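(* Let $\Sigma$ be a closed Riemann surface of genus $g\ge2$ with canonical bundle $K$ and a fixed square root $K^{1/2}$, let $E=\bigoplus_{j=1}^nK^{\frac{n+1-2j}{2}}$, and let $t>0$ be a real parameter. 1. Let $q_n\in H^0(\Sigma,K^n)$, $q_n\not\equiv0$, $n\geq 2$, and let $h_j(t)$ be the metric on $K^{\frac{n+1-2j}{2}}$ given by the harmonic metric of the Higgs bundle $(E,\tilde e_1+tq_ne_{n-1})$. Then at every point $p\in\Sigma$ away from the zeros of $q_n$, as $t\to\infty$, $$h_j(t)=(t|q_n|)^{-\frac{n+1-2j}{n}}\left(1+O\left(t^{-\frac2n}\right)\right)\qquad\text{for all } 1\le j\le n.$$ 2. Let $q_{n-1}\in H^0(\Sigma,K^{n-1})$, $q_{n-1}\not\equiv0$, $n\ge 3$, and let $h_j(t)$ be the metric on $K^{\frac{n+1-2j}{2}}$ given by the harmonic metric of the Higgs bundle $(E,\tilde e_1+tq_{n-1}e_{n-2})$. Then at every point $p\in\Sigma$ away from the zeros of $q_{n-1}$, as $t\to\infty$, $$h_j(t)=\begin{cases}(t|q_{n-1}|)^{-\frac{n+1-2j}{n-1}}\left(1+O\left(t^{-\frac{2}{n-1}}\right)\right)& j=1\text{ and }j=n,\\ (2t|q_{n-1}|)^{-\frac{n+1-2j}{n-1}}\left(1+O\left(t^{-\frac{2}{n-1}}\right)\right)&1<j<n.\end{cases}$$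
   Context: Number the summands of $E$ by $i=1,\dots,n$, the $i$-th one being $K^{(n+1-2i)/2}$. A bundle map $E\to E\otimes K$ is written as an $n\times n$ matrix whose $(a,b)$ entry is a section of $K^{b-a+1}$. $\tilde e_1$ has $(i+1,i)$ entries $1$ for $1\le i\le n-1$ and zeros elsewhere; $q_ne_{n-1}$ has single nonzero entry $q_n$ in position $(1,n)$; $q_{n-1}e_{n-2}$ has nonzero entries $q_{n-1}$ in positions $(1,n-1)$ and $(2,n)$. These Higgs bundles $(E,\phi)$ are stable, and the harmonic metric is the unique Hermitian metric $h$ on $E$ (inducing the trivial metric on $\det E=\mathcal O$) solving $F_{A_h}+[\phi,\phi^{*_h}]=0$ ($A_h$ Chern connection, $F_{A_h}$ curvature, $\phi^{*_h}$ adjoint). It is diagonal: $h=h_1\oplus\cdots\oplus h_n$ with $h_j$ a metric on $K^{(n+1-2j)/2}$ and $h_{n+1-j}=h_j^{-1}$. In a local coordinate $z$, $h_j$ is identified with the positive function $h_j(dz^{(n+1-2j)/2},dz^{(n+1-2j)/2})$ and, if $q_b=f\,dz^b$, $|q_b|$ denotes $|f|$; so $|q_b|^{-(n+1-2j)/b}$ is a Hermitian metric on $K^{(n+1-2j)/2}$ away from the zeros of $q_b$. *)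

theory Defs
  imports
    "HOL-Analysis.Analysis"
    "HOL-Homology.Homology"
    "HOL-Algebra.Free_Abelian_Groups"
    "HOL-Library.Landau_Symbols"
    "Jordan_Normal_Form.Gauss_Jordan_Elimination"
    "Jordan_Normal_Form.Determinant"
    "Jordan_Normal_Form.Schur_Decomposition"
begin

section \<open>Closed Riemann surfaces\<close>

text \<open>A chart is a coordinate domain together with a coordinate function on it.\<close>

type_synonym 'a chart = "'a set \<times> ('a \<Rightarrow> complex)"

abbreviation cdom :: "'a chart \<Rightarrow> 'a set" where "cdom c \<equiv> fst c"
abbreviation coord :: "'a chart \<Rightarrow> 'a \<Rightarrow> complex" where "coord c \<equiv> snd c"

definition image_of :: "'a chart \<Rightarrow> complex set" where
  "image_of c = coord c ` cdom c"

definition overlap :: "'a chart \<Rightarrow> 'a chart \<Rightarrow> complex set" where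
  "overlap c d = coord c ` (cdom c \<inter> cdom d)"

text \<open>The coordinate of \<open>d\<close> as a function of the coordinate of \<open>c\<close>.\<close>

definition transition :: "'a chart \<Rightarrow> 'a chart \<Rightarrow> complex \<Rightarrow> complex" where
  "transition c d = coord d \<circ> inv_into (cdom c) (coord c)"

definition is_chart :: "'a topology \<Rightarrow> 'a chart \<Rightarrow> bool" where
  "is_chart X c \<longleftrightarrow>
     openin X (cdom c) \<and> open (image_of c) \<and>
     homeomorphic_map (subtopology X (cdom c)) (top_of_set (image_of c)) (coord c)"

text \<open>Second countability is automatic here because of compactness.\<close>

definition closed_riemann_surface :: "'a topology \<Rightarrow> 'a chart set \<Rightarrow> bool" where
  "closed_riemann_surface X A \<longleftrightarrow>
     Hausdorff_space X \<and> compact_space X \<and> connected_space X \<and>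
     (\<forall>c\<in>A. is_chart X c) \<and> (\<Union>c\<in>A. cdom c) = topspace X \<and>
     (\<forall>c\<in>A. \<forall>d\<in>A. transition c d holomorphic_on overlap c d)"

text \<open>The genus is half the rank of the first integral singular homology group.\<close>

definition has_genus :: "'a topology \<Rightarrow> nat \<Rightarrow> bool" where
  "has_genus X g \<longleftrightarrow> homology_group 1 X \<cong> free_Abelian_group {..<2 * g}"


section \<open>The bundles\<close>

text \<open>An element of \<open>H\<^sup>0(K\<^sup>b)\<close> is given by its coordinate expressions:
  in the coordinate \<open>z\<close> of the chart \<open>c\<close> it is \<open>q c (z) dz\<^sup>b\<close>.\<close>

definition holomorphic_differential ::
    "'a chart set \<Rightarrow> nat \<Rightarrow> ('a chart \<Rightarrow> complex \<Rightarrow> complex) \<Rightarrow> bool" where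
  "holomorphic_differential A b q \<longleftrightarrow>
     (\<forall>c\<in>A. q c holomorphic_on image_of c) \<and>
     (\<forall>c\<in>A. \<forall>d\<in>A. \<forall>p\<in>cdom c \<inter> cdom d.
        q c (coord c p) = q d (coord d p) * deriv (transition c d) (coord c p) ^ b)"

definition nonzero_differential ::
    "'a chart set \<Rightarrow> ('a chart \<Rightarrow> complex \<Rightarrow> complex) \<Rightarrow> bool" where
  "nonzero_differential A q \<longleftrightarrow> (\<exists>c\<in>A. \<exists>z\<in>image_of c. q c z \<noteq> 0)"

text \<open>A square root \<open>K\<^sup>1\<^sup>/\<^sup>2\<close> of \<open>K\<close>, presented by frames \<open>dz\<^sup>1\<^sup>/\<^sup>2\<close> over the charts of \<open>A\<close>
  whose squares are \<open>dz\<close>: for charts \<open>c\<close>, \<open>d\<close> with coordinates \<open>z\<close>, \<open>w\<close> one has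
  \<open>dw\<^sup>1\<^sup>/\<^sup>2 = \<sigma> c d \<cdot> dz\<^sup>1\<^sup>/\<^sup>2\<close>, where \<open>\<sigma> c d\<close> is a function of \<open>z\<close>.  Every square root has
  such a presentation over an atlas of small (e.g. simply connected) coordinate domains,
  and any local coordinate whose domain carries a frame \<open>dz\<^sup>1\<^sup>/\<^sup>2\<close> can be added to that
  atlas.  Hence a statement for all pairs \<open>(A, \<sigma>)\<close> covers all Riemann surfaces, all
  square roots and all such local coordinates.\<close>

definition sqrt_canonical ::
    "'a chart set \<Rightarrow> ('a chart \<Rightarrow> 'a chart \<Rightarrow> complex \<Rightarrow> complex) \<Rightarrow> bool" where
  "sqrt_canonical A \<sigma> \<longleftrightarrow>
     (\<forall>c\<in>A. \<forall>d\<in>A. \<sigma> c d holomorphic_on overlap c d \<and>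
        (\<forall>z\<in>overlap c d. (\<sigma> c d z)\<^sup>2 = deriv (transition c d) z)) \<and>
     (\<forall>c\<in>A. \<forall>d\<in>A. \<forall>e\<in>A. \<forall>p\<in>cdom c \<inter> cdom d \<inter> cdom e.
        \<sigma> c e (coord c p) = \<sigma> c d (coord c p) * \<sigma> d e (coord d p))"

text \<open>The \<open>j\<close>-th summand of \<open>E\<close>, \<open>1 \<le> j \<le> n\<close>, is the power of \<open>K\<^sup>1\<^sup>/\<^sup>2\<close> with this exponent.\<close>

definition wt :: "nat \<Rightarrow> nat \<Rightarrow> int" where
  "wt n j = int n + 1 - 2 * int j"

text \<open>Fields of \<open>n \<times> n\<close> matrices are written with respect to the frame
  \<open>s\<^sub>j = (dz\<^sup>1\<^sup>/\<^sup>2)\<^sup>m\<close> with \<open>m = wt n j\<close>, \<open>1 \<le> j \<le> n\<close>, of \<open>E\<close>. Matrix entries are indexed from \<open>0\<close>, so the entry in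
  position \<open>(a,b)\<close> in mathematical notation is the entry \<open>(a - 1, b - 1)\<close> below.\<close>

definition e_tilde1 :: "nat \<Rightarrow> complex mat" where
  "e_tilde1 n = mat n n (\<lambda>(a,b). if a = b + 1 then 1 else 0)"

text \<open>The matrices \<open>e\<^sub>n\<^sub>-\<^sub>1\<close> and \<open>e\<^sub>n\<^sub>-\<^sub>2\<close>.\<close>

definition e_n1 :: "nat \<Rightarrow> complex mat" where
  "e_n1 n = mat n n (\<lambda>(a,b). if (a + 1, b + 1) = (1, n) then 1 else 0)"

definition e_n2 :: "nat \<Rightarrow> complex mat" where
  "e_n2 n = mat n n (\<lambda>(a,b). if (a + 1, b + 1) \<in> {(1, n - 1), (2, n)} then 1 else 0)"

text \<open>The Higgs field \<open>e_tilde1 + t q e\<close>; the value at \<open>z\<close> is the coefficient matrix of \<open>dz\<close>.\<close>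

definition higgs_field ::
    "nat \<Rightarrow> complex mat \<Rightarrow> ('a chart \<Rightarrow> complex \<Rightarrow> complex) \<Rightarrow> real
      \<Rightarrow> 'a chart \<Rightarrow> complex \<Rightarrow> complex mat" where
  "higgs_field n e q t = (\<lambda>c z. e_tilde1 n + (of_real t * q c z) \<cdot>\<^sub>m e)"


section \<open>Hermitian metrics and the Hitchin equation\<close>

text \<open>Smoothness of a function on an open subset of the plane, by iterated partial derivatives.\<close>

fun Ck_on :: "nat \<Rightarrow> (complex \<Rightarrow> complex) \<Rightarrow> complex set \<Rightarrow> bool" where
  "Ck_on 0 f S = continuous_on S f"
| "Ck_on (Suc k) f S = ((\<forall>z\<in>S. f differentiable (at z)) \<and>
     Ck_on k (\<lambda>z. frechet_derivative f (at z) 1) S \<and>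
     Ck_on k (\<lambda>z. frechet_derivative f (at z) \<i>) S)"

definition smooth_on :: "(complex \<Rightarrow> complex) \<Rightarrow> complex set \<Rightarrow> bool" where
  "smooth_on f S \<longleftrightarrow> (\<forall>k. Ck_on k f S)"

definition d_z :: "(complex \<Rightarrow> complex) \<Rightarrow> complex \<Rightarrow> complex" where
  "d_z f z = (frechet_derivative f (at z) 1 - \<i> * frechet_derivative f (at z) \<i>) / 2"

definition d_zbar :: "(complex \<Rightarrow> complex) \<Rightarrow> complex \<Rightarrow> complex" where
  "d_zbar f z = (frechet_derivative f (at z) 1 + \<i> * frechet_derivative f (at z) \<i>) / 2"

definition mat_d_z :: "nat \<Rightarrow> (complex \<Rightarrow> complex mat) \<Rightarrow> complex \<Rightarrow> complex mat" where
  "mat_d_z n M z = mat n n (\<lambda>(a,b). d_z (\<lambda>w. M w $$ (a,b)) z)"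

definition mat_d_zbar :: "nat \<Rightarrow> (complex \<Rightarrow> complex mat) \<Rightarrow> complex \<Rightarrow> complex mat" where
  "mat_d_zbar n M z = mat n n (\<lambda>(a,b). d_zbar (\<lambda>w. M w $$ (a,b)) z)"

text \<open>A Hermitian metric \<open>h\<close> on \<open>E\<close> is given by its Gram matrices \<open>H c z\<close>, whose entry in
  position \<open>(a,b)\<close> is \<open>h(s\<^sub>b, s\<^sub>a)\<close> with \<open>s\<^sub>j\<close> the frame above and \<open>h\<close> linear in the first
  argument, so that \<open>h(u,v) = v\<^sup>* H u\<close> for column vectors.  The last conjunct is the
  change of frame between two charts.\<close>

definition hermitian_metric ::
    "'a chart set \<Rightarrow> ('a chart \<Rightarrow> 'a chart \<Rightarrow> complex \<Rightarrow> complex) \<Rightarrow> nat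
      \<Rightarrow> ('a chart \<Rightarrow> complex \<Rightarrow> complex mat) \<Rightarrow> bool" where
  "hermitian_metric A \<sigma> n H \<longleftrightarrow>
     (\<forall>c\<in>A. \<forall>z\<in>image_of c.
        H c z \<in> carrier_mat n n \<and> mat_adjoint (H c z) = H c z \<and>
        (\<forall>v\<in>carrier_vec n. v \<noteq> 0\<^sub>v n \<longrightarrow> Re ((H c z *\<^sub>v v) \<bullet>c v) > 0)) \<and>
     (\<forall>c\<in>A. \<forall>a<n. \<forall>b<n. smooth_on (\<lambda>z. H c z $$ (a,b)) (image_of c)) \<and>
     (\<forall>c\<in>A. \<forall>d\<in>A. \<forall>p\<in>cdom c \<inter> cdom d. \<forall>a<n. \<forall>b<n.
        H d (coord d p) $$ (a,b) =
          cnj (\<sigma> c d (coord c p) powi wt n (a + 1)) * H c (coord c p) $$ (a,b)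
            * \<sigma> c d (coord c p) powi wt n (b + 1))"

abbreviation inv_mat :: "complex mat \<Rightarrow> complex mat" where
  "inv_mat M \<equiv> the (mat_inverse M)"

text \<open>The Chern connection is \<open>d + H\<^sup>-\<^sup>1 \<partial>H\<close>, with curvature \<open>d''(H\<^sup>-\<^sup>1 \<partial>H)\<close>, where \<open>d''\<close> is the
  Dolbeault operator; the following is its coefficient with respect to \<open>dz \<and> cnj dz\<close>,
  whence the sign.\<close>

definition chern_curvature :: "nat \<Rightarrow> (complex \<Rightarrow> complex mat) \<Rightarrow> complex \<Rightarrow> complex mat" where
  "chern_curvature n M z = - mat_d_zbar n (\<lambda>w. inv_mat (M w) * mat_d_z n M w) z"

text \<open>The adjoint of \<open>P\<close> for the inner product \<open>v\<^sup>* M u\<close>.\<close>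

definition adjoint_wrt :: "complex mat \<Rightarrow> complex mat \<Rightarrow> complex mat" where
  "adjoint_wrt M P = inv_mat M * mat_adjoint P * M"

text \<open>For \<open>\<phi> = P dz\<close> the form \<open>[\<phi>, \<phi>\<^sup>*]\<close> is \<open>(P P\<^sup>* - P\<^sup>* P) dz \<and> cnj dz\<close>.  The sum of the weights
  of \<open>E\<close> is \<open>0\<close>, so that \<open>det E\<close> is trivialised by \<open>s\<^sub>1 \<and> \<dots> \<and> s\<^sub>n\<close> and the induced
  metric on it is \<open>det H\<close>.\<close>

definition hitchin_solution ::
    "'a chart set \<Rightarrow> ('a chart \<Rightarrow> 'a chart \<Rightarrow> complex \<Rightarrow> complex) \<Rightarrow> nat
      \<Rightarrow> ('a chart \<Rightarrow> complex \<Rightarrow> complex mat)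
      \<Rightarrow> ('a chart \<Rightarrow> complex \<Rightarrow> complex mat) \<Rightarrow> bool" where
  "hitchin_solution A \<sigma> n \<phi> H \<longleftrightarrow>
     hermitian_metric A \<sigma> n H \<and>
     (\<forall>c\<in>A. \<forall>z\<in>image_of c. Determinant.det (H c z) = 1 \<and>
        chern_curvature n (H c) z +
          (\<phi> c z * adjoint_wrt (H c z) (\<phi> c z) - adjoint_wrt (H c z) (\<phi> c z) * \<phi> c z)
        = 0\<^sub>m n n)"

text \<open>The harmonic metric is the unique solution; metrics are compared only where they are
  meaningful, i.e. on the coordinate domains of \<open>A\<close>.\<close>

definition harmonic_metric ::
    "'a chart set \<Rightarrow> ('a chart \<Rightarrow> 'a chart \<Rightarrow> complex \<Rightarrow> complex) \<Rightarrow> nat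
      \<Rightarrow> ('a chart \<Rightarrow> complex \<Rightarrow> complex mat)
      \<Rightarrow> ('a chart \<Rightarrow> complex \<Rightarrow> complex mat) \<Rightarrow> bool" where
  "harmonic_metric A \<sigma> n \<phi> H \<longleftrightarrow>
     hitchin_solution A \<sigma> n \<phi> H \<and>
     (\<forall>H'. hitchin_solution A \<sigma> n \<phi> H' \<longrightarrow> (\<forall>c\<in>A. \<forall>z\<in>image_of c. H' c z = H c z))"

text \<open>The restriction of the metric to the \<open>j\<close>-th summand, \<open>h(s\<^sub>j, s\<^sub>j)\<close>, \<open>1 \<le> j \<le> n\<close>.\<close>

definition summand_metric ::
    "('a chart \<Rightarrow> complex \<Rightarrow> complex mat) \<Rightarrow> nat \<Rightarrow> 'a chart \<Rightarrow> complex \<Rightarrow> real" where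
  "summand_metric H j c z = Re (H c z $$ (j - 1, j - 1))"

end

theory Submission
  imports Defs "HOL-Complex_Analysis.Cauchy_Integral_Formula"
begin

text \<open>Conjugating the Higgs field by a diagonal matrix of roots of unity multiplies it by a root of
  unity; by uniqueness the harmonic metric is invariant under this conjugation, hence diagonal up to
  the two corner entries in the case of \<open>q\<^sub>n\<^sub>-\<^sub>1\<close>, and these are removed by the symmetry
  \<open>h \<mapsto> h\<^sup>*\<close> (dual metric). The Hitchin equation is then a Toda system.  Let \<open>w\<^sub>j\<close> be the
  logarithm of the quotient of \<open>h\<^sub>j\<close> by the claimed leading term.  The leading terms solve the Toda
  system with zero curvature, so with edge weights \<open>E\<^sub>j\<^sub>k\<close> of order \<open>t\<^sup>2\<^sup>/\<^sup>n\<close> (of order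
  \<open>t\<^sup>2\<^sup>/\<^sup>(\<^sup>n\<^sup>-\<^sup>1\<^sup>)\<close> in the second case), balanced at every vertex,
  \<open>\<Delta>w\<^sub>j = 4 \<Sum>\<^sub>k (E\<^sub>j\<^sub>k exp (w\<^sub>j - w\<^sub>k) - E\<^sub>k\<^sub>j exp (w\<^sub>k - w\<^sub>j))\<close>.
  Consequently \<open>Y = \<Sum>\<^sub>j w\<^sub>j\<^sup>2\<close> satisfies \<open>\<Delta>Y \<ge> \<kappa> Y\<^sup>3\<^sup>/\<^sup>2\<close> with \<open>\<kappa>\<close> of the order of
  the weights, and comparison with a barrier that is infinite on the boundary of a disc of radius
  \<open>R\<close> around \<open>p\<close> gives \<open>\<surd>Y \<le> 96 / (\<kappa> R\<^sup>2)\<close> at \<open>p\<close>.  The argument is local: only the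
  uniqueness of the harmonic metric uses the whole surface.\<close>

section \<open>Local decay for Toda systems\<close>

text \<open>No bound for \<open>w\<close> on the boundary of the disc is available, so a comparison
  that needs boundary values is impossible. The bound d (exp d - 1) \<ge> d^3 / 2 for d \<ge> 0
  makes the estimate interior: a differential inequality with superlinear right hand side controls
  its solutions at the centre whatever they do near the boundary. The size of the weights then is
  the whole rate: \<kappa> of order t^(2/m) gives w = O(t^(-2/m)), with m = n or m = n - 1. Balance
  dictates the leading terms. Read \<open>E\<close> as a flow on the graph whose edges are the
  nonzero entries of the Higgs field. For q_n the graph is one oriented cycle, and the powers of t
  |q| make all its weights equal. For q_(n-1) two cycles share the path from n - 1 down to 2
  (numbering from 1); shared edges carry twice the flow, which is the origin of the factor 2 for 1 <
  j < n. Since ln |q| is harmonic off the zeros, the leading terms have zero curvature.\<close>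

definition second_derivs_on ::
    "complex \<Rightarrow> (complex \<Rightarrow> real) \<Rightarrow> (complex \<Rightarrow> real) \<Rightarrow> (complex \<Rightarrow> real) \<Rightarrow> complex set \<Rightarrow> bool" where
  "second_derivs_on e u p a S \<longleftrightarrow> (\<forall>z\<in>S.
     ((\<lambda>s. u (z + of_real s * e)) has_real_derivative p z) (at 0) \<and>
     ((\<lambda>s. p (z + of_real s * e)) has_real_derivative a z) (at 0))"

text \<open>A relation with explicit witnesses: testing an interior maximum only takes second
  derivatives along the two coordinate lines, so no joint regularity has to be carried through sums
  and squares.\<close>

definition laplacian_on :: "(complex \<Rightarrow> real) \<Rightarrow> (complex \<Rightarrow> real) \<Rightarrow> complex set \<Rightarrow> bool" where
  "laplacian_on u L S \<longleftrightarrow> (\<exists>p a r b. second_derivs_on 1 u p a S \<and> second_derivs_on \<i> u r b S \<and>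
     (\<forall>z\<in>S. L z = a z + b z))"

lemma second_derivs_on_subset:
  "second_derivs_on e u p a S \<Longrightarrow> T \<subseteq> S \<Longrightarrow> second_derivs_on e u p a T"
  unfolding second_derivs_on_def by blast

lemma laplacian_on_subset: "laplacian_on u L S \<Longrightarrow> T \<subseteq> S \<Longrightarrow> laplacian_on u L T"
  unfolding laplacian_on_def using second_derivs_on_subset by (metis subsetD)

lemma laplacian_on_cong: "laplacian_on u L S \<Longrightarrow> (\<And>z. z \<in> S \<Longrightarrow> L z = L' z) \<Longrightarrow> laplacian_on u L' S"
  unfolding laplacian_on_def by metis

lemma second_derivs_on_const: "second_derivs_on e (\<lambda>z. c) (\<lambda>z. 0) (\<lambda>z. 0) S"
  unfolding second_derivs_on_def by (auto intro!: derivative_eq_intros)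

lemma second_derivs_on_lincomb:
  assumes "second_derivs_on e u p a S" "second_derivs_on e v r b S"
  shows "second_derivs_on e (\<lambda>z. k * u z + l * v z) (\<lambda>z. k * p z + l * r z) (\<lambda>z. k * a z + l * b z) S"
  using assms unfolding second_derivs_on_def by (auto intro!: derivative_eq_intros)

lemma second_derivs_on_square:
  assumes "second_derivs_on e u p a S"
  shows "second_derivs_on e (\<lambda>z. (u z)\<^sup>2) (\<lambda>z. 2 * u z * p z) (\<lambda>z. 2 * (p z)\<^sup>2 + 2 * u z * a z) S"
  unfolding second_derivs_on_def
proof (intro ballI conjI)
  fix z assume z: "z \<in> S"
  have u: "((\<lambda>s. u (z + of_real s * e)) has_real_derivative p z) (at 0)"
    and p: "((\<lambda>s. p (z + of_real s * e)) has_real_derivative a z) (at 0)"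
    using assms z unfolding second_derivs_on_def by auto
  show "((\<lambda>s. (u (z + of_real s * e))\<^sup>2) has_real_derivative 2 * u z * p z) (at 0)"
    using u by (auto intro!: derivative_eq_intros)
  show "((\<lambda>s. 2 * u (z + of_real s * e) * p (z + of_real s * e)) has_real_derivative
      2 * (p z)\<^sup>2 + 2 * u z * a z) (at 0)"
    by (rule derivative_eq_intros u p refl)+ (simp add: power2_eq_square algebra_simps)
qed

lemma laplacian_on_const: "laplacian_on (\<lambda>z. c) (\<lambda>z. 0) S"
  unfolding laplacian_on_def using second_derivs_on_const[of 1 c S] second_derivs_on_const[of \<i> c S]
  by (intro exI[of _ "\<lambda>z. 0"]) auto

lemma laplacian_on_lincomb:
  assumes "laplacian_on u L S" "laplacian_on v M S"
  shows "laplacian_on (\<lambda>z. k * u z + l * v z) (\<lambda>z. k * L z + l * M z) S"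
proof -
  obtain p a r b where 1: "second_derivs_on 1 u p a S" "second_derivs_on \<i> u r b S" "\<forall>z\<in>S. L z = a z + b z"
    using assms(1) unfolding laplacian_on_def by blast
  obtain p' a' r' b' where 2: "second_derivs_on 1 v p' a' S" "second_derivs_on \<i> v r' b' S"
    "\<forall>z\<in>S. M z = a' z + b' z"
    using assms(2) unfolding laplacian_on_def by blast
  show ?thesis unfolding laplacian_on_def
    using second_derivs_on_lincomb[OF 1(1) 2(1), of k l] second_derivs_on_lincomb[OF 1(2) 2(2), of k l] 1(3) 2(3)
    by (intro exI conjI) (assumption, assumption, auto simp: algebra_simps)
qed

text \<open>The Laplacian of u^2 is 2 u L plus twice the squared gradient. Only the sign of the
  gradient term is kept, hence an inequality and an unspecified \<open>M\<close>.\<close>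

lemma laplacian_on_square:
  assumes "laplacian_on u L S"
  shows "\<exists>M. laplacian_on (\<lambda>z. (u z)\<^sup>2) M S \<and> (\<forall>z\<in>S. 2 * (u z * L z) \<le> M z)"
proof -
  obtain p a r b where 1: "second_derivs_on 1 u p a S" "second_derivs_on \<i> u r b S" "\<forall>z\<in>S. L z = a z + b z"
    using assms unfolding laplacian_on_def by blast
  let ?M = "\<lambda>z. (2 * (p z)\<^sup>2 + 2 * u z * a z) + (2 * (r z)\<^sup>2 + 2 * u z * b z)"
  have "laplacian_on (\<lambda>z. (u z)\<^sup>2) ?M S"
    unfolding laplacian_on_def
    using second_derivs_on_square[OF 1(1)] second_derivs_on_square[OF 1(2)] by blast
  moreover have "2 * (u z * L z) \<le> ?M z" if "z \<in> S" for z
  proof -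
    have "?M z = 2 * (u z * L z) + 2 * (p z)\<^sup>2 + 2 * (r z)\<^sup>2" using 1(3) that by (simp add: algebra_simps)
    thus ?thesis using zero_le_power2[of "p z"] zero_le_power2[of "r z"] by linarith
  qed
  ultimately show ?thesis by blast
qed

lemma laplacian_on_sum_squares:
  fixes w :: "nat \<Rightarrow> complex \<Rightarrow> real"
  assumes "\<And>j. j < n \<Longrightarrow> laplacian_on (w j) (L j) S"
  shows "\<exists>M. laplacian_on (\<lambda>z. \<Sum>j<n. (w j z)\<^sup>2) M S \<and> (\<forall>z\<in>S. 2 * (\<Sum>j<n. w j z * L j z) \<le> M z)"
  using assms
proof (induction n)
  case 0
  show ?case using laplacian_on_const[of 0 S] by (intro exI[of _ "\<lambda>z. 0"]) simp
next
  case (Suc n)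
  obtain M where M: "laplacian_on (\<lambda>z. \<Sum>j<n. (w j z)\<^sup>2) M S" "\<forall>z\<in>S. 2 * (\<Sum>j<n. w j z * L j z) \<le> M z"
    using Suc by fastforce
  obtain N where N: "laplacian_on (\<lambda>z. (w n z)\<^sup>2) N S" "\<forall>z\<in>S. 2 * (w n z * L n z) \<le> N z"
    using laplacian_on_square[OF Suc.prems[of n]] by auto
  show ?case
    using laplacian_on_lincomb[OF M(1) N(1), of 1 1] M(2) N(2)
    by (intro exI[of _ "\<lambda>z. M z + N z"]) (auto simp: distrib_left intro: add_mono)
qed

section \<open>Interior maxima and the barrier\<close>

lemma second_derivative_le_0_at_max:
  fixes f f' :: "real \<Rightarrow> real"
  assumes d: "d > 0" and f: "\<And>s. \<bar>s\<bar> < d \<Longrightarrow> (f has_real_derivative f' s) (at s)"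
    and f': "(f' has_real_derivative D) (at 0)" and mx: "\<And>s. \<bar>s\<bar> < d \<Longrightarrow> f s \<le> f 0"
  shows "D \<le> 0"
proof (rule ccontr)
  assume "\<not> D \<le> 0"
  have "f' 0 = 0" using DERIV_local_max[of f "f' 0" 0 d] f[of 0] d mx by simp
  with DERIV_pos_inc_right[OF f'] \<open>\<not> D \<le> 0\<close> obtain \<delta> where \<delta>: "\<delta> > 0" "\<And>h. 0 < h \<Longrightarrow> h < \<delta> \<Longrightarrow> 0 < f' h"
    by auto
  define t where "t = min d \<delta> / 2"
  have t: "0 < t" "t < d" "t < \<delta>" using d \<delta> by (auto simp: t_def min_def)
  have "f 0 < f t"
  proof (rule DERIV_pos_imp_increasing_open[OF t(1)])
    show "\<exists>y. (f has_real_derivative y) (at x) \<and> 0 < y" if "0 < x" "x < t" for x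
      using f[of x] \<delta>(2)[of x] that t by (intro exI[of _ "f' x"]) auto
    show "continuous_on {0..t} f"
      by (rule DERIV_continuous_on[where D = f'], rule has_field_derivative_at_within, rule f) (use t in auto)
  qed
  with mx[of t] t show False by auto
qed

lemma norm_add_real_mult_unit_sq:
  assumes "norm (e::complex) = 1"
  shows "(norm (v + of_real s * e))\<^sup>2 = (norm v)\<^sup>2 + 2 * s * (v \<bullet> e) + s\<^sup>2"
proof -
  have "(norm (v + s *\<^sub>R e))\<^sup>2 = (norm v)\<^sup>2 + 2 * s * (v \<bullet> e) + (norm (s *\<^sub>R e))\<^sup>2"
    unfolding power2_norm_eq_inner by (simp add: inner_simps inner_commute algebra_simps)
  thus ?thesis using assms by (simp add: scaleR_conv_of_real norm_mult power_mult_distrib)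
qed

lemma has_real_derivative_divide_power:
  fixes f g :: "real \<Rightarrow> real"
  assumes "(f has_real_derivative f') (at s)" "(g has_real_derivative g') (at s)" "g s \<noteq> 0"
  shows "((\<lambda>s. f s / g s ^ Suc m) has_real_derivative
    (f' / g s ^ Suc m - Suc m * f s * g' / g s ^ (m + 2))) (at s)"
proof -
  have "((\<lambda>s. f s / g s ^ Suc m) has_real_derivative
    (f' * g s ^ Suc m - f s * (Suc m * (g' * g s ^ m))) / (g s ^ Suc m * g s ^ Suc m)) (at s)"
    by (rule derivative_eq_intros assms refl)+ (use assms(3) in auto)
  moreover have "(f' * g s ^ Suc m - f s * (Suc m * (g' * g s ^ m))) / (g s ^ Suc m * g s ^ Suc m)
    = f' / g s ^ Suc m - Suc m * f s * g' / g s ^ (m + 2)"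
    using assms(3) by (simp add: diff_divide_distrib)
  ultimately show ?thesis by simp
qed

text \<open>The right hand side is the second derivative in direction \<open>e\<close> of the
  barrier, which \<open>u\<close> touches from below at \<open>z1\<close>. The power 4 solves 3 p /
  2 = p + 2: the Laplacian of the barrier and its power 3 / 2 both blow up like the power -6 of R^2
  - |z - z0|^2.\<close>

lemma second_derivative_le_barrier:
  assumes u: "second_derivs_on e u p a (ball z0 R)" and e: "norm e = 1" and z1: "z1 \<in> ball z0 R"
    and le: "\<And>z. z \<in> ball z0 R \<Longrightarrow> u z \<le> c / (R\<^sup>2 - (norm (z - z0))\<^sup>2)^4"
    and eq: "u z1 = c / (R\<^sup>2 - (norm (z1 - z0))\<^sup>2)^4"
  shows "a z1 \<le> 8 * c / (R\<^sup>2 - (norm (z1 - z0))\<^sup>2)^5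
    + 80 * ((z1 - z0) \<bullet> e)\<^sup>2 * c / (R\<^sup>2 - (norm (z1 - z0))\<^sup>2)^6"
proof -
  define S where "S = R\<^sup>2 - (norm (z1 - z0))\<^sup>2"
  define \<alpha> where "\<alpha> = (z1 - z0) \<bullet> e"
  \<comment> \<open>Along the line through \<open>z1\<close> the denominator is a quadratic
    polynomial in the parameter, because \<open>e\<close> is a unit vector.\<close>
  define \<sigma> where "\<sigma> s = S - 2 * s * \<alpha> - s\<^sup>2" for s :: real
  have \<sigma>: "R\<^sup>2 - (norm (z1 + of_real s * e - z0))\<^sup>2 = \<sigma> s" for s
    using norm_add_real_mult_unit_sq[OF e, of "z1 - z0" s] unfolding \<sigma>_def S_def \<alpha>_def
    by (simp add: algebra_simps)
  define d where "d = R - norm (z1 - z0)"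
  have d: "d > 0" using z1 by (simp add: d_def dist_norm norm_minus_commute)
  have inb: "z1 + of_real s * e \<in> ball z0 R" if "\<bar>s\<bar> < d" for s
  proof -
    have "norm (z1 + of_real s * e - z0) \<le> norm (z1 - z0) + norm (of_real s * e)"
      by (metis add_diff_eq add.commute diff_add_eq norm_triangle_ineq)
    also have "\<dots> < R" using that e by (simp add: d_def norm_mult)
    finally show ?thesis by (simp add: dist_norm norm_minus_commute)
  qed
  have pos: "\<sigma> s > 0" if "\<bar>s\<bar> < d" for s
  proof -
    have "norm (z1 + of_real s * e - z0) < R" using inb[OF that] by (simp add: dist_norm norm_minus_commute)
    hence "(norm (z1 + of_real s * e - z0))\<^sup>2 < R\<^sup>2" by (intro power_strict_mono) auto
    thus ?thesis using \<sigma>[of s] by simp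
  qed
  have D\<sigma>: "(\<sigma> has_real_derivative - 2 * (\<alpha> + s)) (at s)" for s
    unfolding \<sigma>_def by (auto intro!: derivative_eq_intros)
  define f where "f s = u (z1 + of_real s * e) - c / \<sigma> s ^ 4" for s
  define f' where "f' s = p (z1 + of_real s * e) - 8 * c * (\<alpha> + s) / \<sigma> s ^ 5" for s
  have du: "((\<lambda>s. u (z1 + of_real s * e)) has_real_derivative p (z1 + of_real s * e)) (at s)" if "\<bar>s\<bar> < d" for s
  proof -
    have "((\<lambda>t. u (z1 + of_real s * e + of_real t * e)) has_real_derivative p (z1 + of_real s * e)) (at 0)"
      using u inb[OF that] unfolding second_derivs_on_def by blast
    hence "((\<lambda>t. u (z1 + of_real (t + s) * e)) has_real_derivative p (z1 + of_real s * e)) (at 0)"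
      by (simp add: algebra_simps)
    thus ?thesis using DERIV_shift[of "\<lambda>t. u (z1 + of_real t * e)" "p (z1 + of_real s * e)" 0 s] by simp
  qed
  have "(a z1 - (8 * c / S^5 + 80 * \<alpha>\<^sup>2 * c / S^6)) \<le> 0"
  proof (rule second_derivative_le_0_at_max[OF d, of f f'])
    show "(f has_real_derivative f' s) (at s)" if "\<bar>s\<bar> < d" for s
    proof -
      have "((\<lambda>s. c / \<sigma> s ^ 4) has_real_derivative 8 * c * (\<alpha> + s) / \<sigma> s ^ 5) (at s)"
        by (rule DERIV_cong[OF has_real_derivative_divide_power[OF DERIV_const[of c] D\<sigma>, of s 3, simplified]])
          (use pos[OF that] in \<open>auto simp: field_simps\<close>)
      from DERIV_diff[OF du[OF that] this] show ?thesis unfolding f_def f'_def .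
    qed
    have "((\<lambda>s. 8 * c * (\<alpha> + s) / \<sigma> s ^ 5) has_real_derivative (8 * c / S^5 + 80 * \<alpha>\<^sup>2 * c / S^6)) (at 0)"
    proof -
      have "((\<lambda>s. 8 * c * (\<alpha> + s)) has_real_derivative 8 * c) (at 0)"
        by (auto intro!: derivative_eq_intros)
      from has_real_derivative_divide_power[OF this D\<sigma>, of 4] pos[of 0] d show ?thesis
        by (simp add: \<sigma>_def power2_eq_square algebra_simps)
    qed
    moreover have "((\<lambda>s. p (z1 + of_real s * e)) has_real_derivative a z1) (at 0)"
      using u z1 unfolding second_derivs_on_def by blast
    ultimately show "(f' has_real_derivative (a z1 - (8 * c / S^5 + 80 * \<alpha>\<^sup>2 * c / S^6))) (at 0)"
      unfolding f'_def using DERIV_diff by blast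
    show "f s \<le> f 0" if "\<bar>s\<bar> < d" for s
      using le[OF inb[OF that]] eq \<sigma>[of s] \<sigma>[of 0] unfolding f_def by simp
  qed
  thus ?thesis unfolding S_def \<alpha>_def by simp
qed

text \<open>The barrier is the multiple of \<open>(R\<^sup>2 - |z - z0|\<^sup>2)\<^sup>-\<^sup>4\<close> that touches \<open>Y\<close> from above.\<close>

lemma keller_osserman:
  assumes R: "R > 0" and \<kappa>: "\<kappa> > 0"
    and cont: "continuous_on (cball z0 R) Y" and nn: "\<And>z. z \<in> cball z0 R \<Longrightarrow> Y z \<ge> 0"
    and lap: "laplacian_on Y L (ball z0 R)"
    and ineq: "\<And>z. z \<in> ball z0 R \<Longrightarrow> \<kappa> * sqrt (Y z) ^ 3 \<le> L z"
  shows "sqrt (Y z0) \<le> 96 / (\<kappa> * R\<^sup>2)"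
proof -
  define s where "s z = R\<^sup>2 - (norm (z - z0))\<^sup>2" for z
  define f where "f z = Y z * s z ^ 4" for z
  have "continuous_on (cball z0 R) f"
    unfolding f_def s_def by (intro continuous_intros cont)
  then obtain z1 where z1: "z1 \<in> cball z0 R" "\<And>z. z \<in> cball z0 R \<Longrightarrow> f z \<le> f z1"
    using continuous_attains_sup[of "cball z0 R" f] R by auto
  show ?thesis
  proof (cases "Y z0 = 0")
    case True
    thus ?thesis using R \<kappa> by simp
  next
    case False
    hence Y0: "Y z0 > 0" using nn[of z0] R by simp
    have f0: "f z0 = Y z0 * R ^ 8" unfolding f_def s_def by simp
    have f1: "f z1 \<ge> Y z0 * R ^ 8" using z1(2)[of z0] R f0 by simp
    have "f z1 > 0" using f1 Y0 R by (smt (verit) mult_pos_pos zero_less_power)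
    \<comment> \<open>\<open>f\<close> vanishes on the boundary circle, so a positive maximum is
      attained inside.\<close>
    have "norm (z1 - z0) \<noteq> R" using \<open>f z1 > 0\<close> unfolding f_def s_def by auto
    hence z1b: "z1 \<in> ball z0 R" using z1(1) by (simp add: dist_norm norm_minus_commute)
    have spos: "s z > 0" if "z \<in> ball z0 R" for z
    proof -
      have "norm (z - z0) < R" using that by (simp add: dist_norm norm_minus_commute)
      hence "(norm (z - z0))\<^sup>2 < R\<^sup>2" by (intro power_strict_mono) auto
      thus ?thesis unfolding s_def by simp
    qed
    define c where "c = f z1"
    define S where "S = s z1"
    have S: "S > 0" using spos[OF z1b] unfolding S_def .
    have le: "Y z \<le> c / (R\<^sup>2 - (norm (z - z0))\<^sup>2)^4" if "z \<in> ball z0 R" for z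
      using z1(2)[of z] that spos[OF that] unfolding c_def f_def s_def[symmetric] by (simp add: field_simps)
    have eq: "Y z1 = c / (R\<^sup>2 - (norm (z1 - z0))\<^sup>2)^4"
      using spos[OF z1b] unfolding c_def f_def s_def[symmetric] by simp
    obtain p a r b where 1: "second_derivs_on 1 Y p a (ball z0 R)" "second_derivs_on \<i> Y r b (ball z0 R)"
      "\<And>z. z \<in> ball z0 R \<Longrightarrow> L z = a z + b z"
      using lap unfolding laplacian_on_def by blast
    have "L z1 \<le> 16 * c / S^5 + 80 * (norm (z1 - z0))\<^sup>2 * c / S^6"
    proof -
      have "a z1 \<le> 8 * c / S^5 + 80 * (Re (z1 - z0))\<^sup>2 * c / S^6"
        using second_derivative_le_barrier[OF 1(1) _ z1b le eq] unfolding S_def s_def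
        by (simp add: inner_complex_def)
      moreover have "b z1 \<le> 8 * c / S^5 + 80 * (Im (z1 - z0))\<^sup>2 * c / S^6"
        using second_derivative_le_barrier[OF 1(2) _ z1b le eq] unfolding S_def s_def
        by (simp add: inner_complex_def)
      moreover have "16 * c / S^5 = 8 * c / S^5 + 8 * c / S^5" by simp
      moreover have "80 * (norm (z1 - z0))\<^sup>2 * c / S^6 =
          80 * (Re (z1 - z0))\<^sup>2 * c / S^6 + 80 * (Im (z1 - z0))\<^sup>2 * c / S^6"
        by (simp only: cmod_power2 distrib_left distrib_right add_divide_distrib)
      ultimately show ?thesis using 1(3)[OF z1b] by linarith
    qed
    \<comment> \<open>16 + 80, because \<open>S\<close> and the squared distance from
      \<open>z1\<close> to \<open>z0\<close> are both at most R^2.\<close>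
    also have "\<dots> \<le> 96 * R\<^sup>2 * c / S^6"
    proof -
      have "16 * c / S^5 = 16 * S * c / S^6" using S by (simp add: field_simps power_numeral_reduce)
      moreover have "16 * S * c + 80 * (norm (z1 - z0))\<^sup>2 * c \<le> 96 * R\<^sup>2 * c"
      proof -
        have "16 * S + 80 * (norm (z1 - z0))\<^sup>2 \<le> 96 * R\<^sup>2"
          proof -
            have "16 * (x - y) + 80 * y \<le> 96 * x" if "0 < x - y" "0 \<le> y" for x y :: real
              using that by (simp add: algebra_simps)
            from this[OF _ zero_le_power2] show ?thesis using S unfolding S_def s_def by blast
          qed
        from mult_right_mono[OF this, of c] \<open>f z1 > 0\<close> show ?thesis by (simp add: c_def algebra_simps)
      qed
      ultimately show ?thesis using S by (simp add: add_divide_distrib[symmetric] divide_right_mono)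
    qed
    finally have L: "\<kappa> * sqrt (Y z1) ^ 3 \<le> 96 * R\<^sup>2 * c / S^6" using ineq[OF z1b] by simp
    define y where "y = sqrt (Y z1)"
    have Y1: "Y z1 > 0" using \<open>f z1 > 0\<close> S unfolding f_def S_def by (simp add: zero_less_mult_iff)
    have y: "y > 0" "Y z1 = y\<^sup>2" using Y1 unfolding y_def by auto
    have c: "c = y\<^sup>2 * S^4" unfolding c_def f_def S_def y(2) ..
    \<comment> \<open>With c = y^2 S^4 the inequality at \<open>z1\<close> is cubic in
      \<open>y\<close> on the left and quadratic on the right. This is where superlinearity yields a
      bound.\<close>
    have "\<kappa> * y * y\<^sup>2 \<le> 96 * R\<^sup>2 / S\<^sup>2 * y\<^sup>2"
      using L S unfolding y_def[symmetric] c by (simp add: field_simps power_numeral_reduce)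
    hence "\<kappa> * y \<le> 96 * R\<^sup>2 / S\<^sup>2" using y by (simp add: mult_right_le_imp_le)
    hence yS: "y * S\<^sup>2 \<le> 96 * R\<^sup>2 / \<kappa>" using S \<kappa> by (simp add: field_simps)
    \<comment> \<open>Maximality of \<open>z1\<close> transfers the bound to the centre.\<close>
    have "Y z0 * R^8 \<le> y\<^sup>2 * S^4" using f1 c unfolding c_def by simp
    hence "sqrt (Y z0 * R^8) \<le> sqrt (y\<^sup>2 * S^4)" by simp
    moreover have "sqrt (Y z0 * R^8) = sqrt (Y z0) * R^4"
      using R by (simp add: real_sqrt_mult real_sqrt_unique[of "R^4"])
    moreover have "sqrt (y\<^sup>2 * S^4) = y * S\<^sup>2"
      using y S by (intro real_sqrt_unique) (auto simp: power_mult_distrib)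
    ultimately have "sqrt (Y z0) * R^4 \<le> 96 * R\<^sup>2 / \<kappa>" using yS by simp
    thus ?thesis using R \<kappa> by (simp add: field_simps power_numeral_reduce)
  qed
qed

section \<open>Coercivity and decay for balanced weights\<close>

text \<open>By balance the right hand side is \<open>\<Sum> E\<^sub>j\<^sub>k d (exp d - 1)\<close> with \<open>d = w\<^sub>j - w\<^sub>k\<close>, a sum of nonnegative
  terms, in which the edge with the largest \<open>d\<close> contributes at least \<open>b0 d\<^sup>3 / 2\<close>.  The hypothesis on
  \<open>K\<close> expresses that the edges in \<open>T\<close> form a strongly connected graph.\<close>

lemma toda_coercive:
  fixes E :: "nat \<Rightarrow> nat \<Rightarrow> real" and w :: "nat \<Rightarrow> real"
  assumes E: "\<And>j k. j < n \<Longrightarrow> k < n \<Longrightarrow> 0 \<le> E j k"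
    and bal: "\<And>j. j < n \<Longrightarrow> (\<Sum>k<n. E j k) = (\<Sum>k<n. E k j)"
    and conn: "\<And>M. 0 \<le> M \<Longrightarrow> (\<And>j k. (j, k) \<in> T \<Longrightarrow> w j - w k \<le> M) \<Longrightarrow>
                 (\<And>j k. j < n \<Longrightarrow> k < n \<Longrightarrow> w j - w k \<le> K * M)"
    and T: "T \<subseteq> {..<n} \<times> {..<n}" and b0: "0 < b0" and Tb: "\<And>j k. (j, k) \<in> T \<Longrightarrow> b0 \<le> E j k"
    and sum0: "(\<Sum>j<n. w j) = 0" and K: "K > 0" and n: "n > 0"
  shows "b0 / 2 * (sqrt (\<Sum>j<n. (w j)\<^sup>2) / (n * K)) ^ 3
    \<le> (\<Sum>j<n. w j * (\<Sum>k<n. E j k * exp (w j - w k) - E k j * exp (w k - w j)))"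
proof -
  define F where "F j k = E j k * ((w j - w k) * (exp (w j - w k) - 1))" for j k
  \<comment> \<open>Summation by parts: the two contributions of an edge are collected with the
    common factor w_j - w_k.\<close>
  have "(\<Sum>j<n. w j * (\<Sum>k<n. E k j * exp (w k - w j))) = (\<Sum>j<n. \<Sum>k<n. w j * (E k j * exp (w k - w j)))"
    by (simp add: sum_distrib_left)
  also have "\<dots> = (\<Sum>j<n. \<Sum>k<n. w k * (E j k * exp (w j - w k)))" by (rule sum.swap)
  finally have s1: "(\<Sum>j<n. w j * (\<Sum>k<n. E k j * exp (w k - w j))) = \<dots>" .
  \<comment> \<open>By balance the differences w_j - w_k, weighted by \<open>E\<close>, sum to 0; so
    the -1 in \<open>F\<close> can be inserted for free.\<close>
  have "(\<Sum>j<n. \<Sum>k<n. w k * E j k) = (\<Sum>k<n. \<Sum>j<n. w k * E j k)" by (rule sum.swap)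
  also have "\<dots> = (\<Sum>k<n. w k * (\<Sum>j<n. E k j))" using bal by (simp add: sum_distrib_left[symmetric])
  finally have s2: "(\<Sum>j<n. \<Sum>k<n. w k * E j k) = (\<Sum>j<n. \<Sum>k<n. w j * E j k)" by (simp add: sum_distrib_left)
  have "(\<Sum>j<n. \<Sum>k<n. F j k) = (\<Sum>j<n. \<Sum>k<n. (w j * (E j k * exp (w j - w k)) - w k * (E j k * exp (w j - w k)))
      - (w j * E j k - w k * E j k))"
    unfolding F_def by (intro sum.cong) (auto simp: algebra_simps)
  also have "\<dots> = (\<Sum>j<n. w j * (\<Sum>k<n. E j k * exp (w j - w k) - E k j * exp (w k - w j)))"
    using s1 s2 by (simp add: sum_subtractf sum_distrib_left right_diff_distrib)
  finally have rhs: "(\<Sum>j<n. w j * (\<Sum>k<n. E j k * exp (w j - w k) - E k j * exp (w k - w j)))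
    = (\<Sum>j<n. \<Sum>k<n. F j k)" ..
  have Fnn: "0 \<le> F j k" if "j < n" "k < n" for j k
  proof -
    have "0 \<le> (w j - w k) * (exp (w j - w k) - 1)"
      by (cases "w j - w k \<ge> 0") (auto intro: mult_nonneg_nonneg mult_nonpos_nonpos)
    thus ?thesis unfolding F_def using E[OF that] by simp
  qed
  \<comment> \<open>The inserted 0 makes the set nonempty and its maximum nonnegative. If
    \<open>M\<close> is 0 it need not come from an edge, which is why that case is split off
    below.\<close>
  define D where "D = insert 0 ((\<lambda>(j, k). w j - w k) ` T)"
  have finD: "finite D" unfolding D_def using finite_subset[OF T] by simp
  define M where "M = Max D"
  have M0: "0 \<le> M" unfolding M_def using finD by (intro Max_ge) (auto simp: D_def)
  have MT: "w j - w k \<le> M" if "(j, k) \<in> T" for j k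
    unfolding M_def using finD that by (intro Max_ge) (auto simp: D_def)
  have wd: "w j - w k \<le> K * M" if "j < n" "k < n" for j k using conn[OF M0 MT that] .
  \<comment> \<open>The \<open>w j\<close> have mean 0, so each of them is an average of
    differences.\<close>
  have wb: "\<bar>w j\<bar> \<le> K * M" if j: "j < n" for j
  proof -
    have "real n * w j = (\<Sum>k<n. w j - w k)" using sum0 by (simp add: sum_subtractf)
    moreover have "(\<Sum>k<n. w j - w k) \<le> (\<Sum>k<n. K * M)" by (rule sum_mono) (use wd j in auto)
    moreover have "(\<Sum>k<n. w k - w j) \<le> (\<Sum>k<n. K * M)" by (rule sum_mono) (use wd j in auto)
    moreover have "- (real n * w j) = (\<Sum>k<n. w k - w j)" using sum0 by (simp add: sum_subtractf)
    ultimately have "real n * w j \<le> real n * (K * M)" "real n * (- w j) \<le> real n * (K * M)" by auto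
    hence "w j \<le> K * M" "- w j \<le> K * M" using n by (simp_all only: mult_le_cancel_left_pos of_nat_0_less_iff)
    thus ?thesis by linarith
  qed
  have "(\<Sum>j<n. (w j)\<^sup>2) \<le> (\<Sum>j<n. (K * M)\<^sup>2)"
    by (rule sum_mono) (use wb in \<open>auto simp: abs_le_square_iff[symmetric] intro: order.trans[OF _ abs_ge_self]\<close>)
  also have "\<dots> = n * (K * M)\<^sup>2" by simp
  also have "\<dots> \<le> (n * (K * M))\<^sup>2"
  proof -
    have "real n \<le> (real n)\<^sup>2" using n by (simp add: power2_eq_square)
    from mult_right_mono[OF this, of "(K * M)\<^sup>2"] show ?thesis by (simp add: power_mult_distrib)
  qed
  finally have "sqrt (\<Sum>j<n. (w j)\<^sup>2) \<le> n * (K * M)"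
    using K M0 n by (intro real_le_lsqrt) (auto intro: sum_nonneg)
  hence sM: "sqrt (\<Sum>j<n. (w j)\<^sup>2) / (n * K) \<le> M" using n K by (simp add: field_simps)
  have "b0 / 2 * (sqrt (\<Sum>j<n. (w j)\<^sup>2) / (n * K)) ^ 3 \<le> b0 / 2 * M ^ 3"
    using sM b0 n K by (intro mult_left_mono power_mono) (auto intro!: divide_nonneg_nonneg sum_nonneg)
  also have "\<dots> \<le> (\<Sum>j<n. \<Sum>k<n. F j k)"
  proof (cases "M = 0")
    case True
    thus ?thesis using Fnn by (auto intro!: sum_nonneg)
  next
    case False
    have "M \<in> D" unfolding M_def using finD by (intro Max_in) (auto simp: D_def)
    with False obtain j k where jk: "(j, k) \<in> T" "M = w j - w k" unfolding D_def by auto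
    have j: "j < n" and k: "k < n" using jk T by auto
    have "M\<^sup>2 / 2 \<le> exp M - 1" using exp_lower_Taylor_quadratic[OF M0] M0 by simp
    hence "b0 * (M * (M\<^sup>2 / 2)) \<le> E j k * (M * (exp M - 1))"
      using Tb[OF jk(1)] b0 M0 by (intro mult_mono) (auto intro: mult_nonneg_nonneg)
    hence "b0 / 2 * M ^ 3 \<le> F j k" unfolding F_def jk(2)[symmetric] by (simp add: power_numeral_reduce)
    also have "\<dots> \<le> (\<Sum>k<n. F j k)" using k j Fnn by (intro member_le_sum) auto
    also have "\<dots> \<le> (\<Sum>j<n. \<Sum>k<n. F j k)" using j Fnn
      by (intro member_le_sum[of j _ "\<lambda>j. \<Sum>k<n. F j k"]) (auto intro: sum_nonneg)
    finally show ?thesis .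
  qed
  finally show ?thesis unfolding rhs .
qed

text \<open>The bound contains no values of \<open>w\<close> on the boundary of the disc. In the
  application \<open>b0\<close>, the size of the weights, is the only quantity on the right that
  depends on \<open>t\<close>.\<close>

lemma toda_decay:
  fixes w :: "nat \<Rightarrow> complex \<Rightarrow> real" and E :: "complex \<Rightarrow> nat \<Rightarrow> nat \<Rightarrow> real"
  assumes R: "R > 0"
    and cont: "\<And>j. j < n \<Longrightarrow> continuous_on (cball z0 R) (w j)"
    and lap: "\<And>j. j < n \<Longrightarrow> laplacian_on (w j)
       (\<lambda>z. 4 * (\<Sum>k<n. E z j k * exp (w j z - w k z) - E z k j * exp (w k z - w j z))) (ball z0 R)"
    and E: "\<And>z j k. z \<in> ball z0 R \<Longrightarrow> j < n \<Longrightarrow> k < n \<Longrightarrow> 0 \<le> E z j k"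
    and bal: "\<And>z j. z \<in> ball z0 R \<Longrightarrow> j < n \<Longrightarrow> (\<Sum>k<n. E z j k) = (\<Sum>k<n. E z k j)"
    and conn: "\<And>(v :: nat \<Rightarrow> real) M. 0 \<le> M \<Longrightarrow> (\<And>j k. (j, k) \<in> T \<Longrightarrow> v j - v k \<le> M) \<Longrightarrow>
                 (\<And>j k. j < n \<Longrightarrow> k < n \<Longrightarrow> v j - v k \<le> K * M)"
    and T: "T \<subseteq> {..<n} \<times> {..<n}" and b0: "0 < b0"
    and Tb: "\<And>z j k. z \<in> ball z0 R \<Longrightarrow> (j, k) \<in> T \<Longrightarrow> b0 \<le> E z j k"
    and sum0: "\<And>z. z \<in> ball z0 R \<Longrightarrow> (\<Sum>j<n. w j z) = 0" and K: "K > 0" and n: "n > 0" and j: "j < n"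
  shows "\<bar>w j z0\<bar> \<le> 24 * (n * K) ^ 3 / (b0 * R\<^sup>2)"
proof -
  let ?L = "\<lambda>j z. 4 * (\<Sum>k<n. E z j k * exp (w j z - w k z) - E z k j * exp (w k z - w j z))"
  let ?Y = "\<lambda>z. \<Sum>j<n. (w j z)\<^sup>2"
  obtain M where M: "laplacian_on ?Y M (ball z0 R)" "\<And>z. z \<in> ball z0 R \<Longrightarrow> 2 * (\<Sum>j<n. w j z * ?L j z) \<le> M z"
    using laplacian_on_sum_squares[of n w ?L, OF lap] by blast
  \<comment> \<open>2 from squaring, 4 from the Laplacian and 1 / 2 from
    \<open>toda_coercive\<close> give 4; then 96 / 4 = 24.\<close>
  define \<kappa> where "\<kappa> = 4 * b0 / (n * K) ^ 3"
  have \<kappa>: "\<kappa> > 0" unfolding \<kappa>_def using b0 K n by simp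
  have "sqrt (?Y z0) \<le> 96 / (\<kappa> * R\<^sup>2)"
  proof (rule keller_osserman[OF R \<kappa> _ _ M(1)])
    show "continuous_on (cball z0 R) ?Y" by (intro continuous_intros cont) auto
    show "\<kappa> * sqrt (?Y z) ^ 3 \<le> M z" if z: "z \<in> ball z0 R" for z
    proof -
      have "b0 / 2 * (sqrt (?Y z) / (n * K)) ^ 3
        \<le> (\<Sum>j<n. w j z * (\<Sum>k<n. E z j k * exp (w j z - w k z) - E z k j * exp (w k z - w j z)))"
        by (rule toda_coercive[where T = T, OF E[OF z] bal[OF z] conn[of _ "\<lambda>j. w j z"] T b0 Tb[OF z] sum0[OF z] K n])
      moreover have S: "(\<Sum>j<n. w j z * ?L j z) =
          4 * (\<Sum>j<n. w j z * (\<Sum>k<n. E z j k * exp (w j z - w k z) - E z k j * exp (w k z - w j z)))"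
        by (subst sum_distrib_left) (intro sum.cong refl, simp only: mult.left_commute)
      ultimately have "8 * (b0 / 2 * (sqrt (?Y z) / (n * K)) ^ 3) \<le> 2 * (\<Sum>j<n. w j z * ?L j z)"
        by (simp add: S)
      also have "\<dots> \<le> M z" by (rule M(2)[OF z])
      finally show ?thesis unfolding \<kappa>_def by (simp add: power_divide)
    qed
  qed (auto intro: sum_nonneg)
  moreover have "\<bar>w j z0\<bar> \<le> sqrt (?Y z0)"
  proof -
    have "(w j z0)\<^sup>2 \<le> ?Y z0" using j by (intro member_le_sum) auto
    thus ?thesis by (simp add: real_le_rsqrt)
  qed
  moreover have "96 / (\<kappa> * R\<^sup>2) = 24 * (n * K) ^ 3 / (b0 * R\<^sup>2)"
    unfolding \<kappa>_def using b0 R K n by (simp add: field_simps)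
  ultimately show ?thesis by simp
qed

section \<open>Calculus in a coordinate\<close>

text \<open>Bridge from the Frechet derivatives in the definition of smoothness to the derivatives
  along lines in \<open>second_derivs_on\<close>.\<close>

lemma differentiable_has_vector_derivative_line:
  fixes f :: "complex \<Rightarrow> complex"
  assumes "f differentiable (at z)"
  shows "((\<lambda>s. f (z + of_real s * e)) has_vector_derivative frechet_derivative f (at z) e) (at 0)"
proof -
  let ?F = "frechet_derivative f (at z)"
  have F: "(f has_derivative ?F) (at (z + of_real 0 * e))"
    using assms by (simp add: frechet_derivative_works[symmetric])
  have "((\<lambda>s. z + of_real s * e) has_derivative (\<lambda>s. of_real s * e)) (at 0)"
    by (auto intro!: derivative_eq_intros)
  from has_derivative_compose[OF this F]
  have "((\<lambda>s. f (z + of_real s * e)) has_derivative (\<lambda>s. ?F (of_real s * e))) (at 0)" .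
  moreover have "?F (of_real s * e) = s *\<^sub>R ?F e" for s
    using linear_cmul[OF linear_frechet_derivative[OF assms], of s e] by (simp add: scaleR_conv_of_real)
  ultimately show ?thesis unfolding has_vector_derivative_def by simp
qed

lemma has_real_derivative_Re_line:
  fixes f :: "complex \<Rightarrow> complex"
  shows
  "f differentiable (at z) \<Longrightarrow>
    ((\<lambda>s. Re (f (z + of_real s * e))) has_real_derivative Re (frechet_derivative f (at z) e)) (at 0)"
  using has_field_derivative_Re[OF differentiable_has_vector_derivative_line] .

lemma has_real_derivative_Im_line:
  fixes f :: "complex \<Rightarrow> complex"
  shows
  "f differentiable (at z) \<Longrightarrow>
    ((\<lambda>s. Im (f (z + of_real s * e))) has_real_derivative Im (frechet_derivative f (at z) e)) (at 0)"
  using has_field_derivative_Im[OF differentiable_has_vector_derivative_line] .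

lemma eventually_line_in_open:
  fixes z e :: complex
  assumes "open S" "z \<in> S"
  shows "eventually (\<lambda>s::real. z + of_real s * e \<in> S) (nhds 0)"
proof -
  have "isCont (\<lambda>s::real. z + of_real s * e) 0" by (intro continuous_intros)
  moreover have "z + of_real 0 * e \<in> S" using assms by simp
  ultimately show ?thesis
    using assms(1) unfolding continuous_at_open eventually_nhds by (metis)
qed

lemma laplacian_on_eq_fun:
  assumes S: "open S" and eq: "\<And>z. z \<in> S \<Longrightarrow> u z = v z" and u: "laplacian_on u L S"
  shows "laplacian_on v L S"
proof -
  have *: "second_derivs_on e v p a S" if "second_derivs_on e u p a S" for e p a
    unfolding second_derivs_on_def
  proof (intro ballI conjI)
    fix z assume z: "z \<in> S"
    have "eventually (\<lambda>s::real. u (z + of_real s * e) = v (z + of_real s * e)) (nhds 0)"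
      using eventually_line_in_open[OF S z] by (rule eventually_mono) (rule eq)
    from DERIV_cong_ev[OF refl this refl]
    show "((\<lambda>s. v (z + of_real s * e)) has_real_derivative p z) (at 0)"
      using that z unfolding second_derivs_on_def by blast
  qed (use that in \<open>auto simp: second_derivs_on_def\<close>)
  show ?thesis using u * unfolding laplacian_on_def by metis
qed

text \<open>The second derivative in direction \<open>e\<close> is the real part of g'' e^2, and the
  squares of 1 and \<i> add up to 0.\<close>

lemma laplacian_on_Re_holomorphic:
  assumes "g holomorphic_on S" "open S"
  shows "laplacian_on (\<lambda>z. Re (g z)) (\<lambda>z. 0) S"
proof -
  have *: "second_derivs_on e (\<lambda>z. Re (g z)) (\<lambda>z. Re (deriv g z * e)) (\<lambda>z. Re (deriv (deriv g) z * e * e)) S" for e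
    unfolding second_derivs_on_def
  proof (intro ballI conjI)
    fix z assume z: "z \<in> S"
    have 1: "(g has_field_derivative deriv g z) (at z)"
      using assms z by (simp add: holomorphic_derivI)
    have 2: "(deriv g has_field_derivative deriv (deriv g) z) (at z)"
      using holomorphic_deriv[OF assms] assms z by (simp add: holomorphic_derivI)
    have fd: "frechet_derivative f (at z) = (*) d" "f differentiable (at z)"
      if "(f has_field_derivative d) (at z)" for f and d :: complex
      using that frechet_derivative_at[of f "(*) d" z] unfolding has_field_derivative_def differentiable_def by auto
    show "((\<lambda>s. Re (g (z + of_real s * e))) has_real_derivative Re (deriv g z * e)) (at 0)"
      using has_real_derivative_Re_line[OF fd(2)[OF 1], of e] fd(1)[OF 1] by simp
    have 3: "((\<lambda>z. deriv g z * e) has_field_derivative deriv (deriv g) z * e) (at z)"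
      using 2 by (auto intro!: derivative_eq_intros)
    show "((\<lambda>s. Re (deriv g (z + of_real s * e) * e)) has_real_derivative Re (deriv (deriv g) z * e * e)) (at 0)"
      using has_real_derivative_Re_line[OF fd(2)[OF 3], of e] fd(1)[OF 3] by simp
  qed
  show ?thesis unfolding laplacian_on_def
    using *[of 1] *[of \<i>] by (intro exI conjI) (assumption, assumption, simp)
qed

text \<open>On a disc \<open>q\<close> has a holomorphic logarithm, whose real part is ln
  |q|.\<close>

lemma laplacian_on_ln_norm_holomorphic:
  assumes q: "q holomorphic_on ball z0 R" "\<And>z. z \<in> ball z0 R \<Longrightarrow> q z \<noteq> 0"
  shows "laplacian_on (\<lambda>z. ln (norm (q z))) (\<lambda>z. 0) (ball z0 R)"
proof -
  obtain g where g: "g holomorphic_on ball z0 R" "\<And>z. z \<in> ball z0 R \<Longrightarrow> q z = exp (g z)"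
    using contractible_imp_holomorphic_log[OF q(1) convex_imp_contractible q(2)] by auto
  show ?thesis
    by (rule laplacian_on_eq_fun[OF open_ball _ laplacian_on_Re_holomorphic[OF g(1) open_ball]]) (simp add: g(2))
qed

text \<open>The Laplacian is 4 \<open>d_zbar\<close> \<open>d_z\<close>, and \<open>d_z\<close> of
  ln h is the quotient d_z h / h. It is written with this quotient because for a diagonal metric the
  quotient is an entry of the connection form. Its real and imaginary parts are half the
  x-derivative and minus half the y-derivative of ln h.\<close>

lemma laplacian_on_ln_Re:
  assumes S: "open S" and h: "\<And>z. z \<in> S \<Longrightarrow> h differentiable (at z)"
    and real: "\<And>z. z \<in> S \<Longrightarrow> Im (h z) = 0" and pos: "\<And>z. z \<in> S \<Longrightarrow> Re (h z) > 0"
    and G: "\<And>z. z \<in> S \<Longrightarrow> (\<lambda>w. d_z h w / h w) differentiable (at z)"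
  shows "laplacian_on (\<lambda>z. ln (Re (h z))) (\<lambda>z. 4 * Re (d_zbar (\<lambda>w. d_z h w / h w) z)) S"
proof -
  let ?G = "\<lambda>w. d_z h w / h w"
  have Im0: "Im (frechet_derivative h (at z) e) = 0" if z: "z \<in> S" for z e
  proof -
    have "eventually (\<lambda>s::real. Im (h (z + of_real s * e)) = 0) (nhds 0)"
      using eventually_line_in_open[OF S z] by (rule eventually_mono) (rule real)
    from DERIV_cong_ev[OF refl this refl] has_real_derivative_Im_line[OF h[OF z], of e]
    have "((\<lambda>s::real. 0) has_real_derivative Im (frechet_derivative h (at z) e)) (at 0)" by blast
    from DERIV_unique[OF this DERIV_const] show ?thesis .
  qed
  have ln: "((\<lambda>s. ln (Re (h (z + of_real s * e)))) has_real_derivative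
      Re (frechet_derivative h (at z) e) / Re (h z)) (at 0)" if z: "z \<in> S" for z e
    using DERIV_chain2[OF DERIV_ln_divide has_real_derivative_Re_line[OF h[OF z], of e]] pos[OF z]
    by simp
  have Geq: "2 * Re (?G z) = Re (frechet_derivative h (at z) 1) / Re (h z)"
    "- 2 * Im (?G z) = Re (frechet_derivative h (at z) \<i>) / Re (h z)" if z: "z \<in> S" for z
  proof -
    have hz: "h z = of_real (Re (h z))" using real[OF z] by (simp add: complex_eq_iff)
    have "?G z = d_z h z / of_real (Re (h z))" using hz by metis
    moreover have "Re (d_z h z) = Re (frechet_derivative h (at z) 1) / 2"
      "Im (d_z h z) = - (Re (frechet_derivative h (at z) \<i>) / 2)"
      using Im0[OF z] unfolding d_z_def by simp_all
    ultimately show "2 * Re (?G z) = Re (frechet_derivative h (at z) 1) / Re (h z)"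
      "- 2 * Im (?G z) = Re (frechet_derivative h (at z) \<i>) / Re (h z)"
      by (simp_all only: Re_divide_of_real Im_divide_of_real)
  qed
  have "second_derivs_on 1 (\<lambda>z. ln (Re (h z))) (\<lambda>z. 2 * Re (?G z))
      (\<lambda>z. 2 * Re (frechet_derivative ?G (at z) 1)) S"
    unfolding second_derivs_on_def
  proof (intro ballI conjI)
    fix z assume z: "z \<in> S"
    show "((\<lambda>s. ln (Re (h (z + of_real s * 1)))) has_real_derivative 2 * Re (?G z)) (at 0)"
      using ln[OF z, of 1] Geq(1)[OF z] by simp
    show "((\<lambda>s. 2 * Re (?G (z + of_real s * 1))) has_real_derivative
        2 * Re (frechet_derivative ?G (at z) 1)) (at 0)"
      by (rule DERIV_cmult[OF has_real_derivative_Re_line[OF G[OF z], of 1]])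
  qed
  moreover have "second_derivs_on \<i> (\<lambda>z. ln (Re (h z))) (\<lambda>z. - 2 * Im (?G z))
      (\<lambda>z. - 2 * Im (frechet_derivative ?G (at z) \<i>)) S"
    unfolding second_derivs_on_def
  proof (intro ballI conjI)
    fix z assume z: "z \<in> S"
    show "((\<lambda>s. ln (Re (h (z + of_real s * \<i>)))) has_real_derivative - 2 * Im (?G z)) (at 0)"
      using ln[OF z, of \<i>] Geq(2)[OF z] by simp
    show "((\<lambda>s. - 2 * Im (?G (z + of_real s * \<i>))) has_real_derivative
        - 2 * Im (frechet_derivative ?G (at z) \<i>)) (at 0)"
      by (rule DERIV_cmult[OF has_real_derivative_Im_line[OF G[OF z], of \<i>]])
  qed
  moreover have "4 * Re (d_zbar ?G z) = 2 * Re (frechet_derivative ?G (at z) 1)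
      + - 2 * Im (frechet_derivative ?G (at z) \<i>)" for z
    unfolding d_zbar_def by simp
  ultimately show ?thesis unfolding laplacian_on_def by blast
qed

section \<open>Closure properties of smoothness; Wirtinger derivatives\<close>

lemma frechet_derivative_cong_open:
  assumes "open S" "z \<in> S" "\<And>w. w \<in> S \<Longrightarrow> f w = g w"
  shows "frechet_derivative f (at z) = frechet_derivative g (at z)"
proof -
  have "(f has_derivative D) (at z) \<longleftrightarrow> (g has_derivative D) (at z)" for D
    using has_derivative_transform_within_open[OF _ assms(1,2), of f D _ g]
      has_derivative_transform_within_open[OF _ assms(1,2), of g D _ f] assms(3) by auto
  thus ?thesis unfolding frechet_derivative_def by simp
qed

lemma differentiable_cong_open:
  assumes "open S" "z \<in> S" "\<And>w. w \<in> S \<Longrightarrow> f w = g w" "f differentiable (at z)"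
  shows "g differentiable (at z)"
  using assms(4) has_derivative_transform_within_open[OF _ assms(1,2), of f _ _ g] assms(3)
  unfolding differentiable_def by auto

lemma Ck_on_cong:
  assumes "open S" "\<And>z. z \<in> S \<Longrightarrow> f z = g z" "Ck_on k f S"
  shows "Ck_on k g S"
  using assms(2,3)
proof (induction k arbitrary: f g)
  case 0
  thus ?case using continuous_on_cong[of S S f g] by simp
next
  case (Suc k)
  have "frechet_derivative f (at z) = frechet_derivative g (at z)" if "z \<in> S" for z
    using frechet_derivative_cong_open[OF assms(1) that] Suc.prems(1) by blast
  hence "Ck_on k (\<lambda>z. frechet_derivative g (at z) e) S" if "Ck_on k (\<lambda>z. frechet_derivative f (at z) e) S" for e
    using Suc.IH[OF _ that] by simp
  thus ?case using Suc.prems differentiable_cong_open[OF assms(1) _ Suc.prems(1)] by auto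
qed

text \<open>Needed for products: the derivative of a product contains the undifferentiated factors,
  which must be of class k as well.\<close>

lemma Ck_on_SucD: "Ck_on (Suc k) f S \<Longrightarrow> Ck_on k f S"
proof (induction k arbitrary: f)
  case 0
  thus ?case by (simp add: continuous_at_imp_continuous_on differentiable_imp_continuous_within)
next
  case (Suc k)
  have "Ck_on (Suc k) (\<lambda>z. frechet_derivative f (at z) 1) S" "Ck_on (Suc k) (\<lambda>z. frechet_derivative f (at z) \<i>) S"
    using Suc.prems unfolding Ck_on.simps(2)[of "Suc k"] by blast+
  from this[THEN Suc.IH] Suc.prems show ?case by (simp only: Ck_on.simps(2)) blast
qed

lemma Ck_on_const: "Ck_on k (\<lambda>z. c) S"
  by (induction k arbitrary: c) auto

lemma Ck_on_add:
  assumes S: "open S" shows "Ck_on k f S \<Longrightarrow> Ck_on k g S \<Longrightarrow> Ck_on k (\<lambda>z. f z + g z) S"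
proof (induction k arbitrary: f g)
  case 0
  thus ?case by (auto intro: continuous_intros)
next
  case (Suc k)
  have fd: "frechet_derivative f (at z) e + frechet_derivative g (at z) e
      = frechet_derivative (\<lambda>z. f z + g z) (at z) e" if "z \<in> S" for z e
  proof -
    have "((\<lambda>z. f z + g z) has_derivative
      (\<lambda>e. frechet_derivative f (at z) e + frechet_derivative g (at z) e)) (at z)"
      using Suc.prems that by (intro has_derivative_add) (auto simp: frechet_derivative_works[symmetric])
    from frechet_derivative_at[OF this] show ?thesis by metis
  qed
  show ?case
    using Suc.prems Ck_on_cong[OF S fd Suc.IH] by auto
qed

lemma Ck_on_mult:
  assumes S: "open S" shows "Ck_on k f S \<Longrightarrow> Ck_on k g S \<Longrightarrow> Ck_on k (\<lambda>z. f z * g z) S"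
proof (induction k arbitrary: f g)
  case 0
  thus ?case by (auto intro: continuous_intros)
next
  case (Suc k)
  have fd: "f z * frechet_derivative g (at z) e + frechet_derivative f (at z) e * g z
      = frechet_derivative (\<lambda>z. f z * g z) (at z) e" if "z \<in> S" for z e
  proof -
    have "((\<lambda>z. f z * g z) has_derivative
      (\<lambda>e. f z * frechet_derivative g (at z) e + frechet_derivative f (at z) e * g z)) (at z)"
      using Suc.prems that by (intro has_derivative_mult) (auto simp: frechet_derivative_works[symmetric])
    from frechet_derivative_at[OF this] show ?thesis by metis
  qed
  have "Ck_on k f S" "Ck_on k g S" using Suc.prems Ck_on_SucD by blast+
  hence "Ck_on k (\<lambda>z. frechet_derivative (\<lambda>z. f z * g z) (at z) e) S" if "e = 1 \<or> e = \<i>" for e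
    using that Suc.prems by (intro Ck_on_cong[OF S fd Ck_on_add[OF S Suc.IH Suc.IH]]) auto
  thus ?case using Suc.prems by auto
qed

lemma smooth_on_const: "smooth_on (\<lambda>z. c) S"
  and smooth_on_add: "open S \<Longrightarrow> smooth_on f S \<Longrightarrow> smooth_on g S \<Longrightarrow> smooth_on (\<lambda>z. f z + g z) S"
  and smooth_on_mult: "open S \<Longrightarrow> smooth_on f S \<Longrightarrow> smooth_on g S \<Longrightarrow> smooth_on (\<lambda>z. f z * g z) S"
  and smooth_on_cong: "open S \<Longrightarrow> (\<And>z. z \<in> S \<Longrightarrow> f z = g z) \<Longrightarrow> smooth_on f S \<Longrightarrow> smooth_on g S"
  unfolding smooth_on_def by (auto intro: Ck_on_const Ck_on_add Ck_on_mult Ck_on_cong)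

lemma smooth_on_sum:
  "open S \<Longrightarrow> (\<And>i. i \<in> I \<Longrightarrow> smooth_on (f i) S) \<Longrightarrow> smooth_on (\<lambda>z. \<Sum>i\<in>I. f i z) S"
  by (induction I rule: infinite_finite_induct) (auto intro: smooth_on_const smooth_on_add)

lemma smooth_on_prod:
  "open S \<Longrightarrow> (\<And>i. i \<in> I \<Longrightarrow> smooth_on (f i) S) \<Longrightarrow> smooth_on (\<lambda>z. \<Prod>i\<in>I. f i z) S"
  by (induction I rule: infinite_finite_induct) (auto intro: smooth_on_const smooth_on_mult)

lemma smooth_on_imp_differentiable: "smooth_on f S \<Longrightarrow> z \<in> S \<Longrightarrow> f differentiable (at z)"
  unfolding smooth_on_def using Ck_on.simps(2) by metis

lemma smooth_on_imp_continuous_on: "smooth_on f S \<Longrightarrow> continuous_on S f"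
  unfolding smooth_on_def using Ck_on.simps(1) by metis

lemma smooth_on_frechet_derivative:
  assumes "smooth_on f S"
  shows "smooth_on (\<lambda>z. frechet_derivative f (at z) 1) S" "smooth_on (\<lambda>z. frechet_derivative f (at z) \<i>) S"
  unfolding smooth_on_def
proof -
  have *: "Ck_on (Suc k) f S" for k using assms unfolding smooth_on_def by blast
  show "\<forall>k. Ck_on k (\<lambda>z. frechet_derivative f (at z) 1) S" "\<forall>k. Ck_on k (\<lambda>z. frechet_derivative f (at z) \<i>) S"
    using * unfolding Ck_on.simps(2) by blast+
qed

lemma smooth_on_d_z:
  assumes "open S" "smooth_on f S" shows "smooth_on (d_z f) S"
proof -
  have "smooth_on (\<lambda>z. 1/2 * frechet_derivative f (at z) 1 + (- \<i> / 2) * frechet_derivative f (at z) \<i>) S"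
    by (intro smooth_on_add smooth_on_mult smooth_on_const smooth_on_frechet_derivative assms)
  thus ?thesis by (rule smooth_on_cong[OF assms(1), rotated]) (simp add: d_z_def field_simps)
qed

lemma
  assumes S: "open S" "z \<in> S" and eq: "\<And>w. w \<in> S \<Longrightarrow> f w = g w"
  shows d_z_cong: "d_z f z = d_z g z" and d_zbar_cong: "d_zbar f z = d_zbar g z"
  using frechet_derivative_cong_open[OF S eq] unfolding d_z_def d_zbar_def by simp_all

lemma frechet_derivative_cmult:
  fixes f :: "complex \<Rightarrow> complex"
  assumes "f differentiable (at z)"
  shows "frechet_derivative (\<lambda>w. c * f w) (at z) = (\<lambda>e. c * frechet_derivative f (at z) e)"
proof -
  have "((\<lambda>w. c * f w) has_derivative (\<lambda>e. c * frechet_derivative f (at z) e)) (at z)"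
    using assms by (intro has_derivative_mult_right) (simp add: frechet_derivative_works[symmetric])
  from frechet_derivative_at[OF this] show ?thesis ..
qed

lemma
  assumes "f differentiable (at z)"
  shows d_z_cmult: "d_z (\<lambda>w. c * f w) z = c * d_z f z"
    and d_zbar_cmult: "d_zbar (\<lambda>w. c * f w) z = c * d_zbar f z"
  unfolding d_z_def d_zbar_def frechet_derivative_cmult[OF assms] by (simp_all add: field_simps)

lemma d_z_const: "d_z (\<lambda>w. c) z = 0"
  unfolding d_z_def by simp

lemma d_z_sum_mult:
  fixes f g :: "'i \<Rightarrow> complex \<Rightarrow> complex"
  assumes "\<And>i. i \<in> I \<Longrightarrow> f i differentiable (at z)" "\<And>i. i \<in> I \<Longrightarrow> g i differentiable (at z)"
  shows "d_z (\<lambda>w. \<Sum>i\<in>I. f i w * g i w) z = (\<Sum>i\<in>I. f i z * d_z (g i) z + d_z (f i) z * g i z)"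
proof -
  have "((\<lambda>w. \<Sum>i\<in>I. f i w * g i w) has_derivative
    (\<lambda>e. \<Sum>i\<in>I. f i z * frechet_derivative (g i) (at z) e + frechet_derivative (f i) (at z) e * g i z)) (at z)"
    using assms by (intro has_derivative_sum has_derivative_mult) (auto simp: frechet_derivative_works[symmetric])
  from frechet_derivative_at[OF this, symmetric]
  show ?thesis unfolding d_z_def
    by (simp only: sum_distrib_left sum_subtractf[symmetric] sum_divide_distrib)
      (intro sum.cong refl, simp add: algebra_simps diff_divide_distrib add_divide_distrib)
qed

section \<open>Symmetries of the Hitchin equation\<close>

lemma mult_mat_entry:
  assumes "X \<in> carrier_mat n n" "Y \<in> carrier_mat n n" "a < n" "b < n"
  shows "(X * Y) $$ (a, b) = (\<Sum>k<n. X $$ (a, k) * Y $$ (k, b))"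
  using assms by (simp add: scalar_prod_def atLeast0LessThan)

lemma mat_adjoint_carrier [simp]:
  "X \<in> carrier_mat n n \<Longrightarrow> mat_adjoint X \<in> carrier_mat n n"
  unfolding mat_adjoint_def by auto

lemma mat_adjoint_entry:
  fixes X :: "complex mat"
  assumes "X \<in> carrier_mat n n" "a < n" "b < n"
  shows "mat_adjoint X $$ (a, b) = cnj (X $$ (b, a))"
  using assms unfolding mat_adjoint_def by (auto simp: mat_of_rows_def)

text \<open>\<open>inv_mat\<close> is \<open>the\<close> of an option. A one-sided inverse makes
  \<open>X\<close> a unit of the matrix ring, so the option is \<open>Some\<close>, and inverses are
  unique.\<close>

lemma inv_mat_eqI:
  fixes X Y :: "complex mat"
  assumes X: "X \<in> carrier_mat n n" and Y: "Y \<in> carrier_mat n n" and XY: "X * Y = 1\<^sub>m n"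
  shows "inv_mat X = Y"
proof -
  have YX: "Y * X = 1\<^sub>m n" by (rule mat_mult_left_right_inverse[OF X Y XY])
  have "X \<in> Units (ring_mat TYPE(complex) n ())"
    using X Y XY YX unfolding Units_def by (auto simp: ring_mat_simps)
  with mat_inverse(1)[OF X, of "()"] obtain Z where Z: "mat_inverse X = Some Z" by fastforce
  from mat_inverse(2)[OF X Z] have Z': "X * Z = 1\<^sub>m n" "Z * X = 1\<^sub>m n" "Z \<in> carrier_mat n n" by auto
  have "Z = Z * (X * Y)" using XY Z' by simp
  also have "\<dots> = Z * X * Y" by (rule assoc_mult_mat[OF Z'(3) X Y, symmetric])
  also have "\<dots> = Y" using Z' Y by simp
  finally show ?thesis using Z by simp
qed

lemma inv_mat_det_1:
  fixes X :: "complex mat"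
  assumes X: "X \<in> carrier_mat n n" and d: "Determinant.det X = 1"
  shows "inv_mat X = adj_mat X" "inv_mat X \<in> carrier_mat n n"
    "X * inv_mat X = 1\<^sub>m n" "inv_mat X * X = 1\<^sub>m n"
proof -
  have "X * adj_mat X = 1\<^sub>m n" "adj_mat X * X = 1\<^sub>m n" using adj_mat[OF X] d by auto
  moreover show "inv_mat X = adj_mat X" using inv_mat_eqI[OF X adj_mat(1)[OF X]] calculation by blast
  ultimately show "inv_mat X \<in> carrier_mat n n" "X * inv_mat X = 1\<^sub>m n" "inv_mat X * X = 1\<^sub>m n"
    using adj_mat(1)[OF X] by auto
qed

lemma smooth_on_det:
  assumes S: "open S" and X: "\<And>z. z \<in> S \<Longrightarrow> X z \<in> carrier_mat m m"
    and sm: "\<And>a b. a < m \<Longrightarrow> b < m \<Longrightarrow> smooth_on (\<lambda>z. X z $$ (a, b)) S"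
  shows "smooth_on (\<lambda>z. Determinant.det (X z) :: complex) S"
proof (rule smooth_on_cong[OF S])
  show "smooth_on (\<lambda>z. \<Sum>p\<in>{p. p permutes {0..<m}}. signof p * (\<Prod>i = 0..<m. X z $$ (i, p i))) S"
  proof (intro smooth_on_sum smooth_on_mult smooth_on_const smooth_on_prod S)
    fix p i assume "p \<in> {p. p permutes {0..<m}}" "i \<in> {0..<m}"
    hence "i < m" "p i < m" using permutes_in_image[of p "{0..<m}" i] by auto
    thus "smooth_on (\<lambda>z. X z $$ (i, p i)) S" by (rule sm)
  qed
qed (simp add: det_def'[OF X])

text \<open>With determinant 1 the inverse is the adjugate, so each entry is up to sign a minor, a
  polynomial in the entries of \<open>X\<close>.\<close>

lemma smooth_on_inv_mat:
  assumes S: "open S" and X: "\<And>z. z \<in> S \<Longrightarrow> X z \<in> carrier_mat n n"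
    and d: "\<And>z. z \<in> S \<Longrightarrow> Determinant.det (X z) = 1"
    and sm: "\<And>a b. a < n \<Longrightarrow> b < n \<Longrightarrow> smooth_on (\<lambda>z. X z $$ (a, b)) S"
    and ab: "a < n" "b < n"
  shows "smooth_on (\<lambda>z. inv_mat (X z) $$ (a, b)) S"
proof (rule smooth_on_cong[OF S])
  show "smooth_on (\<lambda>z. (-1) ^ (b + a) * Determinant.det (mat_delete (X z) b a)) S"
  proof (intro smooth_on_mult smooth_on_const S smooth_on_det[where m = "n - 1"])
    show "mat_delete (X z) b a \<in> carrier_mat (n - 1) (n - 1)" if "z \<in> S" for z
      by (rule mat_delete_carrier[OF X[OF that]])
    fix i j assume ij: "i < n - 1" "j < n - 1"
    show "smooth_on (\<lambda>z. mat_delete (X z) b a $$ (i, j)) S"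
    proof (rule smooth_on_cong[OF S])
      show "smooth_on (\<lambda>z. X z $$ (if i < b then i else Suc i, if j < a then j else Suc j)) S"
        by (rule sm) (use ij in auto)
    next
      fix z assume "z \<in> S"
      hence "dim_row (X z) = n" "dim_col (X z) = n" using X[of z] by auto
      thus "X z $$ (if i < b then i else Suc i, if j < a then j else Suc j) = mat_delete (X z) b a $$ (i, j)"
        using ij by (simp add: mat_delete_def)
    qed
  qed
next
  fix z assume z: "z \<in> S"
  show "(-1) ^ (b + a) * Determinant.det (mat_delete (X z) b a) = inv_mat (X z) $$ (a, b)"
    using inv_mat_det_1(1)[OF X[OF z] d[OF z]] X[OF z] ab unfolding adj_mat_def
    by (simp add: cofactor_def)
qed

lemma scalar_prod_quadratic_form:
  fixes X :: "complex mat"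
  assumes "X \<in> carrier_mat n n" "v \<in> carrier_vec n"
  shows "(X *\<^sub>v v) \<bullet>c v = (\<Sum>a<n. \<Sum>b<n. X $$ (a, b) * v $ b * cnj (v $ a))"
  using assms by (simp add: scalar_prod_def atLeast0LessThan sum_distrib_right)

text \<open>\<open>twist g\<close> is conjugation by the diagonal matrix with entries \<open>g\<close> of modulus \<open>1\<close>; \<open>flip\<close> is the
  transpose along the antidiagonal, which corresponds to the pairing of \<open>K\<^sup>m\<close> with \<open>K\<^sup>-\<^sup>m\<close>.\<close>

definition twist :: "(nat \<Rightarrow> complex) \<Rightarrow> nat \<Rightarrow> complex mat \<Rightarrow> complex mat" where
  "twist g n X = mat n n (\<lambda>(a, b). cnj (g a) * X $$ (a, b) * g b)"

definition flip :: "nat \<Rightarrow> complex mat \<Rightarrow> complex mat" where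
  "flip n X = mat n n (\<lambda>(a, b). X $$ (n - 1 - b, n - 1 - a))"

lemma twist_carrier [simp]: "twist g n X \<in> carrier_mat n n"
  and flip_carrier [simp]: "flip n X \<in> carrier_mat n n"
  unfolding twist_def flip_def by auto

lemma twist_entry: "a < n \<Longrightarrow> b < n \<Longrightarrow> twist g n X $$ (a, b) = cnj (g a) * X $$ (a, b) * g b"
  and flip_entry: "a < n \<Longrightarrow> b < n \<Longrightarrow> flip n X $$ (a, b) = X $$ (n - 1 - b, n - 1 - a)"
  unfolding twist_def flip_def by auto

lemma mult_cnj_unit: "norm (c :: complex) = 1 \<Longrightarrow> c * cnj c = 1" "norm (c :: complex) = 1 \<Longrightarrow> cnj c * c = 1"
  by (simp_all add: complex_norm_square[symmetric] mult.commute)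

lemma twist_mult:
  assumes g: "\<And>a. norm (g a) = 1" and X: "X \<in> carrier_mat n n" and Y: "Y \<in> carrier_mat n n"
  shows "twist g n X * twist g n Y = twist g n (X * Y)"
proof (rule eq_matI)
  fix a b assume "a < dim_row (twist g n (X * Y))" "b < dim_col (twist g n (X * Y))"
  hence ab: "a < n" "b < n" by (auto simp: twist_def)
  have "(twist g n X * twist g n Y) $$ (a, b) = (\<Sum>k<n. (cnj (g a) * X $$ (a, k) * g k) * (cnj (g k) * Y $$ (k, b) * g b))"
    using ab by (simp add: mult_mat_entry[of _ n] twist_entry)
  also have "\<dots> = (\<Sum>k<n. cnj (g a) * (X $$ (a, k) * Y $$ (k, b)) * g b)"
    using mult_cnj_unit(1)[OF g] by (intro sum.cong refl) (metis (no_types, opaque_lifting) mult.assoc mult.left_neutral)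
  also have "\<dots> = twist g n (X * Y) $$ (a, b)"
    using ab X Y by (simp only: twist_entry mult_mat_entry[of _ n] sum_distrib_left sum_distrib_right)
  finally show "(twist g n X * twist g n Y) $$ (a, b) = twist g n (X * Y) $$ (a, b)" .
qed (auto simp: twist_def)

lemma sum_reflect: "(\<Sum>k<n. f (n - 1 - k)) = (\<Sum>k<n. f k :: 'a :: comm_monoid_add)" for n :: nat
  using sum.nat_diff_reindex[of f n] by simp

lemma flip_mult:
  assumes X: "X \<in> carrier_mat n n" and Y: "Y \<in> carrier_mat n n"
  shows "flip n X * flip n Y = flip n (Y * X)"
proof (rule eq_matI)
  fix a b assume "a < dim_row (flip n (Y * X))" "b < dim_col (flip n (Y * X))"
  hence ab: "a < n" "b < n" by (auto simp: flip_def)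
  have "(flip n X * flip n Y) $$ (a, b) = (\<Sum>k<n. Y $$ (n - 1 - b, n - 1 - k) * X $$ (n - 1 - k, n - 1 - a))"
    using ab by (simp add: mult_mat_entry[of _ n] flip_entry mult.commute)
  also have "\<dots> = (\<Sum>k<n. Y $$ (n - 1 - b, k) * X $$ (k, n - 1 - a))"
    by (rule sum_reflect[of "\<lambda>k. Y $$ (n - 1 - b, k) * X $$ (k, n - 1 - a)"])
  also have "\<dots> = flip n (Y * X) $$ (a, b)"
    using ab X Y by (simp add: mult_mat_entry[of _ n] flip_entry del: index_mult_mat)
  finally show "(flip n X * flip n Y) $$ (a, b) = flip n (Y * X) $$ (a, b)" .
qed (auto simp: flip_def)

lemma twist_one: "(\<And>a. norm (g a) = 1) \<Longrightarrow> twist g n (1\<^sub>m n) = 1\<^sub>m n"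
  using mult_cnj_unit by (intro eq_matI) (auto simp: twist_def)

lemma flip_one: "flip n (1\<^sub>m n) = 1\<^sub>m n"
  by (intro eq_matI) (auto simp: flip_def)

lemma twist_adjoint:
  assumes X: "X \<in> carrier_mat n n"
  shows "mat_adjoint (twist g n X) = twist g n (mat_adjoint X)"
proof (rule eq_matI)
  fix a b assume "a < dim_row (twist g n (mat_adjoint X))" "b < dim_col (twist g n (mat_adjoint X))"
  hence "a < n" "b < n" by (auto simp: twist_def)
  thus "mat_adjoint (twist g n X) $$ (a, b) = twist g n (mat_adjoint X) $$ (a, b)"
    using X by (simp add: mat_adjoint_entry[of _ n] twist_entry mult_ac)
qed (simp_all only: carrier_matD[OF mat_adjoint_carrier[OF twist_carrier]] carrier_matD[OF twist_carrier])

lemma flip_adjoint: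
  assumes X: "X \<in> carrier_mat n n"
  shows "mat_adjoint (flip n X) = flip n (mat_adjoint X)"
proof (rule eq_matI)
  fix a b assume "a < dim_row (flip n (mat_adjoint X))" "b < dim_col (flip n (mat_adjoint X))"
  hence "a < n" "b < n" by (auto simp: flip_def)
  thus "mat_adjoint (flip n X) $$ (a, b) = flip n (mat_adjoint X) $$ (a, b)"
    using X by (simp add: mat_adjoint_entry[of _ n] flip_entry)
qed (simp_all only: carrier_matD[OF mat_adjoint_carrier[OF flip_carrier]] carrier_matD[OF flip_carrier])

lemma det_twist:
  assumes g: "\<And>a. norm (g a) = 1" and X: "X \<in> carrier_mat n n"
  shows "Determinant.det (twist g n X) = Determinant.det X"
proof -
  let ?D = "mat_diag n (\<lambda>a. cnj (g a))" and ?E = "mat_diag n g"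
  have "twist g n X = ?D * X * ?E"
    using X by (subst mat_diag_mult_left[OF X], subst mat_diag_mult_right[of _ n]) (auto simp: twist_def)
  hence "Determinant.det (twist g n X) = Determinant.det ?D * Determinant.det X * Determinant.det ?E"
    by (simp only: det_mult[OF mult_carrier_mat[OF mat_diag_dim X] mat_diag_dim] det_mult[OF mat_diag_dim X])
  moreover have "Determinant.det ?D * Determinant.det ?E = Determinant.det (?D * ?E)"
    by (rule det_mult[OF mat_diag_dim mat_diag_dim, symmetric])
  moreover have "?D * ?E = 1\<^sub>m n" using mult_cnj_unit(2)[OF g] by simp
  ultimately show ?thesis by (simp add: mult.commute mult.left_commute)
qed

text \<open>\<open>flip\<close> is transposition followed by conjugation with the antidiagonal
  permutation matrix; that matrix squares to 1, so its determinant does too.\<close>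

lemma det_flip:
  assumes X: "X \<in> carrier_mat n n"
  shows "Determinant.det (flip n X) = Determinant.det X"
proof -
  let ?S = "mat n n (\<lambda>(a, b). if a + b = n - 1 then 1 else 0 :: complex)"
  have refl_eq: "a + k = n - 1 \<longleftrightarrow> k = n - 1 - a" if "a < n" "k < n" for a k using that by auto
  have L: "(?S * Y) $$ (a, b) = Y $$ (n - 1 - a, b)" if "Y \<in> carrier_mat n n" "a < n" "b < n" for Y a b
  proof -
    have "(?S * Y) $$ (a, b) = (\<Sum>k<n. if k = n - 1 - a then Y $$ (k, b) else 0)"
      unfolding mult_mat_entry[OF mat_carrier that]
      using that refl_eq[OF that(2)] by (intro sum.cong) (auto simp del: sum.delta)
    thus ?thesis using that by simp
  qed
  have R: "(Y * ?S) $$ (a, b) = Y $$ (a, n - 1 - b)" if "Y \<in> carrier_mat n n" "a < n" "b < n" for Y a b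
  proof -
    have "(Y * ?S) $$ (a, b) = (\<Sum>k<n. if k = n - 1 - b then Y $$ (a, k) else 0)"
      unfolding mult_mat_entry[OF that(1) mat_carrier that(2,3)]
      using that refl_eq[OF that(3)] by (intro sum.cong) (auto simp: add.commute[of _ b])
    thus ?thesis using that by simp
  qed
  have "?S * ?S = 1\<^sub>m n"
  proof (rule eq_matI)
    fix a b assume "a < dim_row (1\<^sub>m n)" "b < dim_col (1\<^sub>m n)"
    hence "a < n" "b < n" by auto
    thus "(?S * ?S) $$ (a, b) = 1\<^sub>m n $$ (a, b)" by (subst L) auto
  qed auto
  hence SS: "Determinant.det ?S * Determinant.det ?S = 1"
    using det_mult[of ?S n ?S] by simp
  have "flip n X = ?S * transpose_mat X * ?S"
  proof (rule eq_matI)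
    fix a b assume "a < dim_row (?S * transpose_mat X * ?S)" "b < dim_col (?S * transpose_mat X * ?S)"
    hence ab: "a < n" "b < n" by auto
    have "(?S * transpose_mat X * ?S) $$ (a, b) = (?S * transpose_mat X) $$ (a, n - 1 - b)"
      using X ab by (intro R) auto
    also have "\<dots> = X $$ (n - 1 - b, n - 1 - a)" using X ab by (subst L) auto
    finally show "flip n X $$ (a, b) = (?S * transpose_mat X * ?S) $$ (a, b)"
      using ab by (simp add: flip_entry)
  qed (auto simp: flip_def)
  hence "Determinant.det (flip n X) = Determinant.det ?S * Determinant.det X * Determinant.det ?S"
    by (simp only: det_mult[OF mult_carrier_mat[OF mat_carrier transpose_carrier_mat[THEN iffD2, OF X]] mat_carrier]
        det_mult[OF mat_carrier transpose_carrier_mat[THEN iffD2, OF X]] det_transpose[OF X])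
  thus ?thesis using SS by (simp add: mult.commute mult.left_commute)
qed

section \<open>Entrywise form of the curvature and of the Hitchin equation\<close>

lemma chern_curvature_entry:
  assumes S: "open S" "z \<in> S" and X: "\<And>w. w \<in> S \<Longrightarrow> X w \<in> carrier_mat n n"
    and d: "\<And>w. w \<in> S \<Longrightarrow> Determinant.det (X w) = 1" and ab: "a < n" "b < n"
  shows "chern_curvature n X z $$ (a, b) =
    - d_zbar (\<lambda>w. \<Sum>k<n. inv_mat (X w) $$ (a, k) * d_z (\<lambda>v. X v $$ (k, b)) w) z"
proof -
  have "d_zbar (\<lambda>w. (inv_mat (X w) * mat_d_z n X w) $$ (a, b)) z
     = d_zbar (\<lambda>w. \<Sum>k<n. inv_mat (X w) $$ (a, k) * d_z (\<lambda>v. X v $$ (k, b)) w) z"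
  proof (rule d_zbar_cong[OF S])
    fix w assume w: "w \<in> S"
    have "mat_d_z n X w \<in> carrier_mat n n" unfolding mat_d_z_def by simp
    thus "(inv_mat (X w) * mat_d_z n X w) $$ (a, b)
        = (\<Sum>k<n. inv_mat (X w) $$ (a, k) * d_z (\<lambda>v. X v $$ (k, b)) w)"
      using inv_mat_det_1(2)[OF X[OF w] d[OF w]] ab
      by (subst mult_mat_entry[of _ n]) (auto simp: mat_d_z_def intro!: sum.cong)
  qed
  thus ?thesis using ab unfolding chern_curvature_def mat_d_zbar_def by simp
qed

lemma smooth_on_connection_entry:
  assumes S: "open S" and X: "\<And>w. w \<in> S \<Longrightarrow> X w \<in> carrier_mat n n"
    and d: "\<And>w. w \<in> S \<Longrightarrow> Determinant.det (X w) = 1"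
    and sm: "\<And>a b. a < n \<Longrightarrow> b < n \<Longrightarrow> smooth_on (\<lambda>z. X z $$ (a, b)) S" and ab: "a < n" "b < n"
  shows "smooth_on (\<lambda>w. \<Sum>k<n. inv_mat (X w) $$ (a, k) * d_z (\<lambda>v. X v $$ (k, b)) w) S"
  using ab by (intro smooth_on_sum smooth_on_mult S smooth_on_inv_mat[OF S X d sm] smooth_on_d_z sm) auto

lemma hermitian_metricD:
  assumes "hermitian_metric A \<sigma> n H" "c \<in> A"
  shows "z \<in> image_of c \<Longrightarrow> H c z \<in> carrier_mat n n"
    and "z \<in> image_of c \<Longrightarrow> mat_adjoint (H c z) = H c z"
    and "z \<in> image_of c \<Longrightarrow> v \<in> carrier_vec n \<Longrightarrow> v \<noteq> 0\<^sub>v n \<Longrightarrow>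
      Re (\<Sum>a<n. \<Sum>b<n. H c z $$ (a, b) * v $ b * cnj (v $ a)) > 0"
    and "a < n \<Longrightarrow> b < n \<Longrightarrow> smooth_on (\<lambda>z. H c z $$ (a, b)) (image_of c)"
proof -
  show C: "H c z \<in> carrier_mat n n" if "z \<in> image_of c"
    using assms that unfolding hermitian_metric_def by blast
  show "mat_adjoint (H c z) = H c z" if "z \<in> image_of c"
    using assms that unfolding hermitian_metric_def by blast
  show "Re (\<Sum>a<n. \<Sum>b<n. H c z $$ (a, b) * v $ b * cnj (v $ a)) > 0"
    if "z \<in> image_of c" "v \<in> carrier_vec n" "v \<noteq> 0\<^sub>v n"
    using assms that scalar_prod_quadratic_form[OF C[OF that(1)] that(2)]
    unfolding hermitian_metric_def by metis
  show "smooth_on (\<lambda>z. H c z $$ (a, b)) (image_of c)" if "a < n" "b < n"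
    using assms that unfolding hermitian_metric_def by blast
qed

lemma hermitian_metric_diag:
  assumes H: "hermitian_metric A \<sigma> n H" "c \<in> A" "z \<in> image_of c" and a: "a < n"
  shows "Re (H c z $$ (a, a)) > 0" "Im (H c z $$ (a, a)) = 0"
proof -
  have "unit_vec n a \<noteq> 0\<^sub>v n" using a by (metis index_unit_vec(2) index_zero_vec(1) zero_neq_one)
  from hermitian_metricD(3)[OF H unit_vec_carrier this]
  have "Re (\<Sum>i<n. \<Sum>j<n. H c z $$ (i, j) * unit_vec n a $ j * cnj (unit_vec n a $ i)) > 0" .
  also have "(\<Sum>i<n. \<Sum>j<n. H c z $$ (i, j) * unit_vec n a $ j * cnj (unit_vec n a $ i))
      = (\<Sum>i<n. \<Sum>j<n. if j = a then if i = a then H c z $$ (i, j) else 0 else 0)"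
    using a by (intro sum.cong refl) auto
  also have "\<dots> = H c z $$ (a, a)" using a by simp
  finally show "Re (H c z $$ (a, a)) > 0" .
  have "mat_adjoint (H c z) $$ (a, a) = cnj (H c z $$ (a, a))"
    using mat_adjoint_entry[OF hermitian_metricD(1)[OF H] a a] .
  thus "Im (H c z $$ (a, a)) = 0" using hermitian_metricD(2)[OF H] by (simp add: complex_eq_iff)
qed

lemma adjoint_wrt_carrier:
  "inv_mat X \<in> carrier_mat n n \<Longrightarrow> P \<in> carrier_mat n n \<Longrightarrow> X \<in> carrier_mat n n \<Longrightarrow>
    adjoint_wrt X P \<in> carrier_mat n n"
  unfolding adjoint_wrt_def by (meson mat_adjoint_carrier mult_carrier_mat)

lemma hitchin_solutionD:
  assumes "hitchin_solution A \<sigma> n \<phi> H" "c \<in> A" "z \<in> image_of c"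
  shows "H c z \<in> carrier_mat n n" "Determinant.det (H c z) = 1"
    "inv_mat (H c z) \<in> carrier_mat n n" "H c z * inv_mat (H c z) = 1\<^sub>m n" "inv_mat (H c z) * H c z = 1\<^sub>m n"
proof -
  show 1: "H c z \<in> carrier_mat n n" and 2: "Determinant.det (H c z) = 1"
    using assms unfolding hitchin_solution_def hermitian_metric_def by blast+
  show "inv_mat (H c z) \<in> carrier_mat n n" "H c z * inv_mat (H c z) = 1\<^sub>m n" "inv_mat (H c z) * H c z = 1\<^sub>m n"
    using inv_mat_det_1[OF 1 2] by blast+
qed

lemma hitchin_equation_entry:
  assumes sol: "hitchin_solution A \<sigma> n \<phi> H" "c \<in> A" "z \<in> image_of c"
    and \<phi>: "\<phi> c z \<in> carrier_mat n n" and ab: "a < n" "b < n"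
  shows "chern_curvature n (H c) z $$ (a, b) + ((\<phi> c z * adjoint_wrt (H c z) (\<phi> c z)) $$ (a, b)
    - (adjoint_wrt (H c z) (\<phi> c z) * \<phi> c z) $$ (a, b)) = 0"
proof -
  let ?A = "adjoint_wrt (H c z) (\<phi> c z)"
  have A: "?A \<in> carrier_mat n n" by (rule adjoint_wrt_carrier) (use hitchin_solutionD[OF sol] \<phi> in auto)
  have C: "chern_curvature n (H c) z \<in> carrier_mat n n"
    unfolding chern_curvature_def mat_d_zbar_def by simp
  have "(chern_curvature n (H c) z + (\<phi> c z * ?A - ?A * \<phi> c z)) $$ (a, b) = 0\<^sub>m n n $$ (a, b)"
    using sol unfolding hitchin_solution_def by metis
  thus ?thesis using A C \<phi> ab by simp
qed

lemma hitchin_equationI: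
  assumes C: "inv_mat X \<in> carrier_mat n n" "X \<in> carrier_mat n n" "P \<in> carrier_mat n n"
    and eq: "\<And>a b. a < n \<Longrightarrow> b < n \<Longrightarrow> chern_curvature n Y z $$ (a, b)
      + ((P * adjoint_wrt X P) $$ (a, b) - (adjoint_wrt X P * P) $$ (a, b)) = 0"
  shows "chern_curvature n Y z + (P * adjoint_wrt X P - adjoint_wrt X P * P) = 0\<^sub>m n n"
proof (rule eq_matI)
  have A: "adjoint_wrt X P \<in> carrier_mat n n" by (rule adjoint_wrt_carrier) (use C in auto)
  have K: "chern_curvature n Y z \<in> carrier_mat n n"
    unfolding chern_curvature_def mat_d_zbar_def by simp
  show "dim_row (chern_curvature n Y z + (P * adjoint_wrt X P - adjoint_wrt X P * P)) = dim_row (0\<^sub>m n n)"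
    "dim_col (chern_curvature n Y z + (P * adjoint_wrt X P - adjoint_wrt X P * P)) = dim_col (0\<^sub>m n n)"
    using A K C by auto
  show "(chern_curvature n Y z + (P * adjoint_wrt X P - adjoint_wrt X P * P)) $$ (a, b) = 0\<^sub>m n n $$ (a, b)"
    if "a < dim_row (0\<^sub>m n n :: complex mat)" "b < dim_col (0\<^sub>m n n :: complex mat)" for a b
    using A K C eq[of a b] that by simp
qed

lemma smult_mult_smult_mat:
  fixes X Y :: "complex mat"
  assumes X: "X \<in> carrier_mat n n" and Y: "Y \<in> carrier_mat n n"
  shows "(k \<cdot>\<^sub>m X) * (l \<cdot>\<^sub>m Y) = (k * l) \<cdot>\<^sub>m (X * Y)"
  unfolding mult_smult_distrib[OF smult_carrier_mat[OF X] Y] mult_smult_assoc_mat[OF X Y]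
  by (rule eq_matI) auto

lemma one_smult_mat: "(1 :: complex) \<cdot>\<^sub>m X = X"
  by (rule eq_matI) auto

text \<open>The conjugating matrix is constant and diagonal, so it is compatible with the diagonal
  changes of frame and with \<open>d_z\<close> and \<open>d_zbar\<close>. The factors \<kappa> of
  the Higgs field and \<open>cnj \<kappa>\<close> of its adjoint cancel in the commutator.\<close>

lemma hitchin_solution_twist:
  assumes op: "\<And>c. c \<in> A \<Longrightarrow> open (image_of c)" and sol: "hitchin_solution A \<sigma> n \<phi> H"
    and g: "\<And>a. norm (g a) = 1" and \<kappa>: "norm \<kappa> = 1"
    and \<phi>: "\<And>c z. \<phi> c z \<in> carrier_mat n n" "\<And>c z. twist g n (\<phi> c z) = \<kappa> \<cdot>\<^sub>m \<phi> c z"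
  shows "hitchin_solution A \<sigma> n \<phi> (\<lambda>c z. twist g n (H c z))"
proof -
  have herm: "hermitian_metric A \<sigma> n H" using sol unfolding hitchin_solution_def by blast
  have "hermitian_metric A \<sigma> n (\<lambda>c z. twist g n (H c z))"
    unfolding hermitian_metric_def
  proof (intro conjI ballI allI impI)
    fix c z assume c: "c \<in> A" and z: "z \<in> image_of c"
    show "twist g n (H c z) \<in> carrier_mat n n" by simp
    show "mat_adjoint (twist g n (H c z)) = twist g n (H c z)"
      using twist_adjoint[OF hermitian_metricD(1)[OF herm c z]] hermitian_metricD(2)[OF herm c z] by simp
    fix v :: "complex Matrix.vec" assume v: "v \<in> carrier_vec n" "v \<noteq> 0\<^sub>v n"
    \<comment> \<open>The form of the twisted matrix at \<open>v\<close> is the form of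
      \<open>H\<close> at \<open>u\<close>.\<close>
    define u where "u = Matrix.vec n (\<lambda>i. g i * v $ i)"
    have "u \<noteq> 0\<^sub>v n"
    proof
      assume "u = 0\<^sub>v n"
      have "v $ i = 0" if "i < n" for i
      proof -
        have "u $ i = 0" using \<open>u = 0\<^sub>v n\<close> that by simp
        moreover have "g i \<noteq> 0" using g[of i] by auto
        ultimately show ?thesis using that by (simp add: u_def)
      qed
      hence "v = 0\<^sub>v n" using v(1) by (intro eq_vecI) auto
      thus False using v(2) by simp
    qed
    moreover have "u \<in> carrier_vec n" unfolding u_def by simp
    ultimately have "Re (\<Sum>a<n. \<Sum>b<n. H c z $$ (a, b) * u $ b * cnj (u $ a)) > 0"
      using hermitian_metricD(3)[OF herm c z] by blast
    moreover have "(twist g n (H c z) *\<^sub>v v) \<bullet>c v = (\<Sum>a<n. \<Sum>b<n. H c z $$ (a, b) * u $ b * cnj (u $ a))"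
      unfolding scalar_prod_quadratic_form[OF twist_carrier v(1)]
      by (intro sum.cong refl) (simp add: twist_entry u_def)
    ultimately show "Re ((twist g n (H c z) *\<^sub>v v) \<bullet>c v) > 0" by simp
  next
    fix c a b assume c: "c \<in> A" and ab: "a < n" "b < n"
    have "smooth_on (\<lambda>z. (cnj (g a) * g b) * H c z $$ (a, b)) (image_of c)"
      by (intro smooth_on_mult smooth_on_const op c hermitian_metricD(4)[OF herm c ab])
    thus "smooth_on (\<lambda>z. twist g n (H c z) $$ (a, b)) (image_of c)"
      using ab by (simp add: twist_entry mult_ac)
  next
    fix c d p a b assume "c \<in> A" "d \<in> A" "p \<in> cdom c \<inter> cdom d" "a < n" "b < n"
    moreover from this herm have "H d (coord d p) $$ (a, b) =
          cnj (\<sigma> c d (coord c p) powi wt n (a + 1)) * H c (coord c p) $$ (a, b)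
            * \<sigma> c d (coord c p) powi wt n (b + 1)"
      unfolding hermitian_metric_def by blast
    ultimately show "twist g n (H d (coord d p)) $$ (a, b) =
          cnj (\<sigma> c d (coord c p) powi wt n (a + 1)) * twist g n (H c (coord c p)) $$ (a, b)
            * \<sigma> c d (coord c p) powi wt n (b + 1)"
      by (simp add: twist_entry mult_ac)
  qed
  moreover have "Determinant.det (twist g n (H c z)) = 1 \<and>
        chern_curvature n (\<lambda>z. twist g n (H c z)) z +
          (\<phi> c z * adjoint_wrt (twist g n (H c z)) (\<phi> c z) - adjoint_wrt (twist g n (H c z)) (\<phi> c z) * \<phi> c z)
        = 0\<^sub>m n n" if c: "c \<in> A" and z: "z \<in> image_of c" for c z
  proof
    note S = op[OF c]
    have HD: "H c w \<in> carrier_mat n n" "Determinant.det (H c w) = 1" "inv_mat (H c w) \<in> carrier_mat n n"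
      "H c w * inv_mat (H c w) = 1\<^sub>m n" if "w \<in> image_of c" for w using hitchin_solutionD[OF sol c that] by auto
    show det1: "Determinant.det (twist g n (H c z)) = 1" using det_twist[OF g HD(1)[OF z]] HD(2)[OF z] by simp
    have inv: "inv_mat (twist g n (H c w)) = twist g n (inv_mat (H c w))" if w: "w \<in> image_of c" for w
      by (rule inv_mat_eqI[of _ n]) (simp_all add: twist_mult[OF g] HD[OF w] twist_one[OF g])
    let ?M = "H c z" and ?P = "\<phi> c z"
    let ?A = "adjoint_wrt ?M ?P" and ?A' = "adjoint_wrt (twist g n ?M) ?P"
    have A: "?A \<in> carrier_mat n n" by (rule adjoint_wrt_carrier) (use HD[OF z] \<phi> in auto)
    have \<kappa>\<kappa>: "\<kappa> * cnj \<kappa> = 1" "cnj \<kappa> * \<kappa> = 1" using mult_cnj_unit[OF \<kappa>] by auto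
    \<comment> \<open>The hypothesis on the Higgs field solved for the field itself, so that every
      factor of the commutator is a twist.\<close>
    have P: "?P = cnj \<kappa> \<cdot>\<^sub>m twist g n ?P"
      using \<phi>(1) \<kappa>\<kappa> by (subst \<phi>(2)) (auto simp: mult.assoc[symmetric])
    have "mat_adjoint ?P = \<kappa> \<cdot>\<^sub>m twist g n (mat_adjoint ?P)"
    proof (rule eq_matI)
      fix a b assume "a < dim_row (\<kappa> \<cdot>\<^sub>m twist g n (mat_adjoint ?P))" "b < dim_col (\<kappa> \<cdot>\<^sub>m twist g n (mat_adjoint ?P))"
      hence ab: "a < n" "b < n" by (auto simp: twist_def)
      have "cnj \<kappa> * twist g n ?P $$ (b, a) = ?P $$ (b, a)"
        using ab by (subst (2) P) (simp add: carrier_matD[OF twist_carrier])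
      hence "cnj (?P $$ (b, a)) = \<kappa> * cnj (twist g n ?P $$ (b, a))" by (metis complex_cnj_cnj complex_cnj_mult)
      thus "mat_adjoint ?P $$ (a, b) = (\<kappa> \<cdot>\<^sub>m twist g n (mat_adjoint ?P)) $$ (a, b)"
        using ab \<phi>(1) by (simp add: twist_entry mat_adjoint_entry[of _ n] carrier_matD[OF twist_carrier] mult_ac)
    qed (simp_all add: carrier_matD[OF twist_carrier] carrier_matD[OF mat_adjoint_carrier[OF \<phi>(1)]])
    hence "?A' = twist g n (inv_mat ?M) * (\<kappa> \<cdot>\<^sub>m twist g n (mat_adjoint ?P)) * twist g n ?M"
      unfolding adjoint_wrt_def inv[OF z] by simp
    also have "\<dots> = \<kappa> \<cdot>\<^sub>m (twist g n (inv_mat ?M) * twist g n (mat_adjoint ?P) * twist g n ?M)"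
      by (simp only: mult_smult_distrib[OF twist_carrier twist_carrier]
          mult_smult_assoc_mat[OF mult_carrier_mat[OF twist_carrier twist_carrier] twist_carrier])
    also have "\<dots> = \<kappa> \<cdot>\<^sub>m twist g n ?A"
      using HD[OF z] \<phi>(1) unfolding adjoint_wrt_def
      by (simp only: twist_mult[OF g] mat_adjoint_carrier mult_carrier_mat)
    finally have A': "?A' = \<kappa> \<cdot>\<^sub>m twist g n ?A" .
    have PA: "?P * ?A' = twist g n (?P * ?A)"
    proof -
      have "?P * ?A' = (cnj \<kappa> \<cdot>\<^sub>m twist g n ?P) * (\<kappa> \<cdot>\<^sub>m twist g n ?A)" using P A' by simp
      also have "\<dots> = (cnj \<kappa> * \<kappa>) \<cdot>\<^sub>m (twist g n ?P * twist g n ?A)"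
        by (simp only: smult_mult_smult_mat[OF twist_carrier twist_carrier] mult.commute[of \<kappa>])
      finally show ?thesis using \<kappa>\<kappa> twist_mult[OF g \<phi>(1) A] by (simp add: one_smult_mat)
    qed
    have AP: "?A' * ?P = twist g n (?A * ?P)"
    proof -
      have "?A' * ?P = (\<kappa> \<cdot>\<^sub>m twist g n ?A) * (cnj \<kappa> \<cdot>\<^sub>m twist g n ?P)" using P A' by simp
      also have "\<dots> = (cnj \<kappa> * \<kappa>) \<cdot>\<^sub>m (twist g n ?A * twist g n ?P)"
        by (simp only: smult_mult_smult_mat[OF twist_carrier twist_carrier] mult.commute[of \<kappa>])
      finally show ?thesis using \<kappa>\<kappa> twist_mult[OF g A \<phi>(1)] by (simp add: one_smult_mat)
    qed
    show "chern_curvature n (\<lambda>z. twist g n (H c z)) z + (?P * ?A' - ?A' * ?P) = 0\<^sub>m n n"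
    proof (rule hitchin_equationI)
      show "inv_mat (twist g n ?M) \<in> carrier_mat n n" using inv[OF z] by simp
      fix a b assume ab: "a < n" "b < n"
      \<comment> \<open>Entry (a, b) of the connection form. Twisting multiplies it by the constant
        \<open>cnj (g a) * g b\<close>; the inner factors at \<open>k\<close> cancel as |g k| =
        1.\<close>
      let ?K = "\<lambda>a b w. \<Sum>k<n. inv_mat (H c w) $$ (a, k) * d_z (\<lambda>v. H c v $$ (k, b)) w"
      have "chern_curvature n (\<lambda>z. twist g n (H c z)) z $$ (a, b)
        = - d_zbar (\<lambda>w. \<Sum>k<n. inv_mat (twist g n (H c w)) $$ (a, k) * d_z (\<lambda>v. twist g n (H c v) $$ (k, b)) w) z"
        by (rule chern_curvature_entry[OF S z twist_carrier _ ab]) (use det_twist[OF g] HD in auto)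
      also have "d_zbar (\<lambda>w. \<Sum>k<n. inv_mat (twist g n (H c w)) $$ (a, k) * d_z (\<lambda>v. twist g n (H c v) $$ (k, b)) w) z
        = d_zbar (\<lambda>w. (cnj (g a) * g b) * ?K a b w) z"
      proof (rule d_zbar_cong[OF S z])
        fix w assume w: "w \<in> image_of c"
        have "inv_mat (twist g n (H c w)) $$ (a, k) * d_z (\<lambda>v. twist g n (H c v) $$ (k, b)) w
          = (cnj (g a) * g b) * (inv_mat (H c w) $$ (a, k) * d_z (\<lambda>v. H c v $$ (k, b)) w)" if k: "k < n" for k
        proof -
          have "d_z (\<lambda>v. twist g n (H c v) $$ (k, b)) w = d_z (\<lambda>v. (cnj (g k) * g b) * H c v $$ (k, b)) w"
            using k ab by (simp add: twist_entry mult_ac)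
          also have "\<dots> = (cnj (g k) * g b) * d_z (\<lambda>v. H c v $$ (k, b)) w"
            by (rule d_z_cmult[OF smooth_on_imp_differentiable[OF hermitian_metricD(4)[OF herm c k ab(2)] w]])
          finally have D: "d_z (\<lambda>v. twist g n (H c v) $$ (k, b)) w = \<dots>" .
          have "inv_mat (twist g n (H c w)) $$ (a, k) * d_z (\<lambda>v. twist g n (H c v) $$ (k, b)) w
            = (g k * cnj (g k)) * ((cnj (g a) * g b) * (inv_mat (H c w) $$ (a, k) * d_z (\<lambda>v. H c v $$ (k, b)) w))"
            unfolding D inv[OF w] using ab k by (simp add: twist_entry mult_ac)
          thus ?thesis using mult_cnj_unit(1)[OF g] by simp
        qed
        thus "(\<Sum>k<n. inv_mat (twist g n (H c w)) $$ (a, k) * d_z (\<lambda>v. twist g n (H c v) $$ (k, b)) w)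
          = (cnj (g a) * g b) * ?K a b w" by (simp add: sum_distrib_left)
      qed
      also have "\<dots> = (cnj (g a) * g b) * d_zbar (?K a b) z"
        by (rule d_zbar_cmult[OF smooth_on_imp_differentiable[OF
              smooth_on_connection_entry[OF S HD(1) HD(2) hermitian_metricD(4)[OF herm c] ab] z]])
      finally have "chern_curvature n (\<lambda>z. twist g n (H c z)) z $$ (a, b)
          = (cnj (g a) * g b) * chern_curvature n (H c) z $$ (a, b)"
        using chern_curvature_entry[OF S z HD(1) HD(2) ab] by simp
      moreover have "(?P * ?A') $$ (a, b) - (?A' * ?P) $$ (a, b)
          = (cnj (g a) * g b) * ((?P * ?A) $$ (a, b) - (?A * ?P) $$ (a, b))"
        unfolding PA AP using ab by (simp only: twist_entry right_diff_distrib mult_ac)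
      ultimately show "chern_curvature n (\<lambda>z. twist g n (H c z)) z $$ (a, b)
          + ((?P * ?A') $$ (a, b) - (?A' * ?P) $$ (a, b)) = 0"
        using hitchin_equation_entry[OF sol c z \<phi>(1) ab] by (metis distrib_left mult_zero_right)
    qed (use \<phi> in auto)
  qed
  ultimately show ?thesis unfolding hitchin_solution_def by blast
qed

text \<open>Reversing the summands exchanges each power of K with its inverse, so that
  \<open>flip\<close> inverts the factors of a change of frame.\<close>

lemma wt_reflect: "a < n \<Longrightarrow> wt n (n - 1 - a + 1) = - wt n (a + 1)"
  unfolding wt_def by (simp add: of_nat_diff)

text \<open>Follows from positivity: the first summand has weight n - 1, which is not 0, so a zero
  of the transition function would annihilate a diagonal entry of the Gram matrix in the other
  chart.\<close>

lemma hermitian_metric_transition_nonzero: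
  assumes herm: "hermitian_metric A \<sigma> n H" and n: "n \<ge> 2" and c: "c \<in> A" "d \<in> A" "p \<in> cdom c \<inter> cdom d"
  shows "\<sigma> c d (coord c p) \<noteq> 0"
proof
  assume 0: "\<sigma> c d (coord c p) = 0"
  have "wt n (0 + 1) \<noteq> 0" using n unfolding wt_def by simp
  hence "\<sigma> c d (coord c p) powi wt n (0 + 1) = 0" using 0 by (simp add: power_int_0_left)
  moreover have "H d (coord d p) $$ (0, 0) =
          cnj (\<sigma> c d (coord c p) powi wt n (0 + 1)) * H c (coord c p) $$ (0, 0)
            * \<sigma> c d (coord c p) powi wt n (0 + 1)"
  proof -
    have "0 < n" using n by simp
    thus ?thesis using herm c unfolding hermitian_metric_def by blast
  qed
  ultimately have "H d (coord d p) $$ (0, 0) = 0" by simp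
  moreover have "coord d p \<in> image_of d" using c unfolding image_of_def by auto
  ultimately show False using hermitian_metric_diag(1)[OF herm c(2) _, of "coord d p" 0] n by simp
qed

text \<open>Reversing the summands identifies E with its dual. Under this identification
  \<open>flip\<close> of the inverse is the Gram matrix of the dual metric, and the Higgs field is
  its own transpose. Transposed and reversed, curvature and commutator both change sign, so the
  equation is preserved.\<close>

lemma hitchin_solution_flip:
  assumes op: "\<And>c. c \<in> A \<Longrightarrow> open (image_of c)" and sol: "hitchin_solution A \<sigma> n \<phi> H" and n: "n \<ge> 2"
    and \<phi>: "\<And>c z. \<phi> c z \<in> carrier_mat n n" "\<And>c z. flip n (\<phi> c z) = \<phi> c z"
  shows "hitchin_solution A \<sigma> n \<phi> (\<lambda>c z. flip n (inv_mat (H c z)))"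
proof -
  have herm: "hermitian_metric A \<sigma> n H" using sol unfolding hitchin_solution_def by blast
  note HD = hitchin_solutionD[OF sol]
  have adj_inv: "mat_adjoint (inv_mat (H c z)) = inv_mat (H c z)" if cz: "c \<in> A" "z \<in> image_of c" for c z
  proof -
    let ?N = "inv_mat (H c z)"
    have "H c z * mat_adjoint ?N = 1\<^sub>m n"
    proof (rule eq_matI)
      fix a b assume "a < dim_row (1\<^sub>m n)" "b < dim_col (1\<^sub>m n)"
      hence ab: "a < n" "b < n" by auto
      have Hh: "cnj (H c z $$ (k, a)) = H c z $$ (a, k)" if "k < n" for k
        using mat_adjoint_entry[OF HD(1)[OF cz] ab(1) that] hermitian_metricD(2)[OF herm cz] by simp
      have "(H c z * mat_adjoint ?N) $$ (a, b) = (\<Sum>k<n. cnj (?N $$ (b, k) * H c z $$ (k, a)))"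
        unfolding mult_mat_entry[OF HD(1)[OF cz] mat_adjoint_carrier[OF HD(3)[OF cz]] ab]
        using ab by (intro sum.cong refl) (simp add: mat_adjoint_entry[OF HD(3)[OF cz]] Hh)
      also have "\<dots> = cnj ((?N * H c z) $$ (b, a))"
        unfolding mult_mat_entry[OF HD(3)[OF cz] HD(1)[OF cz] ab(2,1)] by (simp only: cnj_sum)
      finally show "(H c z * mat_adjoint ?N) $$ (a, b) = 1\<^sub>m n $$ (a, b)" using HD(5)[OF cz] ab by simp
    qed (use HD(1)[OF cz] mat_adjoint_carrier[OF HD(3)[OF cz]] in \<open>simp_all only: carrier_matD index_mult_mat index_one_mat\<close>)
    from inv_mat_eqI[OF HD(1)[OF cz] mat_adjoint_carrier[OF HD(3)[OF cz]] this] show ?thesis ..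
  qed
  have sm_inv: "smooth_on (\<lambda>z. inv_mat (H c z) $$ (a, b)) (image_of c)" if "c \<in> A" "a < n" "b < n" for c a b
    using smooth_on_inv_mat[OF op[OF that(1)] HD(1,2)[OF that(1)] hermitian_metricD(4)[OF herm that(1)] that(2,3)]
    by blast
  have "hermitian_metric A \<sigma> n (\<lambda>c z. flip n (inv_mat (H c z)))"
    unfolding hermitian_metric_def
  proof (intro conjI ballI allI impI)
    fix c z assume c: "c \<in> A" and z: "z \<in> image_of c"
    let ?N = "inv_mat (H c z)"
    show "flip n ?N \<in> carrier_mat n n" by simp
    show "mat_adjoint (flip n ?N) = flip n ?N"
      using flip_adjoint[OF HD(3)[OF c z]] adj_inv[OF c z] by simp
    fix v :: "complex Matrix.vec" assume v: "v \<in> carrier_vec n" "v \<noteq> 0\<^sub>v n"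
    \<comment> \<open>With u = H^-1 x the form of \<open>H\<close> at \<open>u\<close> is the
      conjugate of the form of H^-1 at \<open>x\<close>. Reversal and conjugation in
      \<open>x\<close> turn the latter into the form of the flipped inverse at \<open>v\<close>; the
      conjugation accounts for the transpose.\<close>
    define x where "x = Matrix.vec n (\<lambda>i. cnj (v $ (n - 1 - i)))"
    define u where "u = ?N *\<^sub>v x"
    have x: "x \<in> carrier_vec n" unfolding x_def by simp
    have u: "u \<in> carrier_vec n" unfolding u_def using HD(3)[OF c z] x by simp
    have Hu: "H c z *\<^sub>v u = x"
      unfolding u_def using HD(1,3,4)[OF c z] x assoc_mult_mat_vec[of "H c z" n n ?N n x] by simp
    have "u \<noteq> 0\<^sub>v n"
    proof
      assume "u = 0\<^sub>v n"
      hence x0: "x = 0\<^sub>v n" using Hu HD(1)[OF c z] by auto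
      have "v $ i = 0" if "i < n" for i
      proof -
        have "x $ (n - 1 - i) = 0" using x0 that by simp
        thus ?thesis using that by (simp add: x_def)
      qed
      hence "v = 0\<^sub>v n" using v(1) by (intro eq_vecI) auto
      thus False using v(2) by simp
    qed
    hence "Re (\<Sum>a<n. \<Sum>b<n. H c z $$ (a, b) * u $ b * cnj (u $ a)) > 0"
      using hermitian_metricD(3)[OF herm c z u] by blast
    also have "(\<Sum>a<n. \<Sum>b<n. H c z $$ (a, b) * u $ b * cnj (u $ a)) = (\<Sum>a<n. x $ a * cnj (u $ a))"
    proof (intro sum.cong refl)
      fix a assume "a \<in> {..<n}"
      hence a: "a < n" by simp
      have "(H c z *\<^sub>v u) $ a = (\<Sum>b<n. H c z $$ (a, b) * u $ b)"
        using HD(1)[OF c z] u a by (simp add: scalar_prod_def atLeast0LessThan)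
      thus "(\<Sum>b<n. H c z $$ (a, b) * u $ b * cnj (u $ a)) = x $ a * cnj (u $ a)"
        unfolding Hu by (simp add: sum_distrib_right)
    qed
    also have "\<dots> = cnj (\<Sum>a<n. u $ a * cnj (x $ a))" by (simp add: cnj_sum mult.commute)
    also have "(\<Sum>a<n. u $ a * cnj (x $ a)) = (\<Sum>a<n. \<Sum>b<n. ?N $$ (a, b) * x $ b * cnj (x $ a))"
    proof (intro sum.cong refl)
      fix a assume "a \<in> {..<n}"
      thus "u $ a * cnj (x $ a) = (\<Sum>b<n. ?N $$ (a, b) * x $ b * cnj (x $ a))"
        unfolding u_def using HD(3)[OF c z] x by (simp add: scalar_prod_def atLeast0LessThan sum_distrib_right)
    qed
    also have "\<dots> = (\<Sum>b<n. \<Sum>a<n. ?N $$ (a, b) * x $ b * cnj (x $ a))" by (rule sum.swap)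
    also have "\<dots> = (\<Sum>b<n. \<Sum>a<n. ?N $$ (n - 1 - a, n - 1 - b) * x $ (n - 1 - b) * cnj (x $ (n - 1 - a)))"
      by (subst sum_reflect[symmetric], subst sum_reflect[symmetric]) (rule refl)
    also have "\<dots> = (\<Sum>a<n. \<Sum>b<n. flip n ?N $$ (a, b) * v $ b * cnj (v $ a))"
      by (intro sum.cong refl) (simp add: flip_entry x_def mult_ac)
    also have "\<dots> = (flip n ?N *\<^sub>v v) \<bullet>c v" by (rule scalar_prod_quadratic_form[OF flip_carrier v(1), symmetric])
    finally show "Re ((flip n ?N *\<^sub>v v) \<bullet>c v) > 0" by simp
  next
    fix c a b assume "c \<in> A" "a < n" "b < n"
    thus "smooth_on (\<lambda>z. flip n (inv_mat (H c z)) $$ (a, b)) (image_of c)"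
      by (simp add: flip_entry sm_inv)
  next
    fix c d p a b assume c: "c \<in> A" and d: "d \<in> A" and p: "p \<in> cdom c \<inter> cdom d" and ab: "a < n" "b < n"
    define s where "s i = \<sigma> c d (coord c p) powi wt n (i + 1)" for i
    have "\<sigma> c d (coord c p) \<noteq> 0" by (rule hermitian_metric_transition_nonzero[OF herm n c d p])
    hence s0: "s i \<noteq> 0" for i unfolding s_def by simp
    have sr: "s (n - 1 - i) = inverse (s i)" if "i < n" for i
      unfolding s_def wt_reflect[OF that] by (simp add: power_int_minus)
    have z: "coord c p \<in> image_of c" "coord d p \<in> image_of d" using p unfolding image_of_def by auto
    let ?M = "H c (coord c p)" and ?M' = "H d (coord d p)"
    let ?N = "inv_mat ?M"
    \<comment> \<open>The Gram matrix in the new chart is the old one between two diagonal matrices;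
      \<open>Q\<close> is the product of the inverses in reverse order.\<close>
    define Q where "Q = mat n n (\<lambda>(i, j). inverse (s i) * ?N $$ (i, j) * cnj (inverse (s j)))"
    have "?M' * Q = 1\<^sub>m n"
    proof (rule eq_matI)
      fix i j assume "i < dim_row (1\<^sub>m n)" "j < dim_col (1\<^sub>m n)"
      hence ij: "i < n" "j < n" by auto
      have M': "?M' $$ (i, k) = cnj (s i) * ?M $$ (i, k) * s k" if "k < n" for k
        using herm c d p ij that unfolding hermitian_metric_def s_def by blast
      have "(?M' * Q) $$ (i, j) = (\<Sum>k<n. ?M' $$ (i, k) * Q $$ (k, j))"
        by (rule mult_mat_entry[OF HD(1)[OF d z(2)] _ ij]) (simp add: Q_def)
      also have "\<dots> = (\<Sum>k<n. (cnj (s i) * cnj (inverse (s j))) * (?M $$ (i, k) * ?N $$ (k, j)))"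
        using ij s0 by (intro sum.cong refl) (simp add: M' Q_def)
      also have "\<dots> = (cnj (s i) * cnj (inverse (s j))) * (?M * ?N) $$ (i, j)"
        unfolding mult_mat_entry[OF HD(1)[OF c z(1)] HD(3)[OF c z(1)] ij] by (simp only: sum_distrib_left)
      also have "\<dots> = 1\<^sub>m n $$ (i, j)" unfolding HD(4)[OF c z(1)] using ij s0 by simp
      finally show "(?M' * Q) $$ (i, j) = 1\<^sub>m n $$ (i, j)" .
    qed (use HD(1)[OF d z(2)] in \<open>auto simp: Q_def\<close>)
    hence "inv_mat ?M' = Q" by (intro inv_mat_eqI[OF HD(1)[OF d z(2)]]) (simp_all add: Q_def)
    hence "flip n (inv_mat ?M') $$ (a, b) = inverse (s (n - 1 - b)) * ?N $$ (n - 1 - b, n - 1 - a)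
        * cnj (inverse (s (n - 1 - a)))"
      using ab by (simp add: flip_entry Q_def)
    also have "\<dots> = cnj (s a) * flip n ?N $$ (a, b) * s b"
      unfolding sr[OF ab(1)] sr[OF ab(2)] flip_entry[OF ab] by simp
    finally show "flip n (inv_mat ?M') $$ (a, b) =
          cnj (\<sigma> c d (coord c p) powi wt n (a + 1)) * flip n ?N $$ (a, b)
            * \<sigma> c d (coord c p) powi wt n (b + 1)" unfolding s_def .
  qed
  moreover have "Determinant.det (flip n (inv_mat (H c z))) = 1 \<and>
        chern_curvature n (\<lambda>z. flip n (inv_mat (H c z))) z +
          (\<phi> c z * adjoint_wrt (flip n (inv_mat (H c z))) (\<phi> c z)
            - adjoint_wrt (flip n (inv_mat (H c z))) (\<phi> c z) * \<phi> c z)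
        = 0\<^sub>m n n" if c: "c \<in> A" and z: "z \<in> image_of c" for c z
  proof
    note S = op[OF c]
    note HD = HD[OF c]
    have det1: "Determinant.det (flip n (inv_mat (H c w))) = 1" if w: "w \<in> image_of c" for w
    proof -
      have "Determinant.det (inv_mat (H c w)) = 1"
        using det_mult[OF HD(1)[OF w] HD(3)[OF w]] HD(2,4)[OF w] by simp
      thus ?thesis using det_flip[OF HD(3)[OF w]] by simp
    qed
    show "Determinant.det (flip n (inv_mat (H c z))) = 1" by (rule det1[OF z])
    have inv: "inv_mat (flip n (inv_mat (H c w))) = flip n (H c w)" if w: "w \<in> image_of c" for w
      by (rule inv_mat_eqI[of _ n]) (simp_all add: flip_mult HD[OF w] flip_one)
    let ?M = "H c z" and ?P = "\<phi> c z"
    let ?N = "inv_mat ?M"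
    let ?A = "adjoint_wrt ?M ?P" and ?A' = "adjoint_wrt (flip n ?N) ?P"
    have A: "?A \<in> carrier_mat n n" by (rule adjoint_wrt_carrier) (use HD[OF z] \<phi> in auto)
    have aP: "mat_adjoint ?P \<in> carrier_mat n n" using \<phi>(1) by simp
    have "?A' = flip n ?M * flip n (mat_adjoint ?P) * flip n ?N"
      unfolding adjoint_wrt_def inv[OF z] using flip_adjoint[OF \<phi>(1)] \<phi>(2) by simp
    also have "\<dots> = flip n (?N * (mat_adjoint ?P * ?M))"
      by (simp only: flip_mult[OF HD(1)[OF z] aP] flip_mult[OF mult_carrier_mat[OF aP HD(1)[OF z]] HD(3)[OF z]])
    also have "?N * (mat_adjoint ?P * ?M) = ?A"
      unfolding adjoint_wrt_def by (rule assoc_mult_mat[OF HD(3)[OF z] aP HD(1)[OF z], symmetric])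
    finally have A': "?A' = flip n ?A" .
    have PA: "?P * ?A' = flip n (?A * ?P)" unfolding A' using flip_mult[OF \<phi>(1) A] \<phi>(2) by simp
    have AP: "?A' * ?P = flip n (?P * ?A)" unfolding A' using flip_mult[OF A \<phi>(1)] \<phi>(2) by simp
    show "chern_curvature n (\<lambda>z. flip n (inv_mat (H c z))) z + (?P * ?A' - ?A' * ?P) = 0\<^sub>m n n"
    proof (rule hitchin_equationI)
      show "inv_mat (flip n ?N) \<in> carrier_mat n n" using inv[OF z] by simp
      fix a b assume ab: "a < n" "b < n"
      let ?a = "n - 1 - a" and ?b = "n - 1 - b"
      have ab': "?a < n" "?b < n" using ab by auto
      let ?K = "\<lambda>a b w. \<Sum>k<n. inv_mat (H c w) $$ (a, k) * d_z (\<lambda>v. H c v $$ (k, b)) w"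
      have "chern_curvature n (\<lambda>z. flip n (inv_mat (H c z))) z $$ (a, b)
        = - d_zbar (\<lambda>w. \<Sum>k<n. inv_mat (flip n (inv_mat (H c w))) $$ (a, k)
            * d_z (\<lambda>v. flip n (inv_mat (H c v)) $$ (k, b)) w) z"
        by (rule chern_curvature_entry[OF S z flip_carrier det1 ab])
      also have "d_zbar (\<lambda>w. \<Sum>k<n. inv_mat (flip n (inv_mat (H c w))) $$ (a, k)
            * d_z (\<lambda>v. flip n (inv_mat (H c v)) $$ (k, b)) w) z
        = d_zbar (\<lambda>w. (- 1) * ?K ?b ?a w) z"
      proof (rule d_zbar_cong[OF S z])
        fix w assume w: "w \<in> image_of c"
        have "(\<Sum>k<n. inv_mat (flip n (inv_mat (H c w))) $$ (a, k) * d_z (\<lambda>v. flip n (inv_mat (H c v)) $$ (k, b)) w)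
          = (\<Sum>k<n. H c w $$ (n - 1 - k, ?a) * d_z (\<lambda>v. inv_mat (H c v) $$ (?b, n - 1 - k)) w)"
          unfolding inv[OF w] using ab by (intro sum.cong refl) (simp add: flip_entry)
        also have "\<dots> = (\<Sum>k<n. H c w $$ (k, ?a) * d_z (\<lambda>v. inv_mat (H c v) $$ (?b, k)) w)"
          by (rule sum_reflect[of "\<lambda>k. H c w $$ (k, ?a) * d_z (\<lambda>v. inv_mat (H c v) $$ (?b, k)) w"])
        finally have eq1: "(\<Sum>k<n. inv_mat (flip n (inv_mat (H c w))) $$ (a, k)
            * d_z (\<lambda>v. flip n (inv_mat (H c v)) $$ (k, b)) w) = \<dots>" .
        \<comment> \<open>Differentiating H^-1 H = 1 replaces the derivative of H^-1 by minus the
          connection form of \<open>H\<close>: this is the sign change of the curvature under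
          duality.\<close>
        have "d_z (\<lambda>v. \<Sum>k<n. inv_mat (H c v) $$ (?b, k) * H c v $$ (k, ?a)) w
            = (\<Sum>k<n. inv_mat (H c w) $$ (?b, k) * d_z (\<lambda>v. H c v $$ (k, ?a)) w
               + d_z (\<lambda>v. inv_mat (H c v) $$ (?b, k)) w * H c w $$ (k, ?a))"
          using ab' w by (intro d_z_sum_mult)
            (auto intro!: smooth_on_imp_differentiable[OF sm_inv[OF c]]
              smooth_on_imp_differentiable[OF hermitian_metricD(4)[OF herm c]])
        moreover have "d_z (\<lambda>v. \<Sum>k<n. inv_mat (H c v) $$ (?b, k) * H c v $$ (k, ?a)) w = d_z (\<lambda>v. 1\<^sub>m n $$ (?b, ?a)) w"
        proof (rule d_z_cong[OF S w])
          fix v assume v: "v \<in> image_of c"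
          show "(\<Sum>k<n. inv_mat (H c v) $$ (?b, k) * H c v $$ (k, ?a)) = 1\<^sub>m n $$ (?b, ?a)"
            using mult_mat_entry[OF HD(3)[OF v] HD(1)[OF v] ab'(2,1)] HD(5)[OF v] by simp
        qed
        ultimately have "(\<Sum>k<n. H c w $$ (k, ?a) * d_z (\<lambda>v. inv_mat (H c v) $$ (?b, k)) w) = - ?K ?b ?a w"
          unfolding d_z_const sum.distrib by (simp add: eq_neg_iff_add_eq_0 add.commute mult.commute)
        thus "(\<Sum>k<n. inv_mat (flip n (inv_mat (H c w))) $$ (a, k)
            * d_z (\<lambda>v. flip n (inv_mat (H c v)) $$ (k, b)) w) = (- 1) * ?K ?b ?a w"
          using eq1 by simp
      qed
      also have "\<dots> = (- 1) * d_zbar (?K ?b ?a) z"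
        by (rule d_zbar_cmult[OF smooth_on_imp_differentiable[OF
              smooth_on_connection_entry[OF S HD(1) HD(2) hermitian_metricD(4)[OF herm c] ab'(2,1)] z]])
      finally have "chern_curvature n (\<lambda>z. flip n (inv_mat (H c z))) z $$ (a, b)
          = - chern_curvature n (H c) z $$ (?b, ?a)"
        using chern_curvature_entry[OF S z HD(1) HD(2) ab'(2,1)] by simp
      moreover have "(?P * ?A') $$ (a, b) - (?A' * ?P) $$ (a, b)
          = - ((?P * ?A) $$ (?b, ?a) - (?A * ?P) $$ (?b, ?a))"
        unfolding PA AP using ab by (simp only: flip_entry minus_diff_eq)
      ultimately show "chern_curvature n (\<lambda>z. flip n (inv_mat (H c z))) z $$ (a, b)
          + ((?P * ?A') $$ (a, b) - (?A' * ?P) $$ (a, b)) = 0"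
        using hitchin_equation_entry[OF sol c z \<phi>(1) ab'(2,1)] by (metis minus_add_distrib neg_equal_0_iff_equal)
    qed (use \<phi> in auto)
  qed
  ultimately show ?thesis unfolding hitchin_solution_def by blast
qed

section \<open>The Toda system of a diagonal harmonic metric\<close>

lemma inv_mat_diagonal:
  fixes X :: "complex mat"
  assumes X: "X \<in> carrier_mat n n" and off: "\<And>a b. a < n \<Longrightarrow> b < n \<Longrightarrow> a \<noteq> b \<Longrightarrow> X $$ (a, b) = 0"
    and nz: "\<And>a. a < n \<Longrightarrow> X $$ (a, a) \<noteq> 0" and ab: "a < n" "b < n"
  shows "inv_mat X $$ (a, b) = (if a = b then inverse (X $$ (a, a)) else 0)"
proof -
  let ?D = "mat_diag n (\<lambda>a. inverse (X $$ (a, a)))"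
  have "X = mat_diag n (\<lambda>a. X $$ (a, a))"
    by (rule eq_matI) (use X off in \<open>auto simp: mat_diag_def\<close>)
  from arg_cong[OF this, of "\<lambda>Y. Y * ?D"]
  have "X * ?D = mat_diag n (\<lambda>a. X $$ (a, a) * inverse (X $$ (a, a)))" unfolding mat_diag_diag .
  also have "\<dots> = 1\<^sub>m n" by (rule eq_matI) (use nz in \<open>auto simp: mat_diag_def\<close>)
  finally have "inv_mat X = ?D" by (intro inv_mat_eqI[OF X mat_diag_dim])
  thus ?thesis using ab by (auto simp: mat_diag_def)
qed

lemma det_diagonal:
  fixes X :: "complex mat"
  assumes X: "X \<in> carrier_mat n n" and off: "\<And>a b. a < n \<Longrightarrow> b < n \<Longrightarrow> a \<noteq> b \<Longrightarrow> X $$ (a, b) = 0"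
  shows "Determinant.det X = (\<Prod>a<n. X $$ (a, a))"
proof -
  have "Determinant.det X = prod_list (diag_mat X)"
    by (rule det_lower_triangular[OF _ X]) (use off in auto)
  thus ?thesis using X by (simp add: prod_list_diag_prod atLeast0LessThan)
qed

text \<open>For a diagonal metric with entries \<eta>_i the adjoint of \<phi> has the entry \<eta>_j
  / \<eta>_i times the conjugate of \<phi>_ji at (i, j). The (a, a) entry of the commutator is
  therefore the displayed sum, and the curvature entry is -1/4 times the Laplacian of ln
  \<eta>_a.\<close>

lemma toda_equation:
  assumes op: "open (image_of c)" and sol: "hitchin_solution A \<sigma> n \<phi> H" and c: "c \<in> A"
    and \<phi>: "\<And>z. \<phi> c z \<in> carrier_mat n n"
    and off: "\<And>z a b. z \<in> image_of c \<Longrightarrow> a < n \<Longrightarrow> b < n \<Longrightarrow> a \<noteq> b \<Longrightarrow> H c z $$ (a, b) = 0"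
    and a: "a < n"
  shows "laplacian_on (\<lambda>z. ln (Re (H c z $$ (a, a))))
    (\<lambda>z. 4 * (\<Sum>k<n. (norm (\<phi> c z $$ (a, k)))\<^sup>2 * Re (H c z $$ (a, a)) / Re (H c z $$ (k, k))
       - (norm (\<phi> c z $$ (k, a)))\<^sup>2 * Re (H c z $$ (k, k)) / Re (H c z $$ (a, a)))) (image_of c)"
proof -
  have herm: "hermitian_metric A \<sigma> n H" using sol unfolding hitchin_solution_def by blast
  note HD = hitchin_solutionD[OF sol c]
  have pos: "Re (H c z $$ (k, k)) > 0" and im: "Im (H c z $$ (k, k)) = 0" if "z \<in> image_of c" "k < n" for z k
    using hermitian_metric_diag[OF herm c that] by auto
  have nz: "H c z $$ (k, k) \<noteq> 0" if "z \<in> image_of c" "k < n" for z k using pos[OF that] by auto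
  have inv: "inv_mat (H c z) $$ (i, j) = (if i = j then inverse (H c z $$ (i, i)) else 0)"
    if "z \<in> image_of c" "i < n" "j < n" for z i j
    by (rule inv_mat_diagonal[OF HD(1)[OF that(1)] off[OF that(1)] nz[OF that(1)] that(2,3)])
  let ?h = "\<lambda>z. H c z $$ (a, a)"
  let ?G = "\<lambda>w. d_z ?h w / ?h w"
  \<comment> \<open>For a diagonal metric the connection form at (a, a) is the logarithmic
    derivative to which \<open>laplacian_on_ln_Re\<close> applies.\<close>
  have conn: "(\<Sum>k<n. inv_mat (H c w) $$ (a, k) * d_z (\<lambda>v. H c v $$ (k, a)) w) = ?G w" if w: "w \<in> image_of c" for w
  proof -
    have "(\<Sum>k<n. inv_mat (H c w) $$ (a, k) * d_z (\<lambda>v. H c v $$ (k, a)) w)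
      = (\<Sum>k<n. if k = a then inverse (?h w) * d_z ?h w else 0)"
      by (intro sum.cong refl) (use inv[OF w a] in auto)
    thus ?thesis using a by (simp add: field_simps)
  qed
  have smG: "smooth_on ?G (image_of c)"
    by (rule smooth_on_cong[OF op conn smooth_on_connection_entry[OF op HD(1,2) hermitian_metricD(4)[OF herm c] a a]])
  have "laplacian_on (\<lambda>z. ln (Re (?h z))) (\<lambda>z. 4 * Re (d_zbar ?G z)) (image_of c)"
    by (rule laplacian_on_ln_Re[OF op smooth_on_imp_differentiable[OF hermitian_metricD(4)[OF herm c a a]]
          im[OF _ a] pos[OF _ a] smooth_on_imp_differentiable[OF smG]])
  moreover have "4 * Re (d_zbar ?G z) =
    4 * (\<Sum>k<n. (norm (\<phi> c z $$ (a, k)))\<^sup>2 * Re (H c z $$ (a, a)) / Re (H c z $$ (k, k))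
       - (norm (\<phi> c z $$ (k, a)))\<^sup>2 * Re (H c z $$ (k, k)) / Re (H c z $$ (a, a)))" if z: "z \<in> image_of c" for z
  proof -
    let ?P = "\<phi> c z" and ?\<eta> = "\<lambda>k. Re (H c z $$ (k, k))"
    let ?A = "adjoint_wrt (H c z) ?P"
    have \<eta>: "H c z $$ (k, k) = of_real (?\<eta> k)" if "k < n" for k using im[OF z that] by (simp add: complex_eq_iff)
    have aP: "mat_adjoint ?P \<in> carrier_mat n n" using \<phi> by simp
    have NP: "inv_mat (H c z) * mat_adjoint ?P \<in> carrier_mat n n" by (rule mult_carrier_mat[OF HD(3)[OF z] aP])
    have A: "?A \<in> carrier_mat n n" by (rule adjoint_wrt_carrier[OF HD(3)[OF z] \<phi> HD(1)[OF z]])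
    have Aent: "?A $$ (i, j) = of_real (?\<eta> j / ?\<eta> i) * cnj (?P $$ (j, i))" if ij: "i < n" "j < n" for i j
    proof -
      have 1: "(inv_mat (H c z) * mat_adjoint ?P) $$ (i, l) = inverse (H c z $$ (i, i)) * cnj (?P $$ (l, i))"
        if l: "l < n" for l
      proof -
        have "(inv_mat (H c z) * mat_adjoint ?P) $$ (i, l)
          = (\<Sum>k<n. if k = i then inverse (H c z $$ (i, i)) * cnj (?P $$ (l, i)) else 0)"
          unfolding mult_mat_entry[OF HD(3)[OF z] aP ij(1) l]
          by (intro sum.cong refl) (use inv[OF z ij(1)] l in \<open>auto simp: mat_adjoint_entry[OF \<phi>]\<close>)
        thus ?thesis using ij by simp
      qed
      have "?A $$ (i, j) = (\<Sum>l<n. if l = j then inverse (H c z $$ (i, i)) * cnj (?P $$ (j, i)) * H c z $$ (j, j) else 0)"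
        unfolding adjoint_wrt_def mult_mat_entry[OF NP HD(1)[OF z] ij]
        by (intro sum.cong refl) (use off[OF z _ ij(2)] 1 in auto)
      also have "\<dots> = inverse (H c z $$ (i, i)) * cnj (?P $$ (j, i)) * H c z $$ (j, j)" using ij by simp
      also have "\<dots> = of_real (?\<eta> j / ?\<eta> i) * cnj (?P $$ (j, i))"
        by (subst \<eta>[OF ij(1)], subst \<eta>[OF ij(2)]) (simp add: field_simps)
      finally show ?thesis .
    qed
    have "d_zbar ?G z = - chern_curvature n (H c) z $$ (a, a)"
      using chern_curvature_entry[OF op z HD(1,2) a a] d_zbar_cong[OF op z conn] by simp
    also have "\<dots> = (?P * ?A) $$ (a, a) - (?A * ?P) $$ (a, a)"
      using hitchin_equation_entry[OF sol c z \<phi> a a] by (simp add: algebra_simps eq_neg_iff_add_eq_0)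
    also have "\<dots> = (\<Sum>k<n. ?P $$ (a, k) * ?A $$ (k, a) - ?A $$ (a, k) * ?P $$ (k, a))"
      unfolding mult_mat_entry[OF \<phi> A a a] mult_mat_entry[OF A \<phi> a a] by (simp add: sum_subtractf)
    also have "\<dots> = (\<Sum>k<n. of_real ((norm (?P $$ (a, k)))\<^sup>2 * ?\<eta> a / ?\<eta> k - (norm (?P $$ (k, a)))\<^sup>2 * ?\<eta> k / ?\<eta> a))"
    proof (intro sum.cong refl)
      fix k assume "k \<in> {..<n}"
      hence k: "k < n" by simp
      have "?P $$ (a, k) * ?A $$ (k, a) = of_real (?\<eta> a / ?\<eta> k) * (?P $$ (a, k) * cnj (?P $$ (a, k)))"
        unfolding Aent[OF k a] by simp
      moreover have "?A $$ (a, k) * ?P $$ (k, a) = of_real (?\<eta> k / ?\<eta> a) * (?P $$ (k, a) * cnj (?P $$ (k, a)))"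
        unfolding Aent[OF a k] by simp
      ultimately show "?P $$ (a, k) * ?A $$ (k, a) - ?A $$ (a, k) * ?P $$ (k, a)
        = of_real ((norm (?P $$ (a, k)))\<^sup>2 * ?\<eta> a / ?\<eta> k - (norm (?P $$ (k, a)))\<^sup>2 * ?\<eta> k / ?\<eta> a)"
        unfolding complex_norm_square[symmetric] by (simp add: mult.commute)
    qed
    finally show ?thesis unfolding of_real_sum[symmetric] by simp
  qed
  ultimately show ?thesis by (rule laplacian_on_cong)
qed

lemma sum_ln_diagonal_eq_0:
  assumes sol: "hitchin_solution A \<sigma> n \<phi> H" and c: "c \<in> A" and z: "z \<in> image_of c"
    and off: "\<And>a b. a < n \<Longrightarrow> b < n \<Longrightarrow> a \<noteq> b \<Longrightarrow> H c z $$ (a, b) = 0"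
  shows "(\<Sum>a<n. ln (Re (H c z $$ (a, a)))) = 0"
proof -
  have herm: "hermitian_metric A \<sigma> n H" using sol unfolding hitchin_solution_def by blast
  have pos: "Re (H c z $$ (k, k)) > 0" and eq: "H c z $$ (k, k) = of_real (Re (H c z $$ (k, k)))" if "k < n" for k
    using hermitian_metric_diag[OF herm c z that] by (auto simp: complex_eq_iff)
  have "1 = (\<Prod>a<n. H c z $$ (a, a))"
    using det_diagonal[OF hitchin_solutionD(1)[OF sol c z] off] hitchin_solutionD(2)[OF sol c z] by simp
  also have "\<dots> = (\<Prod>a<n. of_real (Re (H c z $$ (a, a))))" by (rule prod.cong[OF refl]) (use eq in auto)
  finally have "(\<Prod>a<n. Re (H c z $$ (a, a))) = 1" by (simp add: of_real_prod[symmetric] del: of_real_prod)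
  moreover have "ln (\<Prod>a<n. Re (H c z $$ (a, a))) = (\<Sum>a<n. ln (Re (H c z $$ (a, a))))"
  proof (rule ln_prod)
    show "Re (H c z $$ (i, i)) \<noteq> 0" if "i \<in> {..<n}" for i using pos[of i] that by simp
  qed simp
  ultimately show ?thesis by simp
qed

text \<open>Converts a bound for the logarithm of a quotient into one for the relative
  error.\<close>

lemma abs_exp_minus_1_le: "\<bar>exp w - 1\<bar> \<le> \<bar>w\<bar> * exp \<bar>w\<bar>" for w :: real
proof (cases "w \<ge> 0")
  case True
  have "(1 - w) * exp w \<le> exp (- w) * exp w"
    using exp_ge_add_one_self[of "- w"] by (intro mult_right_mono) auto
  thus ?thesis using True by (simp add: exp_minus field_simps)
next
  case False
  have "1 - exp w \<le> - w" using exp_ge_add_one_self[of w] by linarith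
  also have "\<dots> \<le> - w * exp (- w)" using False mult_left_mono[of 1 "exp (-w)" "-w"] by simp
  finally show ?thesis using False by simp
qed

text \<open>Treats both families: \<open>s\<close> is the factor 1 or 2, \<open>m\<close> is n or n
  - 1, and \<open>bal\<close> says that the leading terms \<open>f\<close> solve the Toda system
  with zero curvature. Indices start at 0, so the exponent n + 1 - 2 j appears as n - 1 - 2 a with j
  = a + 1.\<close>

lemma decoupling_asymptotics:
  fixes q :: "complex \<Rightarrow> complex" and s :: "nat \<Rightarrow> real" and m K :: real and n :: nat
    and \<phi> :: "real \<Rightarrow> 'a chart \<Rightarrow> complex \<Rightarrow> complex mat"
  defines "f \<equiv> \<lambda>t a z. (s a * t * norm (q z)) powr (- (real n - 1 - 2 * real a) / m)"
  assumes op: "open (image_of c)" and c: "c \<in> A" and z0: "z0 \<in> image_of c" and n: "n > 0"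
    and q: "q holomorphic_on image_of c" "q z0 \<noteq> 0"
    and sol: "\<And>t. t > 0 \<Longrightarrow> hitchin_solution A \<sigma> n (\<phi> t) (H t)"
    and \<phi>: "\<And>t z. \<phi> t c z \<in> carrier_mat n n"
    and off: "\<And>t z a b. t > 0 \<Longrightarrow> z \<in> image_of c \<Longrightarrow> a < n \<Longrightarrow> b < n \<Longrightarrow> a \<noteq> b \<Longrightarrow> H t c z $$ (a, b) = 0"
    and s: "\<And>a. s a > 0" "\<And>a. a < n \<Longrightarrow> s (n - 1 - a) = s a" and m: "m > 0" and K: "K > 0"
    and bal: "\<And>t z j. t > 0 \<Longrightarrow> q z \<noteq> 0 \<Longrightarrow> j < n \<Longrightarrow>
      (\<Sum>k<n. (norm (\<phi> t c z $$ (j, k)))\<^sup>2 * f t j z / f t k z) = (\<Sum>k<n. (norm (\<phi> t c z $$ (k, j)))\<^sup>2 * f t k z / f t j z)"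
    and Tb: "\<And>t z j k. t > 0 \<Longrightarrow> q z \<noteq> 0 \<Longrightarrow> (j, k) \<in> T \<Longrightarrow>
      (t * norm (q z)) powr (2 / m) / 2 \<le> (norm (\<phi> t c z $$ (j, k)))\<^sup>2 * f t j z / f t k z"
    and T: "T \<subseteq> {..<n} \<times> {..<n}"
    and conn: "\<And>(v :: nat \<Rightarrow> real) M. 0 \<le> M \<Longrightarrow> (\<And>j k. (j, k) \<in> T \<Longrightarrow> v j - v k \<le> M) \<Longrightarrow>
                 (\<And>j k. j < n \<Longrightarrow> k < n \<Longrightarrow> v j - v k \<le> K * M)"
    and a: "a < n"
  shows "\<exists>r\<in>O[at_top](\<lambda>t. t powr (- 2 / m)). \<forall>t>0. Re (H t c z0 $$ (a, a)) = f t a z0 * (1 + r t)"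
proof -
  have "open (image_of c \<inter> q -` (- {0}))"
    by (rule continuous_open_preimage[OF holomorphic_on_imp_continuous_on[OF q(1)] op]) (simp add: open_Compl)
  \<comment> \<open>The radius is determined by \<open>q\<close> and the chart alone. Together with
    the minimum of |q| on the disc it makes \<open>C\<close> independent of
    \<open>t\<close>.\<close>
  then obtain R where R: "R > 0" "cball z0 R \<subseteq> image_of c \<inter> q -` (- {0})"
    using z0 q(2) by (metis (no_types, lifting) ComplI IntI open_contains_cball singletonD vimageI2)
  have qc: "continuous_on (cball z0 R) q"
    by (rule continuous_on_subset[OF holomorphic_on_imp_continuous_on[OF q(1)]]) (use R in auto)
  have qnz: "q z \<noteq> 0" "z \<in> image_of c" if "z \<in> cball z0 R" for z using R that by auto
  obtain z1 where z1: "z1 \<in> cball z0 R" "\<And>z. z \<in> cball z0 R \<Longrightarrow> norm (q z1) \<le> norm (q z)"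
    using continuous_attains_inf[of "cball z0 R" "\<lambda>z. norm (q z)"] R(1) qc
    by (metis cball_eq_empty compact_cball continuous_on_norm less_le_not_le)
  define m0 where "m0 = norm (q z1)"
  have m0: "m0 > 0" using qnz(1)[OF z1(1)] by (simp add: m0_def)
  \<comment> \<open>24 from \<open>toda_decay\<close>, doubled because \<open>b0\<close> below is
    half of a power; the factor t^(-2/m) has been split off.\<close>
  define C where "C = 48 * (n * K) ^ 3 / (m0 powr (2 / m) * R\<^sup>2)"
  have C: "C \<ge> 0" unfolding C_def using K by simp
  define \<eta> where "\<eta> t j z = Re (H t c z $$ (j, j))" for t j z
  define w where "w t j z = ln (\<eta> t j z) - ln (f t j z)" for t j z
  have \<eta>pos: "\<eta> t j z > 0" if "t > 0" "j < n" "z \<in> image_of c" for t j z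
    using hermitian_metric_diag(1)[of A \<sigma> n "H t" c z j] sol[OF that(1)] c that
    unfolding hitchin_solution_def \<eta>_def by blast
  have fpos: "f t j z > 0" if "t > 0" "q z \<noteq> 0" for t j z
    unfolding f_def using that s(1)[of j] by simp
  have lnf: "ln (f t j z) = (- (real n - 1 - 2 * real j) / m) * ln (norm (q z))
      + (- (real n - 1 - 2 * real j) / m) * ln (s j * t)" if "t > 0" "q z \<noteq> 0" for t j z
    unfolding f_def using that s(1)[of j] by (simp add: ln_powr ln_mult algebra_simps add_divide_distrib diff_divide_distrib)
  have bound: "\<bar>w t a z0\<bar> \<le> C * t powr (- 2 / m)" if t: "t > 0" for t
  proof -
    \<comment> \<open>The edge weights with the leading terms in place of the metric. Multiplied by
      \<open>exp (w t j z - w t k z)\<close> they become the actual ones.\<close>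
    define E where "E z j k = (norm (\<phi> t c z $$ (j, k)))\<^sup>2 * f t j z / f t k z" for z j k
    define b0 where "b0 = (t * m0) powr (2 / m) / 2"
    have b0: "b0 > 0" unfolding b0_def using t m0 by simp
    have herm: "hermitian_metric A \<sigma> n (H t)" using sol[OF t] unfolding hitchin_solution_def by blast
    have "\<bar>w t a z0\<bar> \<le> 24 * (n * K) ^ 3 / (b0 * R\<^sup>2)"
    proof (rule toda_decay[where E = E and T = T and w = "w t" and K = K])
      fix j assume j: "j < n"
      have "continuous_on (cball z0 R) (\<lambda>z. H t c z $$ (j, j))"
        by (rule continuous_on_subset[OF smooth_on_imp_continuous_on[OF hermitian_metricD(4)[OF herm c j j]]])
          (use R in auto)
      hence "continuous_on (cball z0 R) (\<eta> t j)" unfolding \<eta>_def by (intro continuous_intros)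
      moreover have "continuous_on (cball z0 R) (f t j)"
        unfolding f_def using qc s(1)[of j] t qnz(1) by (intro continuous_intros) auto
      ultimately show "continuous_on (cball z0 R) (w t j)"
        unfolding w_def using \<eta>pos[OF t j] fpos[OF t] qnz
        by (intro continuous_intros) (auto simp: less_imp_neq[THEN not_sym])
      have sub: "ball z0 R \<subseteq> image_of c" "\<And>z. z \<in> ball z0 R \<Longrightarrow> q z \<noteq> 0"
        using qnz ball_subset_cball[of z0 R] by blast+
      let ?\<alpha> = "- (real n - 1 - 2 * real j) / m"
      have "laplacian_on (\<lambda>z. ?\<alpha> * ln (norm (q z)) + ?\<alpha> * ln (s j * t)) (\<lambda>z. ?\<alpha> * 0 + ?\<alpha> * 0) (ball z0 R)"
        by (intro laplacian_on_lincomb laplacian_on_const laplacian_on_ln_norm_holomorphic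
            holomorphic_on_subset[OF q(1)] sub)
      hence lf: "laplacian_on (\<lambda>z. ln (f t j z)) (\<lambda>z. 0) (ball z0 R)"
        using laplacian_on_eq_fun[OF open_ball lnf[OF t sub(2), symmetric]] by simp
      have l\<eta>: "laplacian_on (\<lambda>z. ln (\<eta> t j z)) (\<lambda>z. 4 * (\<Sum>k<n. (norm (\<phi> t c z $$ (j, k)))\<^sup>2 * \<eta> t j z / \<eta> t k z
          - (norm (\<phi> t c z $$ (k, j)))\<^sup>2 * \<eta> t k z / \<eta> t j z)) (ball z0 R)"
        unfolding \<eta>_def
        by (rule laplacian_on_subset[OF toda_equation[OF op sol[OF t] c \<phi> off[OF t] j] sub(1)])
      show "laplacian_on (w t j)
         (\<lambda>z. 4 * (\<Sum>k<n. E z j k * exp (w t j z - w t k z) - E z k j * exp (w t k z - w t j z))) (ball z0 R)"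
      proof (rule laplacian_on_cong)
        have "w t j = (\<lambda>z. 1 * ln (\<eta> t j z) + (- 1) * ln (f t j z))" unfolding w_def by auto
        thus "laplacian_on (w t j) (\<lambda>z. 1 * (4 * (\<Sum>k<n. (norm (\<phi> t c z $$ (j, k)))\<^sup>2 * \<eta> t j z / \<eta> t k z
          - (norm (\<phi> t c z $$ (k, j)))\<^sup>2 * \<eta> t k z / \<eta> t j z)) + (- 1) * 0) (ball z0 R)"
          using laplacian_on_lincomb[OF l\<eta> lf, of 1 "- 1"] by simp
        fix z assume z: "z \<in> ball z0 R"
        have ex: "E z i k * exp (w t i z - w t k z) = (norm (\<phi> t c z $$ (i, k)))\<^sup>2 * \<eta> t i z / \<eta> t k z"
          if "i < n" "k < n" for i k
        proof -
          have p: "\<eta> t i z > 0" "\<eta> t k z > 0" "f t i z > 0" "f t k z > 0"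
            using \<eta>pos[OF t] fpos[OF t] sub z that by auto
          have "exp (w t i z - w t k z) = (\<eta> t i z / f t i z) / (\<eta> t k z / f t k z)"
            unfolding w_def using p by (simp add: exp_diff)
          thus ?thesis unfolding E_def using p by (simp add: field_simps)
        qed
        show "1 * (4 * (\<Sum>k<n. (norm (\<phi> t c z $$ (j, k)))\<^sup>2 * \<eta> t j z / \<eta> t k z
            - (norm (\<phi> t c z $$ (k, j)))\<^sup>2 * \<eta> t k z / \<eta> t j z)) + (- 1) * 0
          = 4 * (\<Sum>k<n. E z j k * exp (w t j z - w t k z) - E z k j * exp (w t k z - w t j z))"
          using ex j by simp
      qed
    next
      fix z assume z: "z \<in> ball z0 R"
      hence zc: "z \<in> image_of c" "q z \<noteq> 0" using qnz[of z] by auto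
      show "0 \<le> E z j k" if "j < n" "k < n" for j k
        unfolding E_def using fpos[OF t zc(2)] by (simp add: less_imp_le)
      show "(\<Sum>k<n. E z j k) = (\<Sum>k<n. E z k j)" if "j < n" for j
        unfolding E_def by (rule bal[OF t zc(2) that])
      show "b0 \<le> E z j k" if "(j, k) \<in> T" for j k
      proof -
        have "b0 \<le> (t * norm (q z)) powr (2 / m) / 2"
          unfolding b0_def using z1(2)[of z] z t m m0 by (intro divide_right_mono powr_mono2) (auto simp: m0_def)
        also have "\<dots> \<le> E z j k" unfolding E_def by (rule Tb[OF t zc(2) that])
        finally show ?thesis .
      qed
      have "(\<Sum>j<n. ln (\<eta> t j z)) = 0"
        unfolding \<eta>_def by (rule sum_ln_diagonal_eq_0[OF sol[OF t] c zc(1) off[OF t zc(1)]])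
      moreover have "(\<Sum>j<n. ln (f t j z)) = 0"
      proof -
        \<comment> \<open>Under the reflection of the indices the exponents are odd and
          \<open>s\<close> is even, so the logarithms cancel in pairs.\<close>
        have "(\<Sum>j<n. ln (f t j z)) = (\<Sum>j<n. ln (f t (n - 1 - j) z))" by (rule sum_reflect[symmetric])
        also have "\<dots> = (\<Sum>j<n. - ln (f t j z))"
        proof (intro sum.cong refl)
          fix j assume "j \<in> {..<n}"
          hence j: "j < n" by simp
          have rj: "real n - 1 - 2 * real (n - 1 - j) = - (real n - 1 - 2 * real j)" using j by (simp add: of_nat_diff)
          thus "ln (f t (n - 1 - j) z) = - ln (f t j z)"
            unfolding lnf[OF t zc(2)] s(2)[OF j] rj by (simp add: diff_divide_distrib algebra_simps)
        qed
        finally show ?thesis by (simp add: sum_negf)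
      qed
      ultimately show "(\<Sum>j<n. w t j z) = 0" unfolding w_def by (simp add: sum_subtractf)
    qed (use R T b0 K n a conn in auto)
    also have "24 * (n * K) ^ 3 / (b0 * R\<^sup>2) = C * t powr (- 2 / m)"
      unfolding b0_def C_def using t m0 by (simp add: powr_mult powr_minus divide_simps)
    finally show ?thesis .
  qed
  define r where "r t = \<eta> t a z0 / f t a z0 - 1" for t
  have "r \<in> O[at_top](\<lambda>t. t powr (- 2 / m))"
  proof (rule bigoI[where c = "C * exp C"])
    show "\<forall>\<^sub>F t in at_top. norm (r t) \<le> C * exp C * norm (t powr (- 2 / m))"
      using eventually_ge_at_top[of 1]
    proof (rule eventually_mono)
      fix t :: real assume t: "t \<ge> 1"
      hence t0: "t > 0" by simp
      \<comment> \<open>For t \<ge> 1 this bounds |w| by \<open>C\<close>, so that the factor exp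
        |w| is absorbed into the constant.\<close>
      have "t powr (- 2 / m) \<le> t powr 0" using t m by (intro powr_mono) auto
      hence "C * t powr (- 2 / m) \<le> C" using C t by (simp add: mult_left_le)
      hence wC: "\<bar>w t a z0\<bar> \<le> C" using bound[OF t0] by simp
      have "exp (w t a z0) = \<eta> t a z0 / f t a z0"
        unfolding w_def using \<eta>pos[OF t0 a z0] fpos[OF t0 q(2)] by (simp add: exp_diff)
      hence "norm (r t) = \<bar>exp (w t a z0) - 1\<bar>" unfolding r_def by simp
      also have "\<dots> \<le> \<bar>w t a z0\<bar> * exp \<bar>w t a z0\<bar>" by (rule abs_exp_minus_1_le)
      also have "\<dots> \<le> (C * t powr (- 2 / m)) * exp C"
        using bound[OF t0] wC C by (intro mult_mono) auto
      finally show "norm (r t) \<le> C * exp C * norm (t powr (- 2 / m))" by (simp add: mult_ac)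
    qed
  qed
  moreover have "Re (H t c z0 $$ (a, a)) = f t a z0 * (1 + r t)" if "t > 0" for t
    unfolding r_def \<eta>_def using fpos[OF that q(2), of a] by simp
  ultimately show ?thesis by blast
qed

section \<open>The two families of Higgs fields\<close>

text \<open>Twisting with the m-th roots of unity multiplies the entry (a, b) by a root of unity
  that depends only on b - a modulo m. The nonzero entries of the Higgs field all lie in the class
  -1, so they receive one common factor; by uniqueness an entry of \<open>H\<close> survives only if
  its own factor is 1.\<close>

lemma harmonic_metric_graded:
  assumes op: "\<And>c. c \<in> A \<Longrightarrow> open (image_of c)" and harm: "harmonic_metric A \<sigma> n \<phi> H" and m: "m > 0"
    and \<phi>: "\<And>c z. \<phi> c z \<in> carrier_mat n n"
      "\<And>c z a b. a < n \<Longrightarrow> b < n \<Longrightarrow> \<phi> c z $$ (a, b) \<noteq> 0 \<Longrightarrow> \<exists>k. int b - int a = k * int m - 1"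
    and c: "c \<in> A" "z \<in> image_of c" and ab: "a < n" "b < n" and nz: "H c z $$ (a, b) \<noteq> 0"
  shows "int m dvd int b - int a"
proof -
  define g where "g a = cis (2 * pi * real a / real m)" for a :: nat
  have gg: "cnj (g i) * g j = cis (2 * pi * (real_of_int (int j - int i) / real m))" for i j
    unfolding g_def cis_cnj cis_mult by (simp add: diff_divide_distrib algebra_simps)
  have "twist g n (\<phi> c z) = cis (- 2 * pi / real m) \<cdot>\<^sub>m \<phi> c z" for c z
  proof (rule eq_matI)
    fix i j assume "i < dim_row (cis (- 2 * pi / real m) \<cdot>\<^sub>m \<phi> c z)" "j < dim_col (cis (- 2 * pi / real m) \<cdot>\<^sub>m \<phi> c z)"
    hence ij: "i < n" "j < n" using \<phi>(1)[of c z] by auto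
    have "cnj (g i) * g j * \<phi> c z $$ (i, j) = cis (- 2 * pi / real m) * \<phi> c z $$ (i, j)"
    proof (cases "\<phi> c z $$ (i, j) = 0")
      case False
      then obtain k where k: "int j - int i = k * int m - 1" using \<phi>(2)[OF ij] by blast
      have "2 * pi * (real_of_int (int j - int i) / real m) = 2 * pi * of_int k + (- 2 * pi / real m)"
        unfolding k using m by (simp add: field_simps)
      hence "cnj (g i) * g j = cis (2 * pi * of_int k) * cis (- 2 * pi / real m)"
        unfolding gg cis_mult by simp
      thus ?thesis by simp
    qed simp
    thus "twist g n (\<phi> c z) $$ (i, j) = (cis (- 2 * pi / real m) \<cdot>\<^sub>m \<phi> c z) $$ (i, j)"
      using ij \<phi>(1)[of c z] by (simp add: twist_entry mult_ac)
  qed (use \<phi>(1)[of c z] in \<open>auto simp: twist_def\<close>)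
  moreover have "norm (g i) = 1" for i unfolding g_def by simp
  ultimately have "hitchin_solution A \<sigma> n \<phi> (\<lambda>c z. twist g n (H c z))"
    using hitchin_solution_twist[where A = A and \<sigma> = \<sigma> and H = H and g = g and \<kappa> = "cis (- 2 * pi / real m)" and \<phi> = \<phi> and n = n,
        OF op _ _ _ \<phi>(1)] harm
    unfolding harmonic_metric_def by auto
  hence "twist g n (H c z) = H c z" using harm c unfolding harmonic_metric_def by blast
  hence "cnj (g a) * H c z $$ (a, b) * g b = H c z $$ (a, b)" using twist_entry[OF ab, of g "H c z"] by simp
  hence "cnj (g a) * g b = 1" using nz by (simp add: mult_ac)
  hence "cos (2 * pi * (real_of_int (int b - int a) / real m)) = 1" unfolding gg by (simp add: complex_eq_iff)
  then obtain k :: int where "2 * pi * (real_of_int (int b - int a) / real m) = real_of_int k * 2 * pi"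
    unfolding cos_one_2pi_int by blast
  hence "2 * pi * (real_of_int (int b - int a) / real m) = 2 * pi * real_of_int k" by (simp only: mult_ac)
  hence "real_of_int (int b - int a) / real m = real_of_int k"
    by (subst (asm) mult_left_cancel) simp_all
  hence "real_of_int (int b - int a) = real_of_int (k * int m)" using m by (simp add: field_simps)
  hence "int b - int a = k * int m" by (simp only: of_int_eq_iff)
  thus ?thesis by simp
qed

lemma higgs_field_carrier: "e \<in> carrier_mat n n \<Longrightarrow> higgs_field n e q t c z \<in> carrier_mat n n"
  unfolding higgs_field_def e_tilde1_def by auto

lemma higgs_field_entry:
  assumes "e \<in> carrier_mat n n" "a < n" "b < n"
  shows "higgs_field n e q t c z $$ (a, b) = (if a = b + 1 then 1 else 0) + of_real t * q c z * e $$ (a, b)"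
  using assms unfolding higgs_field_def e_tilde1_def by auto

lemma e_n1_carrier: "e_n1 n \<in> carrier_mat n n" and e_n2_carrier: "e_n2 n \<in> carrier_mat n n"
  unfolding e_n1_def e_n2_def by auto

lemma e_n1_entry: "a < n \<Longrightarrow> b < n \<Longrightarrow> e_n1 n $$ (a, b) = (if a = 0 \<and> b = n - 1 then 1 else 0)"
  unfolding e_n1_def by auto

lemma e_n2_entry: "a < n \<Longrightarrow> b < n \<Longrightarrow> n \<ge> 3 \<Longrightarrow>
    e_n2 n $$ (a, b) = (if (a = 0 \<and> b = n - 2) \<or> (a = 1 \<and> b = n - 1) then 1 else 0)"
  unfolding e_n2_def by auto

lemma norm_higgs_n1:
  assumes "j < n" "k < n" "n \<ge> 2" "t > 0"
  shows "(norm (higgs_field n (e_n1 n) q t c z $$ (j, k)))\<^sup>2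
    = (if j = k + 1 then 1 else 0) + (if j = 0 \<and> k = n - 1 then (t * norm (q c z))\<^sup>2 else 0)"
  using assms by (auto simp: higgs_field_entry[OF e_n1_carrier] e_n1_entry norm_mult)

lemma norm_higgs_n2:
  assumes "j < n" "k < n" "n \<ge> 3" "t > 0"
  shows "(norm (higgs_field n (e_n2 n) q t c z $$ (j, k)))\<^sup>2
    = (if j = k + 1 then 1 else 0)
      + (if (j = 0 \<and> k = n - 2) \<or> (j = 1 \<and> k = n - 1) then (t * norm (q c z))\<^sup>2 else 0)"
  using assms by (auto simp: higgs_field_entry[OF e_n2_carrier] e_n2_entry norm_mult)

text \<open>The entries of the Higgs field have b - a equal to -1 or n - 1, both in the class -1
  modulo n, and a nonzero |b - a| < n is not divisible by n.\<close>

lemma harmonic_metric_n1_diagonal: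
  assumes op: "\<And>c. c \<in> A \<Longrightarrow> open (image_of c)" and n: "n \<ge> 2"
    and harm: "harmonic_metric A \<sigma> n (higgs_field n (e_n1 n) q t) H"
    and c: "c \<in> A" "z \<in> image_of c" and ab: "a < n" "b < n" "a \<noteq> b"
  shows "H c z $$ (a, b) = 0"
proof (rule ccontr)
  assume nz: "H c z $$ (a, b) \<noteq> 0"
  have "int n dvd int b - int a"
  proof (rule harmonic_metric_graded[OF op harm _ higgs_field_carrier[OF e_n1_carrier] _ c ab(1,2) nz])
    fix c z i j assume ij: "i < n" "j < n" and "higgs_field n (e_n1 n) q t c z $$ (i, j) \<noteq> 0"
    hence "i = j + 1 \<or> (i = 0 \<and> j = n - 1)"
      by (auto simp: higgs_field_entry[OF e_n1_carrier] e_n1_entry split: if_splits)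
    thus "\<exists>k. int j - int i = k * int n - 1"
    proof
      assume "i = j + 1"
      thus ?thesis by (intro exI[of _ 0]) simp
    next
      assume "i = 0 \<and> j = n - 1"
      thus ?thesis using n by (intro exI[of _ 1]) simp
    qed
  qed (use n in auto)
  hence "\<bar>int n\<bar> \<le> \<bar>int b - int a\<bar>" using ab(3) by (intro dvd_imp_le_int) auto
  thus False using ab by linarith
qed

text \<open>Here b - a is -1 or n - 2, so the grading is only modulo n - 1 and cannot separate the
  first summand from the last, whose indices differ by n - 1. Duality does: uniqueness gives flip
  (H^-1) = H, and the corner entry is multiplied by a positive diagonal entry in an expression that
  is 0.\<close>

lemma harmonic_metric_n2_diagonal:
  assumes op: "\<And>c. c \<in> A \<Longrightarrow> open (image_of c)" and n: "n \<ge> 3"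
    and harm: "harmonic_metric A \<sigma> n (higgs_field n (e_n2 n) q t) H"
    and c: "c \<in> A" "z \<in> image_of c" and ab: "a < n" "b < n" "a \<noteq> b"
  shows "H c z $$ (a, b) = 0"
proof -
  let ?\<phi> = "higgs_field n (e_n2 n) q t"
  have sol: "hitchin_solution A \<sigma> n ?\<phi> H" using harm unfolding harmonic_metric_def by blast
  have herm: "hermitian_metric A \<sigma> n H" using sol unfolding hitchin_solution_def by blast
  have corner: "(i = 0 \<and> j = n - 1) \<or> (i = n - 1 \<and> j = 0)"
    if nz: "H c z $$ (i, j) \<noteq> 0" and ij: "i < n" "j < n" "i \<noteq> j" for i j
  proof -
    have "int (n - 1) dvd int j - int i"
    proof (rule harmonic_metric_graded[OF op harm _ higgs_field_carrier[OF e_n2_carrier] _ c ij(1,2) nz])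
      fix c z i j assume ij: "i < n" "j < n" and "?\<phi> c z $$ (i, j) \<noteq> 0"
      hence "i = j + 1 \<or> (i = 0 \<and> j = n - 2) \<or> (i = 1 \<and> j = n - 1)"
        using n by (auto simp: higgs_field_entry[OF e_n2_carrier] e_n2_entry split: if_splits)
      thus "\<exists>k. int j - int i = k * int (n - 1) - 1"
      proof
        assume "i = j + 1"
        thus ?thesis by (intro exI[of _ 0]) simp
      next
        assume "(i = 0 \<and> j = n - 2) \<or> (i = 1 \<and> j = n - 1)"
        thus ?thesis using n by (intro exI[of _ 1]) auto
      qed
    qed (use n in auto)
    hence "\<bar>int (n - 1)\<bar> \<le> \<bar>int j - int i\<bar>" using ij(3) by (intro dvd_imp_le_int) auto
    thus ?thesis using ij by linarith
  qed
  have "flip n (?\<phi> c z) = ?\<phi> c z" for c z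
  proof (rule eq_matI)
    fix i j assume "i < dim_row (?\<phi> c z)" "j < dim_col (?\<phi> c z)"
    hence ij: "i < n" "j < n" using higgs_field_carrier[OF e_n2_carrier, of n q t c z] by auto
    \<comment> \<open>The reflection preserves the subdiagonal and exchanges the two positions of
      q_(n-1), which carry the same entry.\<close>
    have "n - 1 - j = n - 1 - i + 1 \<longleftrightarrow> i = j + 1" using ij by auto
    moreover have "(n - 1 - j = 0 \<and> n - 1 - i = n - 2) \<or> (n - 1 - j = 1 \<and> n - 1 - i = n - 1)
        \<longleftrightarrow> (i = 0 \<and> j = n - 2) \<or> (i = 1 \<and> j = n - 1)" using ij n by auto
    ultimately show "flip n (?\<phi> c z) $$ (i, j) = ?\<phi> c z $$ (i, j)"
      using ij n by (simp only: flip_entry higgs_field_entry[OF e_n2_carrier] e_n2_entry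
          diff_less_Suc diff_less less_imp_diff_less)
  qed (use higgs_field_carrier[OF e_n2_carrier, of n q t c z] in \<open>auto simp: flip_def\<close>)
  hence "hitchin_solution A \<sigma> n ?\<phi> (\<lambda>c z. flip n (inv_mat (H c z)))"
    using hitchin_solution_flip[OF op sol _ higgs_field_carrier[OF e_n2_carrier]] n by simp
  hence fl: "flip n (inv_mat (H c z)) = H c z" using harm c unfolding harmonic_metric_def by blast
  note HD = hitchin_solutionD[OF sol c]
  have "H c z * flip n (H c z) = flip n (inv_mat (H c z)) * flip n (H c z)" using fl by simp
  also have "\<dots> = 1\<^sub>m n" unfolding flip_mult[OF HD(3) HD(1)] HD(4) by (rule flip_one)
  finally have one: "H c z * flip n (H c z) = 1\<^sub>m n" .
  have n1: "0 < n" "n - 1 < n" "n - 1 \<noteq> 0" using n by auto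
  \<comment> \<open>In the corner of \<open>H * flip H = 1\<close> the two surviving terms are equal, so they vanish.\<close>
  have "(\<Sum>k<n. H c z $$ (0, k) * flip n (H c z) $$ (k, n - 1)) = 0"
    using mult_mat_entry[OF HD(1) flip_carrier n1(1,2), of "H c z"] one n1 by simp
  also have "(\<Sum>k<n. H c z $$ (0, k) * flip n (H c z) $$ (k, n - 1))
     = (\<Sum>k\<in>{0, n - 1}. H c z $$ (0, k) * flip n (H c z) $$ (k, n - 1))"
    by (rule sum.mono_neutral_right) (use n corner[of 0] in auto)
  also have "\<dots> = 2 * (H c z $$ (0, 0) * H c z $$ (0, n - 1))"
    using n1 by (simp add: flip_entry)
  finally have "H c z $$ (0, n - 1) = 0"
    using hermitian_metric_diag(1)[OF herm c n1(1)] by auto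
  moreover have "H c z $$ (n - 1, 0) = cnj (H c z $$ (0, n - 1))"
    using mat_adjoint_entry[OF HD(1) n1(2,1)] hermitian_metricD(2)[OF herm c] by simp
  ultimately show ?thesis using corner[of a b] ab by auto
qed

text \<open>Two nestings, because \<open>sum.delta\<close> requires the condition on the summation
  variable to be outermost.\<close>

lemma if_conj_nest: "(if P \<and> Q then x else y) = (if P then if Q then x else y else y)"
  and if_conj_swap: "(if P \<and> Q then x else y) = (if Q then if P then x else y else y)"
  by simp_all

text \<open>The boundary cases are the point: no subdiagonal edge leaves vertex 0, and none enters
  the last vertex.\<close>

lemma sum_indicator_shift:
  fixes P :: "nat \<Rightarrow> real"
  assumes "j < n"
  shows "(\<Sum>k<n. if j = k + 1 then P k else 0) = (if j = 0 then 0 else P (j - 1))"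
    and "(\<Sum>k<n. if k = j + 1 then P k else 0) = (if j + 1 < n then P (j + 1) else 0)"
proof -
  have "(\<Sum>k<n. if j = k + 1 then P k else 0) = (\<Sum>k<n. if k = j - 1 then (if j = 0 then 0 else P (j - 1)) else 0)"
    by (intro sum.cong refl) auto
  thus "(\<Sum>k<n. if j = k + 1 then P k else 0) = (if j = 0 then 0 else P (j - 1))" using assms by simp
  show "(\<Sum>k<n. if k = j + 1 then P k else 0) = (if j + 1 < n then P (j + 1) else 0)" by simp
qed

lemma steps_bound:
  fixes v :: "nat \<Rightarrow> real"
  assumes M: "0 \<le> M" and st: "\<And>i. i + 1 < n \<Longrightarrow> v (i + 1) - v i \<le> M" and ij: "i \<le> j" "j < n"
  shows "v j - v i \<le> n * M"
proof -
  have "v (i + d) - v i \<le> d * M" if "i + d < n" for d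
    using that
  proof (induction d)
    case (Suc d)
    have "v (i + d + 1) - v (i + d) \<le> M" using Suc.prems by (intro st) simp
    moreover have "v (i + d) - v i \<le> d * M" using Suc by simp
    ultimately show ?case by (simp add: algebra_simps)
  qed simp
  from this[of "j - i"] have "v j - v i \<le> (j - i) * M" using ij by simp
  also have "\<dots> \<le> n * M" using ij M by (intro mult_right_mono) auto
  finally show ?thesis .
qed

section \<open>Edge weights of the leading terms\<close>

lemma powr_quotient:
  fixes x N m :: real
  shows "x powr (- (N - 1 - 2 * a) / m) / x powr (- (N - 1 - 2 * b) / m) = x powr (2 * (a - b) / m)"
  unfolding powr_diff[symmetric] by (rule arg_cong[where f = "\<lambda>y. x powr y"]) (simp add: diff_divide_distrib[symmetric] algebra_simps)

text \<open>Each step down contributes the exponent 2 / n of t |q|. On the closing edge the factor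
  (t |q|)^2 leaves 2 - 2 (n - 1) / n, again 2 / n. All weights on the cycle coincide, which is why
  these leading terms are balanced.\<close>

lemma edge_weight_n1:
  assumes n: "n \<ge> 2" and t: "t > 0" and q: "q c z \<noteq> (0::complex)" and jk: "j < n" "k < n"
  shows "(norm (higgs_field n (e_n1 n) q t c z $$ (j, k)))\<^sup>2
      * (1 * t * norm (q c z)) powr (- (real n - 1 - 2 * real j) / real n)
      / (1 * t * norm (q c z)) powr (- (real n - 1 - 2 * real k) / real n)
    = (if j = k + 1 then (t * norm (q c z)) powr (2 / real n) else 0)
      + (if j = 0 \<and> k = n - 1 then (t * norm (q c z)) powr (2 / real n) else 0)"
proof -
  let ?x = "t * norm (q c z)"
  have x: "?x > 0" using t q by simp
  have "(norm (higgs_field n (e_n1 n) q t c z $$ (j, k)))\<^sup>2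
      * ?x powr (- (real n - 1 - 2 * real j) / real n) / ?x powr (- (real n - 1 - 2 * real k) / real n)
    = (norm (higgs_field n (e_n1 n) q t c z $$ (j, k)))\<^sup>2 * ?x powr (2 * (real j - real k) / real n)"
    unfolding times_divide_eq_right[symmetric] powr_quotient ..
  also have "\<dots> = (if j = k + 1 then ?x powr (2 / real n) else 0) + (if j = 0 \<and> k = n - 1 then ?x powr (2 / real n) else 0)"
  proof -
    have "?x\<^sup>2 * ?x powr (2 * (real 0 - real (n - 1)) / real n) = ?x powr (2 / real n)"
    proof -
      have "?x\<^sup>2 = ?x powr 2" using x by simp
      hence "?x\<^sup>2 * ?x powr (2 * (real 0 - real (n - 1)) / real n) = ?x powr (2 + 2 * (real 0 - real (n - 1)) / real n)"
        by (simp only: powr_add)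
      also have "2 + 2 * (real 0 - real (n - 1)) / real n = 2 / real n"
        using n by (simp add: of_nat_diff field_simps)
      finally show ?thesis .
    qed
    thus ?thesis unfolding norm_higgs_n1[OF jk n t] using n by auto
  qed
  finally show ?thesis by simp
qed

text \<open>The cycles 0, n - 2, ..., 1, 0 and 1, n - 1, n - 2, ..., 1 share the edges from n - 2
  down to 1. In units of (2 t |q|)^(2 / (n - 1)) each cycle carries the flow 1 / 2, so the shared
  edges carry 1. The factor 2 at the inner summands achieves this.\<close>

lemma edge_weight_n2:
  assumes n: "n \<ge> 3" and t: "t > 0" and q: "q c z \<noteq> (0::complex)" and jk: "j < n" "k < n"
  defines "s \<equiv> \<lambda>a. if a = 0 \<or> a = n - 1 then 1 else 2 :: real"
  shows "(norm (higgs_field n (e_n2 n) q t c z $$ (j, k)))\<^sup>2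
      * (s j * t * norm (q c z)) powr (- (real n - 1 - 2 * real j) / (real n - 1))
      / (s k * t * norm (q c z)) powr (- (real n - 1 - 2 * real k) / (real n - 1))
    = (if j = k + 1 then (if k = 0 \<or> j = n - 1 then 1 / 2 else 1) * (2 * t * norm (q c z)) powr (2 / (real n - 1)) else 0)
      + (if j = 0 \<and> k = n - 2 then (2 * t * norm (q c z)) powr (2 / (real n - 1)) / 2 else 0)
      + (if j = 1 \<and> k = n - 1 then (2 * t * norm (q c z)) powr (2 / (real n - 1)) / 2 else 0)"
proof -
  let ?y = "2 * t * norm (q c z)" and ?m = "real n - 1"
  \<comment> \<open>The quotient of the leading term by the same power of \<open>2 t |q|\<close>.\<close>
  define \<rho> where "\<rho> a = (if a = 0 then 2 else if a = n - 1 then 1 / 2 else 1 :: real)" for a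
  have y: "?y > 0" using t q by simp
  have m: "?m > 0" using n by simp
  have f: "(s a * t * norm (q c z)) powr (- (real n - 1 - 2 * real a) / ?m)
      = \<rho> a * ?y powr (- (real n - 1 - 2 * real a) / ?m)" if a: "a < n" for a
  proof -
    consider "a = 0" | "a = n - 1" "a \<noteq> 0" | "a \<noteq> 0" "a \<noteq> n - 1" by blast
    thus ?thesis
    proof cases
      case 1
      have "- (real n - 1 - 2 * real a) / ?m = - 1" using 1 m by (simp add: field_simps)
      thus ?thesis using 1 y t q by (simp add: s_def \<rho>_def powr_minus field_simps)
    next
      case 2
      have "- (real n - 1 - 2 * real a) / ?m = 1" using 2 m n by (simp add: of_nat_diff field_simps)
      thus ?thesis using 2 y t q by (simp add: s_def \<rho>_def)
    qed (simp add: s_def \<rho>_def)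
  qed
  let ?N = "(norm (higgs_field n (e_n2 n) q t c z $$ (j, k)))\<^sup>2"
  have "?N * (\<rho> j * ?y powr (- (real n - 1 - 2 * real j) / ?m)) / (\<rho> k * ?y powr (- (real n - 1 - 2 * real k) / ?m))
    = ?N * (\<rho> j / \<rho> k) * (?y powr (- (real n - 1 - 2 * real j) / ?m) / ?y powr (- (real n - 1 - 2 * real k) / ?m))"
    by simp
  also have "\<dots> = ?N * (\<rho> j / \<rho> k) * ?y powr (2 * (real j - real k) / ?m)"
    unfolding powr_quotient ..
  also have "\<dots> = (if j = k + 1 then (if k = 0 \<or> j = n - 1 then 1 / 2 else 1) * ?y powr (2 / ?m) else 0)
      + (if j = 0 \<and> k = n - 2 then ?y powr (2 / ?m) / 2 else 0)
      + (if j = 1 \<and> k = n - 1 then ?y powr (2 / ?m) / 2 else 0)"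
  proof -
    \<comment> \<open>Both closing edges raise the index by n - 2, and 2 - 2 (n - 2) / (n - 1) = 2 /
      (n - 1).\<close>
    have pw: "?y\<^sup>2 * ?y powr (2 * (real i - real l) / ?m) = ?y powr (2 / ?m)"
      if "real l - real i = real n - 2" for i l
    proof -
      have "?y\<^sup>2 = ?y powr 2" using y by simp
      hence "?y\<^sup>2 * ?y powr (2 * (real i - real l) / ?m) = ?y powr (2 + 2 * (real i - real l) / ?m)"
        by (simp only: powr_add)
      also have "2 + 2 * (real i - real l) / ?m = 2 / ?m"
      proof -
        have "real i - real l = - (real n - 2)" using that by linarith
        thus ?thesis using m by (simp add: field_simps)
      qed
      finally show ?thesis .
    qed
    consider "j = k + 1" | "j = 0" "k = n - 2" | "j = 1" "k = n - 1"
      | "j \<noteq> k + 1" "\<not> (j = 0 \<and> k = n - 2)" "\<not> (j = 1 \<and> k = n - 1)" by blast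
    thus ?thesis
    proof cases
      case 1
      have "?N = 1" unfolding norm_higgs_n2[OF jk n t] using 1 n by auto
      moreover have "\<rho> j / \<rho> k = (if k = 0 \<or> j = n - 1 then 1 / 2 else 1)"
        unfolding \<rho>_def using 1 n jk by auto
      moreover have "real j - real k = 1" using 1 by simp
      ultimately show ?thesis using 1 n by auto
    next
      case 2
      \<comment> \<open>\<open>?y\<close> contains the factor 2, whence the 4; the quotient 2 of the
        values of \<rho> then leaves the weight 1 / 2.\<close>
      have "?N = ?y\<^sup>2 / 4" unfolding norm_higgs_n2[OF jk n t] using 2 n by (auto simp: power_mult_distrib)
      moreover have "\<rho> j / \<rho> k = 2" unfolding \<rho>_def using 2 n by auto
      moreover have "?y\<^sup>2 * ?y powr (2 * (real j - real k) / ?m) = ?y powr (2 / ?m)"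
        by (rule pw) (use 2 n in \<open>auto simp: of_nat_diff\<close>)
      ultimately have "?N * (\<rho> j / \<rho> k) * ?y powr (2 * (real j - real k) / ?m) = ?y powr (2 / ?m) / 2"
        by (simp only:)
      also have "\<dots> = (if j = k + 1 then (if k = 0 \<or> j = n - 1 then 1 / 2 else 1) * ?y powr (2 / ?m) else 0)
          + (if j = 0 \<and> k = n - 2 then ?y powr (2 / ?m) / 2 else 0)
          + (if j = 1 \<and> k = n - 1 then ?y powr (2 / ?m) / 2 else 0)" using 2 by simp
      finally show ?thesis .
    next
      case 3
      have "?N = ?y\<^sup>2 / 4" unfolding norm_higgs_n2[OF jk n t] using 3 n by (auto simp: power_mult_distrib)
      moreover have "\<rho> j / \<rho> k = 2" unfolding \<rho>_def using 3 n by auto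
      moreover have "?y\<^sup>2 * ?y powr (2 * (real j - real k) / ?m) = ?y powr (2 / ?m)"
        by (rule pw) (use 3 n in \<open>auto simp: of_nat_diff\<close>)
      ultimately have "?N * (\<rho> j / \<rho> k) * ?y powr (2 * (real j - real k) / ?m) = ?y powr (2 / ?m) / 2"
        by (simp only:)
      also have "\<dots> = (if j = k + 1 then (if k = 0 \<or> j = n - 1 then 1 / 2 else 1) * ?y powr (2 / ?m) else 0)
          + (if j = 0 \<and> k = n - 2 then ?y powr (2 / ?m) / 2 else 0)
          + (if j = 1 \<and> k = n - 1 then ?y powr (2 / ?m) / 2 else 0)" using 3 n by simp
      finally show ?thesis .
    next
      case 4
      have "?N = 0" unfolding norm_higgs_n2[OF jk n t] using 4 by auto
      thus ?thesis unfolding if_not_P[OF 4(1)] if_not_P[OF 4(2)] if_not_P[OF 4(3)] by simp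
    qed
  qed
  finally show ?thesis unfolding f[OF jk(1)] f[OF jk(2)] .
qed

section \<open>Balance and connectedness of the two graphs\<close>

lemma asymptotics_n1:
  fixes q :: "'a chart \<Rightarrow> complex \<Rightarrow> complex"
  assumes op: "\<And>c. c \<in> A \<Longrightarrow> open (image_of c)" and n: "n \<ge> 2"
    and q: "q c holomorphic_on image_of c" "q c z0 \<noteq> 0" and c: "c \<in> A" "z0 \<in> image_of c"
    and harm: "\<And>t. t > 0 \<Longrightarrow> harmonic_metric A \<sigma> n (higgs_field n (e_n1 n) q t) (H t)" and a: "a < n"
  shows "\<exists>r\<in>O[at_top](\<lambda>t. t powr (- 2 / real n)). \<forall>t>0.
    Re (H t c z0 $$ (a, a)) = (1 * t * norm (q c z0)) powr (- (real n - 1 - 2 * real a) / real n) * (1 + r t)"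
proof (rule decoupling_asymptotics[where s = "\<lambda>a. 1" and m = "real n" and K = "5 * real n"
      and T = "{(j, k). j < n \<and> k < n \<and> (j = k + 1 \<or> (j = 0 \<and> k = n - 1))}" and \<phi> = "higgs_field n (e_n1 n) q" and \<sigma> = \<sigma> and A = A
      and q = "q c" and ?z0.0 = z0 and H = H and c = c and a = a and n = n])
  show "higgs_field n (e_n1 n) q t c z \<in> carrier_mat n n" for t z
    by (rule higgs_field_carrier[OF e_n1_carrier])
next
  fix t :: real assume t: "t > 0"
  show "hitchin_solution A \<sigma> n (higgs_field n (e_n1 n) q t) (H t)"
    using harm[OF t] unfolding harmonic_metric_def by blast
  show "H t c z $$ (i, j) = 0" if "z \<in> image_of c" "i < n" "j < n" "i \<noteq> j" for z i j
    by (rule harmonic_metric_n1_diagonal[OF op n harm[OF t] c(1) that])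
  fix z assume qz: "q c z \<noteq> 0"
  note ew = edge_weight_n1[of n t q c z, OF n t qz]
  let ?B = "(t * norm (q c z)) powr (2 / real n)"
  show "(\<Sum>k<n. (norm (higgs_field n (e_n1 n) q t c z $$ (j, k)))\<^sup>2
        * (1 * t * norm (q c z)) powr (- (real n - 1 - 2 * real j) / real n)
        / (1 * t * norm (q c z)) powr (- (real n - 1 - 2 * real k) / real n))
    = (\<Sum>k<n. (norm (higgs_field n (e_n1 n) q t c z $$ (k, j)))\<^sup>2
        * (1 * t * norm (q c z)) powr (- (real n - 1 - 2 * real k) / real n)
        / (1 * t * norm (q c z)) powr (- (real n - 1 - 2 * real j) / real n))" (is "?l = ?r") if j: "j < n" for j
  proof -
    \<comment> \<open>On a single cycle every vertex has one outgoing and one incoming edge, both of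
      weight \<open>?B\<close>.\<close>
    have "?l = (\<Sum>k<n. (if j = k + 1 then ?B else 0) + (if k = n - 1 then (if j = 0 then ?B else 0) else 0))"
      by (intro sum.cong refl) (use ew j in auto)
    also have "\<dots> = ?B"
      using j n sum_indicator_shift(1)[OF j, of "\<lambda>k. ?B"] by (simp add: sum.distrib)
    also have "\<dots> = (\<Sum>k<n. (if k = j + 1 then ?B else 0) + (if k = 0 then (if j = n - 1 then ?B else 0) else 0))"
      using j n sum_indicator_shift(2)[OF j, of "\<lambda>k. ?B"] by (auto simp: sum.distrib)
    also have "\<dots> = ?r" by (intro sum.cong refl) (use ew j in auto)
    finally show ?thesis .
  qed
  show "(t * norm (q c z)) powr (2 / real n) / 2 \<le> (norm (higgs_field n (e_n1 n) q t c z $$ (j, k)))\<^sup>2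
        * (1 * t * norm (q c z)) powr (- (real n - 1 - 2 * real j) / real n)
        / (1 * t * norm (q c z)) powr (- (real n - 1 - 2 * real k) / real n)"
    if "(j, k) \<in> {(j, k). j < n \<and> k < n \<and> (j = k + 1 \<or> (j = 0 \<and> k = n - 1))}" for j k
    using that ew[of j k] by auto
next
  fix v :: "nat \<Rightarrow> real" and M j k
  assume M: "0 \<le> M" and e: "\<And>j k. (j, k) \<in> {(j, k). j < n \<and> k < n \<and> (j = k + 1 \<or> (j = 0 \<and> k = n - 1))} \<Longrightarrow> v j - v k \<le> M"
    and jk: "j < n" "k < n"
  have st: "v l - v i \<le> n * M" if "i \<le> l" "l < n" for i l
    using steps_bound[of M n v i l] M e that by auto
  have "M \<le> n * M" using M n mult_right_mono[of 1 "real n" M] by simp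
  \<comment> \<open>Walk from \<open>j\<close> down to 0, over the closing edge to n - 1, and down
    to \<open>k\<close>: (2 n + 1) M, within the 5 n M that the longer walk of the second family
    takes.\<close>
  moreover have "v j - v 0 \<le> n * M" "v (n - 1) - v k \<le> n * M" using st jk by auto
  moreover have "v 0 - v (n - 1) \<le> M" using e n by auto
  ultimately have "v j - v k \<le> 5 * (n * M)" using M by (smt (verit) mult_nonneg_nonneg of_nat_0_le_iff)
  thus "v j - v k \<le> 5 * real n * M" by (simp add: mult_ac)
qed (use op c q n a in auto)

lemma asymptotics_n2:
  fixes q :: "'a chart \<Rightarrow> complex \<Rightarrow> complex"
  assumes op: "\<And>c. c \<in> A \<Longrightarrow> open (image_of c)" and n: "n \<ge> 3"
    and q: "q c holomorphic_on image_of c" "q c z0 \<noteq> 0" and c: "c \<in> A" "z0 \<in> image_of c"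
    and harm: "\<And>t. t > 0 \<Longrightarrow> harmonic_metric A \<sigma> n (higgs_field n (e_n2 n) q t) (H t)" and a: "a < n"
  defines "s \<equiv> \<lambda>a. if a = 0 \<or> a = n - 1 then 1 else 2 :: real"
  shows "\<exists>r\<in>O[at_top](\<lambda>t. t powr (- 2 / (real n - 1))). \<forall>t>0.
    Re (H t c z0 $$ (a, a)) = (s a * t * norm (q c z0)) powr (- (real n - 1 - 2 * real a) / (real n - 1)) * (1 + r t)"
proof (rule decoupling_asymptotics[where s = s and m = "real n - 1" and K = "5 * real n"
      and T = "{(j, k). j < n \<and> k < n \<and> (j = k + 1 \<or> (j = 0 \<and> k = n - 2) \<or> (j = 1 \<and> k = n - 1))}"
      and \<phi> = "higgs_field n (e_n2 n) q" and \<sigma> = \<sigma> and A = A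
      and q = "q c" and ?z0.0 = z0 and H = H and c = c and a = a and n = n])
  show "higgs_field n (e_n2 n) q t c z \<in> carrier_mat n n" for t z
    by (rule higgs_field_carrier[OF e_n2_carrier])
next
  fix t :: real assume t: "t > 0"
  show "hitchin_solution A \<sigma> n (higgs_field n (e_n2 n) q t) (H t)"
    using harm[OF t] unfolding harmonic_metric_def by blast
  show "H t c z $$ (i, j) = 0" if "z \<in> image_of c" "i < n" "j < n" "i \<noteq> j" for z i j
    by (rule harmonic_metric_n2_diagonal[OF op n harm[OF t] c(1) that])
  fix z assume qz: "q c z \<noteq> 0"
  let ?B = "(2 * t * norm (q c z)) powr (2 / (real n - 1))"
  have ew: "(norm (higgs_field n (e_n2 n) q t c z $$ (j, k)))\<^sup>2
      * (s j * t * norm (q c z)) powr (- (real n - 1 - 2 * real j) / (real n - 1))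
      / (s k * t * norm (q c z)) powr (- (real n - 1 - 2 * real k) / (real n - 1))
    = (if j = k + 1 then (if k = 0 \<or> j = n - 1 then 1 / 2 else 1) * ?B else 0)
      + (if j = 0 \<and> k = n - 2 then ?B / 2 else 0) + (if j = 1 \<and> k = n - 1 then ?B / 2 else 0)"
    if "j < n" "k < n" for j k
    unfolding s_def by (rule edge_weight_n2[where q = q and c = c and z = z, OF n t qz that])
  show "(\<Sum>k<n. (norm (higgs_field n (e_n2 n) q t c z $$ (j, k)))\<^sup>2
        * (s j * t * norm (q c z)) powr (- (real n - 1 - 2 * real j) / (real n - 1))
        / (s k * t * norm (q c z)) powr (- (real n - 1 - 2 * real k) / (real n - 1)))
    = (\<Sum>k<n. (norm (higgs_field n (e_n2 n) q t c z $$ (k, j)))\<^sup>2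
        * (s k * t * norm (q c z)) powr (- (real n - 1 - 2 * real k) / (real n - 1))
        / (s j * t * norm (q c z)) powr (- (real n - 1 - 2 * real j) / (real n - 1)))" (is "?l = ?r") if j: "j < n" for j
  proof -
    have "?l = (\<Sum>k<n. (if j = k + 1 then (if k = 0 \<or> j = n - 1 then 1 / 2 else 1) * ?B else 0)
        + (if k = n - 2 then (if j = 0 then ?B / 2 else 0) else 0)
        + (if k = n - 1 then (if j = 1 then ?B / 2 else 0) else 0))"
      by (intro sum.cong refl) (simp only: lessThan_iff ew[OF j] if_conj_swap)
    also have "\<dots> = (if j = 0 then 0 else (if j - 1 = 0 \<or> j = n - 1 then 1 / 2 else 1) * ?B)
        + (if j = 0 then ?B / 2 else 0) + (if j = 1 then ?B / 2 else 0)"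
      using n sum_indicator_shift(1)[OF j, of "\<lambda>k. (if k = 0 \<or> j = n - 1 then 1 / 2 else 1) * ?B"]
      by (simp only: sum.distrib sum.delta finite_lessThan) simp
    \<comment> \<open>Flow out of \<open>j\<close> against flow into \<open>j\<close>. For n = 3
      vertex 1 is also n - 2 and meets both closing edges, hence its separate case.\<close>
    also have "\<dots> = (if j + 1 < n then (if j = 0 \<or> j + 1 = n - 1 then 1 / 2 else 1) * ?B else 0)
        + (if j = n - 2 then ?B / 2 else 0) + (if j = n - 1 then ?B / 2 else 0)"
    proof -
      consider "j = 0" | "j = 1" "n = 3" | "j = 1" "n \<noteq> 3" | "j \<noteq> 0" "j \<noteq> 1" "j = n - 1"
        | "j \<noteq> 0" "j \<noteq> 1" "j = n - 2" | "j \<noteq> 0" "j \<noteq> 1" "j + 2 < n" using j n by linarith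
      thus ?thesis using n by cases auto
    qed
    also have "\<dots> = (\<Sum>k<n. (if k = j + 1 then (if j = 0 \<or> k = n - 1 then 1 / 2 else 1) * ?B else 0)
        + (if k = 0 then (if j = n - 2 then ?B / 2 else 0) else 0)
        + (if k = 1 then (if j = n - 1 then ?B / 2 else 0) else 0))"
      using n sum_indicator_shift(2)[OF j, of "\<lambda>k. (if j = 0 \<or> k = n - 1 then 1 / 2 else 1) * ?B"]
      by (simp only: sum.distrib sum.delta finite_lessThan) simp
    also have "\<dots> = ?r" by (intro sum.cong refl) (simp only: lessThan_iff ew[OF _ j] if_conj_nest)
    finally show ?thesis .
  qed
  \<comment> \<open>The smallest weights are half of \<open>?B\<close>; this is the reason for the
    \<open>/ 2\<close> in the lower bound required by \<open>decoupling_asymptotics\<close>.\<close>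
  have le: "(t * norm (q c z)) powr (2 / (real n - 1)) \<le> ?B"
    using t n by (intro powr_mono2) auto
  moreover have "(t * norm (q c z)) powr (2 / (real n - 1)) \<le> ?B * 2"
    by (rule order.trans[OF le]) simp
  ultimately show "(t * norm (q c z)) powr (2 / (real n - 1)) / 2 \<le> (norm (higgs_field n (e_n2 n) q t c z $$ (j, k)))\<^sup>2
        * (s j * t * norm (q c z)) powr (- (real n - 1 - 2 * real j) / (real n - 1))
        / (s k * t * norm (q c z)) powr (- (real n - 1 - 2 * real k) / (real n - 1))"
    if "(j, k) \<in> {(j, k). j < n \<and> k < n \<and> (j = k + 1 \<or> (j = 0 \<and> k = n - 2) \<or> (j = 1 \<and> k = n - 1))}" for j k
    using that n by (subst ew) auto
next
  fix v :: "nat \<Rightarrow> real" and M j k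
  assume M: "0 \<le> M" and e: "\<And>j k. (j, k) \<in> {(j, k). j < n \<and> k < n \<and>
      (j = k + 1 \<or> (j = 0 \<and> k = n - 2) \<or> (j = 1 \<and> k = n - 1))} \<Longrightarrow> v j - v k \<le> M"
    and jk: "j < n" "k < n"
  have st: "v l - v i \<le> n * M" if "i \<le> l" "l < n" for i l
    using steps_bound[of M n v i l] M e that by auto
  have "M \<le> n * M" using M n mult_right_mono[of 1 "real n" M] by simp
  \<comment> \<open>Walk from \<open>j\<close> down to 0, jump to n - 2, down to 1, jump to n - 1,
    down to \<open>k\<close>: three descents and two jumps cost 3 n M + 2 M \<le> 5 n M.\<close>
  moreover have "v j - v 0 \<le> n * M" "v (n - 2) - v 1 \<le> n * M" "v (n - 1) - v k \<le> n * M" using st jk n by auto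
  moreover have "v 0 - v (n - 2) \<le> M" "v 1 - v (n - 1) \<le> M" using e n by auto
  ultimately have "v j - v k \<le> 5 * (n * M)" by linarith
  thus "v j - v k \<le> 5 * real n * M" by (simp add: mult_ac)
qed (use op c q n a in \<open>auto simp: s_def\<close>)

theorem theorem3p1:
  fixes X :: "'a topology" and A :: "'a chart set" and g n :: nat
    and \<sigma> :: "'a chart \<Rightarrow> 'a chart \<Rightarrow> complex \<Rightarrow> complex"
  assumes "closed_riemann_surface X A"
    and "has_genus X g" and "g \<ge> 2"
    and "sqrt_canonical A \<sigma>"
  shows
    "(n \<ge> 2 \<longrightarrow>
       (\<forall>(q :: 'a chart \<Rightarrow> complex \<Rightarrow> complex)
         (H :: real \<Rightarrow> 'a chart \<Rightarrow> complex \<Rightarrow> complex mat).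
          holomorphic_differential A n q \<and> nonzero_differential A q \<and>
          (\<forall>t>0. harmonic_metric A \<sigma> n (higgs_field n (e_n1 n) q t) (H t)) \<longrightarrow>
          (\<forall>c\<in>A. \<forall>p\<in>cdom c. q c (coord c p) \<noteq> 0 \<longrightarrow>
             (\<forall>j\<in>{1..n}. \<exists>r\<in>O[at_top](\<lambda>t::real. t powr (- 2 / real n)). \<forall>t>0.
                summand_metric (H t) j c (coord c p) =
                  (t * cmod (q c (coord c p))) powr (- (real n + 1 - 2 * real j) / real n)
                    * (1 + r t)))))
     \<and>
     (n \<ge> 3 \<longrightarrow>
       (\<forall>(q :: 'a chart \<Rightarrow> complex \<Rightarrow> complex)
         (H :: real \<Rightarrow> 'a chart \<Rightarrow> complex \<Rightarrow> complex mat).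
          holomorphic_differential A (n - 1) q \<and> nonzero_differential A q \<and>
          (\<forall>t>0. harmonic_metric A \<sigma> n (higgs_field n (e_n2 n) q t) (H t)) \<longrightarrow>
          (\<forall>c\<in>A. \<forall>p\<in>cdom c. q c (coord c p) \<noteq> 0 \<longrightarrow>
             (\<forall>j\<in>{1..n}. \<exists>r\<in>O[at_top](\<lambda>t::real. t powr (- 2 / (real n - 1))). \<forall>t>0.
                summand_metric (H t) j c (coord c p) =
                  (if j = 1 \<or> j = n
                   then (t * cmod (q c (coord c p)))
                          powr (- (real n + 1 - 2 * real j) / (real n - 1))
                   else (2 * t * cmod (q c (coord c p)))
                          powr (- (real n + 1 - 2 * real j) / (real n - 1)))
                    * (1 + r t)))))"

proof (intro conjI impI allI ballI)
  have op: "open (image_of c)" if "c \<in> A" for c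
    using assms(1) that unfolding closed_riemann_surface_def is_chart_def by blast
  fix q :: "'a chart \<Rightarrow> complex \<Rightarrow> complex" and H :: "real \<Rightarrow> 'a chart \<Rightarrow> complex \<Rightarrow> complex mat" and c p j
  assume n: "n \<ge> 2"
    and h: "holomorphic_differential A n q \<and> nonzero_differential A q \<and>
      (\<forall>t>0. harmonic_metric A \<sigma> n (higgs_field n (e_n1 n) q t) (H t))"
    and c: "c \<in> A" and p: "p \<in> cdom c" and q0: "q c (coord c p) \<noteq> 0" and j: "j \<in> {1..n}"
  have z: "coord c p \<in> image_of c" using p unfolding image_of_def by blast
  have hol: "q c holomorphic_on image_of c" using h c unfolding holomorphic_differential_def by blast
  \<comment> \<open>Passage from the summand number to the matrix index; j \<ge> 1 makes the natural
    subtraction exact.\<close>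
  have e: "- (real n - 1 - 2 * real (j - 1)) = - (real n + 1 - 2 * real j)" using j by (simp add: of_nat_diff)
  show "\<exists>r\<in>O[at_top](\<lambda>t::real. t powr (- 2 / real n)). \<forall>t>0.
      summand_metric (H t) j c (coord c p) =
        (t * cmod (q c (coord c p))) powr (- (real n + 1 - 2 * real j) / real n) * (1 + r t)"
    using asymptotics_n1[where q = q and c = c and ?z0.0 = "coord c p" and a = "j - 1" and H = H and \<sigma> = \<sigma>, OF op n hol q0 c z] h j
    unfolding e summand_metric_def by auto
next
  have op: "open (image_of c)" if "c \<in> A" for c
    using assms(1) that unfolding closed_riemann_surface_def is_chart_def by blast
  fix q :: "'a chart \<Rightarrow> complex \<Rightarrow> complex" and H :: "real \<Rightarrow> 'a chart \<Rightarrow> complex \<Rightarrow> complex mat" and c p j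
  assume n: "n \<ge> 3"
    and h: "holomorphic_differential A (n - 1) q \<and> nonzero_differential A q \<and>
      (\<forall>t>0. harmonic_metric A \<sigma> n (higgs_field n (e_n2 n) q t) (H t))"
    and c: "c \<in> A" and p: "p \<in> cdom c" and q0: "q c (coord c p) \<noteq> 0" and j: "j \<in> {1..n}"
  have z: "coord c p \<in> image_of c" using p unfolding image_of_def by blast
  have hol: "q c holomorphic_on image_of c" using h c unfolding holomorphic_differential_def by blast
  have e: "- (real n - 1 - 2 * real (j - 1)) = - (real n + 1 - 2 * real j)" using j by (simp add: of_nat_diff)
  have e2: "j - 1 = 0 \<or> j - 1 = n - 1 \<longleftrightarrow> j = 1 \<or> j = n" using j n by auto
  have "\<exists>r\<in>O[at_top](\<lambda>t. t powr (- 2 / (real n - 1))). \<forall>t>0. Re (H t c (coord c p) $$ (j - 1, j - 1)) =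
      ((if j - 1 = 0 \<or> j - 1 = n - 1 then 1 else 2) * t * cmod (q c (coord c p)))
        powr (- (real n - 1 - 2 * real (j - 1)) / (real n - 1)) * (1 + r t)"
    by (rule asymptotics_n2[where q = q and c = c and ?z0.0 = "coord c p" and a = "j - 1" and H = H and \<sigma> = \<sigma>, OF op n hol q0 c z]) (use h j in auto)
  thus "\<exists>r\<in>O[at_top](\<lambda>t::real. t powr (- 2 / (real n - 1))). \<forall>t>0.
      summand_metric (H t) j c (coord c p) =
        (if j = 1 \<or> j = n
         then (t * cmod (q c (coord c p))) powr (- (real n + 1 - 2 * real j) / (real n - 1))
         else (2 * t * cmod (q c (coord c p))) powr (- (real n + 1 - 2 * real j) / (real n - 1)))
          * (1 + r t)"
    unfolding e e2 summand_metric_def by (cases "j = 1 \<or> j = n") simp_all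
qed

end
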